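(* The subring of automorphic forms for $G$ expanding integrally at the cusp $i\infty$ is given by $$M^{\mathbb{Z}}_{*}(G)\cong\mathbb{Z}[\alpha,\Delta_{G}],$$ a polynomial ring on $\alpha$ and $\Delta_G$, where $\Delta_{G}=2^{6}\epsilon'(\epsilon'-\delta'^{2})$ is the normalized cusp form.
   Context: $U(1,1;\mathbb{Z}[i])$ is the group of matrices $g$ with entries in $\mathbb{Z}[i]$ satisfying $\bar g^{tr}Hg=H$, $H=\mathrm{diag}(1,-1)$. Put $g_0=\frac{1}{\sqrt2}\begin{pmatrix}1&i\\ i&1\end{pmatrix}$ and $G=g_0\,U(1,1;\mathbb{Z}[i])\,g_0^{-1}\subset GL_2(\mathbb{C})$, which acts on the upper half plane $\mathbb{H}_1$ by fractional linear transformations. An automorphic form of weight $k$ for $G$ is a holomorphic function $f$ on $\mathbb{H}_1$ with $f(\frac{a\tau+b}{c\tau+d})=(c\tau+d)^kf(\tau)$ for all $\begin{pmatrix}a&b\\c&d\end{pmatrix}\in G$, holomorphic at the unique cusp $i\infty$ (i.e. with a power series expansion in $q^{1/2}$, $q=e^{2\pi i\tau}$). $M^{\mathbb{C}}_*(G)$ is the ring of automorphic forms for $G$, graded by degree (twice the weight), and $M^{\mathbb{Z}}_*(G)$ is the subring of forms whose expansion lies in $\mathbb{Z}[\![q^{1/2}]\!]$. Let $\theta[\begin{smallmatrix}1\\0\end{smallmatrix}](\tau)=\sum_{n\in\mathbb{Z}}e^{\pi i(n+1/2)^2\tau}$, $\theta[\begin{smallmatrix}0\\1\end{smallmatrix}](\tau)=\sum_{n\in\mathbb{Z}}(-1)^ne^{\pi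 i n^2\tau}$ and $\delta'=\frac18(\theta[\begin{smallmatrix}1\\0\end{smallmatrix}]^4-\theta[\begin{smallmatrix}0\\1\end{smallmatrix}]^4)$, $\epsilon'=-\frac1{16}\theta[\begin{smallmatrix}1\\0\end{smallmatrix}]^4\theta[\begin{smallmatrix}0\\1\end{smallmatrix}]^4$. Then $\alpha=-2^{7}(\epsilon'-\frac{1}{2}\delta'^{2})$, an automorphic form of weight $4$ for $G$. *)

theory Defs
  imports
    "HOL-Complex_Analysis.Complex_Analysis"
    "HOL-Computational_Algebra.Polynomial"
    "HOL-Algebra.QuotRing"
    "HOL-Decision_Procs.Algebra_Aux"
    "HOL-Library.Poly_Mapping"
    "HOL-Library.Function_Algebras"
begin

definition gaussian_integers :: "complex set" where
  "gaussian_integers = {z. Re z \<in> \<int> \<and> Im z \<in> \<int>}"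

definition conj_transpose :: "complex^2^2 \<Rightarrow> complex^2^2" where
  "conj_transpose A = (\<chi> i j. cnj (A $ j $ i))"

definition herm_H :: "complex^2^2" where
  "herm_H = vector [vector [1, 0], vector [0, -1]]"

definition U11_gauss :: "(complex^2^2) set" where
  "U11_gauss = {g. (\<forall>i j. g $ i $ j \<in> gaussian_integers) \<and>
                   conj_transpose g ** herm_H ** g = herm_H}"

definition g0 :: "complex^2^2" where
  "g0 = (\<chi> i j. complex_of_real (1 / sqrt 2) *
                 (vector [vector [1, \<i>], vector [\<i>, 1]] :: complex^2^2) $ i $ j)"

definition group_G :: "(complex^2^2) set" where
  "group_G = {g0 ** g ** matrix_inv g0 | g. g \<in> U11_gauss}"

definition upper_half_plane :: "complex set" where
  "upper_half_plane = {\<tau>. Im \<tau> > 0}"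

definition automorphy_factor :: "complex^2^2 \<Rightarrow> complex \<Rightarrow> complex" where
  "automorphy_factor g \<tau> = g $ 2 $ 1 * \<tau> + g $ 2 $ 2"

definition frac_linear :: "complex^2^2 \<Rightarrow> complex \<Rightarrow> complex" where
  "frac_linear g \<tau> = (g $ 1 $ 1 * \<tau> + g $ 1 $ 2) / (g $ 2 $ 1 * \<tau> + g $ 2 $ 2)"

text \<open>Expansions are in the variable \<open>q\<^sup>1\<^sup>/\<^sup>2 = exp (\<pi> \<i> \<tau>)\<close>.\<close>

definition has_q_expansion :: "(complex \<Rightarrow> complex) \<Rightarrow> (nat \<Rightarrow> complex) \<Rightarrow> bool" where
  "has_q_expansion f a \<longleftrightarrow>
     (\<forall>\<tau>\<in>upper_half_plane. (\<lambda>n. a n * exp (pi * \<i> * \<tau>) ^ n) sums f \<tau>)"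

text \<open>A function on the upper half plane is represented by the total function that vanishes
  off the upper half plane, so that equality of forms is equality in HOL.\<close>

definition on_uhp :: "(complex \<Rightarrow> complex) \<Rightarrow> complex \<Rightarrow> complex" where
  "on_uhp f = (\<lambda>\<tau>. if \<tau> \<in> upper_half_plane then f \<tau> else 0)"

definition automorphic_forms :: "int \<Rightarrow> (complex \<Rightarrow> complex) set" where
  "automorphic_forms k = {f.
     f holomorphic_on upper_half_plane \<and>
     (\<forall>g\<in>group_G. \<forall>\<tau>\<in>upper_half_plane.
        f (frac_linear g \<tau>) = automorphy_factor g \<tau> powi k * f \<tau>) \<and>
     (\<exists>a. has_q_expansion f a) \<and>
     (\<forall>\<tau>. \<tau> \<notin> upper_half_plane \<longrightarrow> f \<tau> = 0)}"

definition integral_expansion :: "(complex \<Rightarrow> complex) \<Rightarrow> bool" where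
  "integral_expansion f \<longleftrightarrow> (\<exists>a :: nat \<Rightarrow> int. has_q_expansion f (\<lambda>n. of_int (a n)))"

definition normalized_cusp_form :: "int \<Rightarrow> (complex \<Rightarrow> complex) \<Rightarrow> bool" where
  "normalized_cusp_form k f \<longleftrightarrow>
     f \<in> automorphic_forms k \<and> (\<exists>a. has_q_expansion f a \<and> a 0 = 0 \<and> a 1 = 1)"

text \<open>The graded rings are direct sums over the degree, which is twice the weight. An element is
  the finitely supported family of its homogeneous components; the product of the type
  \<open>int \<Rightarrow>\<^sub>0 (complex \<Rightarrow> complex)\<close> is the convolution product over the pointwise product of
  functions. The unit of that type is not zero off the upper half plane, hence \<open>homog 0 1\<close>.\<close>

definition homog :: "int \<Rightarrow> (complex \<Rightarrow> complex) \<Rightarrow> (int \<Rightarrow>\<^sub>0 (complex \<Rightarrow> complex))" where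
  "homog d f = Poly_Mapping.single d (on_uhp f)"

definition forms_ring_C :: "(int \<Rightarrow>\<^sub>0 (complex \<Rightarrow> complex)) ring" where
  "forms_ring_C = \<lparr>
     carrier = {F. \<forall>k. Poly_Mapping.lookup F (2 * k) \<in> automorphic_forms k \<and> Poly_Mapping.lookup F (2 * k + 1) = 0},
     mult = (*), one = homog 0 (\<lambda>_. 1), zero = 0, add = (+)\<rparr>"

text \<open>Integrality is a condition on every homogeneous component: a sum of forms of different
  weights can expand integrally although its components do not.\<close>

definition forms_ring_Z :: "(int \<Rightarrow>\<^sub>0 (complex \<Rightarrow> complex)) ring" where
  "forms_ring_Z = forms_ring_C
     \<lparr>carrier := {F \<in> carrier forms_ring_C. \<forall>d. integral_expansion (Poly_Mapping.lookup F d)}\<rparr>"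

definition theta_10 :: "complex \<Rightarrow> complex" where
  "theta_10 \<tau> = (\<Sum>\<^sub>\<infinity>n\<in>(UNIV :: int set). exp (pi * \<i> * (of_int n + 1 / 2)\<^sup>2 * \<tau>))"

definition theta_01 :: "complex \<Rightarrow> complex" where
  "theta_01 \<tau> = (\<Sum>\<^sub>\<infinity>n\<in>(UNIV :: int set). (-1) powi n * exp (pi * \<i> * (of_int n)\<^sup>2 * \<tau>))"

definition delta' :: "complex \<Rightarrow> complex" where
  "delta' \<tau> = 1 / 8 * (theta_10 \<tau> ^ 4 - theta_01 \<tau> ^ 4)"

definition epsilon' :: "complex \<Rightarrow> complex" where
  "epsilon' \<tau> = - (1 / 16) * theta_10 \<tau> ^ 4 * theta_01 \<tau> ^ 4"

definition alpha :: "complex \<Rightarrow> complex" where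
  "alpha \<tau> = - (2 ^ 7) * (epsilon' \<tau> - 1 / 2 * (delta' \<tau>)\<^sup>2)"

definition Delta_G :: "complex \<Rightarrow> complex" where
  "Delta_G \<tau> = 2 ^ 6 * epsilon' \<tau> * (epsilon' \<tau> - (delta' \<tau>)\<^sup>2)"

text \<open>\<open>\<int>[X, Y]\<close> as \<open>(\<int>[X])[Y]\<close>.\<close>

definition ZXY :: "int poly poly ring" where
  "ZXY = cring_class_ops"

definition var_X :: "int poly poly" where
  "var_X = [:[:0, 1:]:]"

definition var_Y :: "int poly poly" where
  "var_Y = [:0, 1:]"

end

theory Submission
  imports Defs "HOL-Real_Asymp.Real_Asymp"
begin

text \<open>
  All functions are written in the nome \<open>w = exp (\<pi> \<i> \<tau>)\<close>, which maps the upper half plane onto the punctured unit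
  disc. Put \<open>x = \<theta>\<^sub>1\<^sub>0\<^sup>4\<close>, \<open>y = \<theta>\<^sub>0\<^sub>1\<^sup>4\<close> and \<open>z = x + y\<close>. By Jacobi's identity \<open>z = \<theta>\<^sub>0\<^sub>0\<^sup>4\<close>, and a computation gives
  \<open>\<alpha> = z\<^sup>2 + 4 x y\<close> and \<open>\<Delta> = x y z\<^sup>2 / 16\<close>.

  \<^emph>\<open>Why these are automorphic.\<close> The group \<open>G\<close> is generated by the translation \<open>\<tau> \<mapsto> \<tau> + 2\<close>, the scalar \<open>\<i>\<close> and
  a rotation of order four about the point \<open>\<i>\<close> (lemma \<open>group_G_subset_gens\<close>): up to a power of the rotation and a scalar,
  an element of \<open>G\<close> lies in the theta group, where Euclid's algorithm applies. The theta group has two cusps, and the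
  rotation exchanges them. Accordingly it exchanges \<open>z\<^sup>2\<close> and \<open>4 x y\<close> up to the automorphy factor (lemma \<open>rot_theta\<close>),
  so their sum and their product are automorphic for \<open>G\<close>. This rests on elementary doubling relations between theta
  series and on the inversion formula \<open>\<tau> \<mapsto> -1/\<tau>\<close>. The latter is obtained on the imaginary axis as the limit of a
  finite identity between cosine powers and binomial coefficients (theorem \<open>gauss_sum_inversion\<close>), and elsewhere by
  analytic continuation.

  \<^emph>\<open>Why there are no others.\<close> The scalar \<open>\<i>\<close> forces the weight of a nonzero form to be a multiple of four. The
  rotation moves every point, after a translation, to height at least \<open>1/2\<close>; so a form of weight zero, seen as a
  function on the unit disc, attains its maximum modulus inside and is constant. The doubling relations also show that
  theta constants have no zeros, so \<open>\<Delta>\<close> is the nome times a unit, and comparison with powers of \<open>\<Delta>\<close> excludes negative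
  weights. Given a form of weight \<open>4 m\<close>, subtract a multiple of \<open>\<alpha>\<^sup>m\<close> to make it vanish at the cusp and divide by
  \<open>\<Delta>\<close>; the weight drops by eight, and induction shows that the form is a polynomial in \<open>\<alpha>\<close> and \<open>\<Delta>\<close>. If the
  expansion is integral, the subtracted multiple is integral, and so is the quotient, because the unit part of \<open>\<Delta>\<close> has
  integer coefficients and constant term one. Finally \<open>\<alpha>\<close> and \<open>\<Delta>\<close> are algebraically independent because \<open>\<alpha>\<close> has
  value one at the cusp and \<open>\<Delta>\<close> vanishes there.
\<close>

section \<open>A finite form of the theta inversion\<close>

text \<open>Orthogonality of the characters of \<open>\<int>/l\<int>\<close>, as a geometric sum.\<close>
lemma sum_cis_multiples:
  fixes t :: int and l :: nat
  assumes "l > 0"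
  shows "(\<Sum>j<l. cis (2 * pi * real j * real_of_int t / real l)) = (if int l dvd t then of_nat l else 0)"
proof -
  define w where "w = cis (2 * pi * real_of_int t / real l)"
  have pw: "cis (2 * pi * real j * real_of_int t / real l) = w ^ j" for j
    unfolding w_def Complex.DeMoivre by (simp add: algebra_simps)
  have wl: "w ^ l = 1"
  proof -
    have "w ^ l = cis (2 * pi * real_of_int t)"
      using assms unfolding w_def Complex.DeMoivre by simp
    thus ?thesis by (simp add: cis_multiple_2pi)
  qed
  show ?thesis
  proof (cases "int l dvd t")
    case True
    then obtain c where "t = int l * c" by blast
    hence "2 * pi * real_of_int t / real l = 2 * pi * real_of_int c" using assms by simp
    hence "w = cis (2 * pi * real_of_int c)" by (simp only: w_def)
    hence "w = 1" by (simp only: cis_multiple_2pi Ints_of_int)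
    thus ?thesis using True by (simp add: pw)
  next
    case False
    have "w \<noteq> 1"
    proof
      assume "w = 1"
      then obtain c :: int where "2 * pi * real_of_int t / real l = 2 * pi * of_int c"
        by (auto simp: w_def complex_eq_iff cos_one_2pi_int)
      hence "real_of_int t = real_of_int (c * int l)" using assms by (simp add: field_simps)
      hence "t = c * int l" by linarith
      with False show False by simp
    qed
    thus ?thesis using False by (simp add: pw geometric_sum wl)
  qed
qed

lemma cos_power_even_expansion:
  "(2 * complex_of_real (cos x)) ^ (2 * m) = (\<Sum>r\<le>2*m. of_nat ((2*m) choose r) * cis (2 * x * (real r - real m)))"
proof -
  have "2 * complex_of_real (cos x) = cis x + cis (- x)"
    by (simp add: complex_eq_iff)
  hence "(2 * complex_of_real (cos x)) ^ (2 * m) =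
      (\<Sum>r\<le>2*m. of_nat ((2*m) choose r) * cis x ^ r * cis (- x) ^ (2*m - r))"
    by (simp only: binomial_ring)
  also have "\<dots> = (\<Sum>r\<le>2*m. of_nat ((2*m) choose r) * cis (2 * x * (real r - real m)))"
  proof (intro sum.cong refl)
    fix r assume "r \<in> {..2*m}"
    hence "real r * x + real (2*m - r) * (- x) = 2 * x * (real r - real m)"
      by (simp add: of_nat_diff algebra_simps)
    thus "of_nat ((2*m) choose r) * cis x ^ r * cis (- x) ^ (2*m - r) =
        of_nat ((2*m) choose r) * cis (2 * x * (real r - real m))"
      by (simp only: Complex.DeMoivre cis_mult mult.assoc)
  qed
  finally show ?thesis .
qed

text \<open>The binomial coefficients on the residue class of \<open>m\<close> modulo \<open>l\<close>, listed by their distance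
  from the centre; the reflection \<open>r \<mapsto> 2m - r\<close> preserves the class. The bound \<open>k < m\<close> is generous: the
  coefficients with \<open>(k + 1) l > m\<close> are zero.\<close>
lemma sum_multiples_binomial:
  assumes "l > 0"
  shows "(\<Sum>r\<le>2*m. if int l dvd int r - int m then real ((2*m) choose r) else 0) =
         real ((2*m) choose m) + 2 * (\<Sum>k<m. real ((2*m) choose (m + Suc k * l)))"
proof -
  define f where "f r = (if int l dvd int r - int m then real ((2*m) choose r) else 0)" for r
  have split: "{..2*m} = {..<m} \<union> ({m} \<union> {m<..2*m})" by auto
  have "sum f {..2*m} = sum f {..<m} + (f m + sum f {m<..2*m})"
    unfolding split by (subst sum.union_disjoint; (subst sum.union_disjoint)?; auto)
  moreover have "sum f {..<m} = sum f {m<..2*m}"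
  proof (rule sum.reindex_bij_witness[of _ "\<lambda>r. 2*m - r" "\<lambda>r. 2*m - r"])
    fix r assume r: "r \<in> {..<m}"
    have "int (2*m - r) - int m = - (int r - int m)" using r by auto
    hence "(int l dvd int (2*m - r) - int m) = (int l dvd int r - int m)"
      by (metis dvd_minus_iff)
    thus "f (2*m - r) = f r"
      using r binomial_symmetric[of r "2*m"] by (simp add: f_def)
  qed auto
  moreover have "sum f {m<..2*m} = (\<Sum>k<m. real ((2*m) choose (m + Suc k * l)))"
  proof -
    have "(\<Sum>k<m. real ((2*m) choose (m + Suc k * l))) = (\<Sum>k\<in>{k. k < m \<and> Suc k * l \<le> m}. real ((2*m) choose (m + Suc k * l)))"
      by (intro sum.mono_neutral_right) (auto simp: not_le)
    also have "\<dots> = (\<Sum>r\<in>{r\<in>{m<..2*m}. int l dvd int r - int m}. real ((2*m) choose r))"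
    proof (rule sum.reindex_bij_witness[of _ "\<lambda>r. (r - m) div l - 1" "\<lambda>k. m + Suc k * l"])
      fix r assume r: "r \<in> {r\<in>{m<..2*m}. int l dvd int r - int m}"
      hence "int l dvd int (r - m)" by (simp add: of_nat_diff)
      then obtain c where c: "r - m = c * l" by (metis dvd_def int_dvd_int_iff mult.commute)
      have "c > 0" using c r by (cases c) auto
      hence d: "Suc ((r - m) div l - 1) = c" using assms c by simp
      show "m + Suc ((r - m) div l - 1) * l = r" using r unfolding d c[symmetric] by auto
      have "c \<le> c * l" using assms by simp
      moreover have "c * l \<le> m" using c r by auto
      ultimately have "c \<le> m" "c * l \<le> m" by linarith+
      thus "(r - m) div l - 1 \<in> {k. k < m \<and> Suc k * l \<le> m}"
        using d \<open>c > 0\<close> by auto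
    qed (use assms in auto)
    also have "\<dots> = sum f {m<..2*m}"
      unfolding f_def by (subst sum.inter_filter) auto
    finally show ?thesis by simp
  qed
  ultimately show ?thesis unfolding f_def by simp
qed

text \<open>Poisson summation on \<open>\<int>/l\<int>\<close> for an even power of the cosine: expand
  \<open>(2 cos (\<pi> j / l))\<^sup>2\<^sup>m\<close> by the binomial theorem and sum over all residues \<open>j\<close>, so that
  only every \<open>l\<close>-th binomial coefficient survives. In the limit both sides become Gaussian sums, and the
  identity becomes the inversion formula of the theta function (this argument goes back to Polya).\<close>
lemma finite_theta_identity:
  fixes N m :: nat
  defines "l \<equiv> 2*N+1"
  shows "1 + 2 * (\<Sum>k<N. cos (pi * real (Suc k) / real l) ^ (2*m)) =
     real l / 4 ^ m * (real ((2*m) choose m) + 2 * (\<Sum>k<m. real ((2*m) choose (m + Suc k * l))))"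
proof -
  have l: "l > 0" by (simp add: l_def)
  define g where "g j = cos (pi * real j / real l) ^ (2*m)" for j
  have "complex_of_real (4 ^ m * (\<Sum>j<l. g j)) =
      (\<Sum>j<l. (2 * complex_of_real (cos (pi * real j / real l))) ^ (2*m))"
    by (simp add: g_def sum_distrib_left power_mult_distrib power_mult)
  also have "\<dots> = (\<Sum>j<l. \<Sum>r\<le>2*m. of_nat ((2*m) choose r) * cis (2 * (pi * real j / real l) * (real r - real m)))"
    by (simp only: cos_power_even_expansion)
  also have "\<dots> = (\<Sum>r\<le>2*m. of_nat ((2*m) choose r) * (\<Sum>j<l. cis (2 * pi * real j * real_of_int (int r - int m) / real l)))"
    by (subst sum.swap) (simp add: sum_distrib_left mult_ac)
  also have "\<dots> = complex_of_real (real l * (\<Sum>r\<le>2*m. if int l dvd int r - int m then real ((2*m) choose r) else 0))"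
    unfolding sum_cis_multiples[OF l] of_real_mult of_real_sum sum_distrib_left
    by (intro sum.cong) auto
  finally have 1: "4 ^ m * (\<Sum>j<l. g j) = real l * (real ((2*m) choose m) + 2 * (\<Sum>k<m. real ((2*m) choose (m + Suc k * l))))"
    unfolding of_real_eq_iff sum_multiples_binomial[OF l] .
  have eq: "{..<l} = insert 0 (Suc ` {..<N} \<union> {N<..2*N})"
  proof (rule Set.set_eqI)
    fix x show "x \<in> {..<l} \<longleftrightarrow> x \<in> insert 0 (Suc ` {..<N} \<union> {N<..2*N})"
      by (cases x) (auto simp: l_def image_iff)
  qed
  have disj: "Suc ` {..<N} \<inter> {N<..2*N} = {}" and nz: "0 \<notin> Suc ` {..<N} \<union> {N<..2*N}" by auto
  have "(\<Sum>j<l. g j) = g 0 + (sum g (Suc ` {..<N}) + sum g {N<..2*N})"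
    unfolding eq by (subst sum.insert[OF _ nz], simp, subst sum.union_disjoint[OF _ _ disj]) (rule finite_imageI finite_lessThan finite_greaterThanAtMost refl)+
  also have "sum g (Suc ` {..<N}) = (\<Sum>k<N. g (Suc k))"
    by (simp add: sum.reindex)
  also have "sum g {N<..2*N} = (\<Sum>k<N. g (Suc k))"
  proof (rule sum.reindex_bij_witness[of _ "\<lambda>k. 2*N - k" "\<lambda>j. 2*N - j"])
    fix j assume j: "j \<in> {N<..2*N}"
    have "real (Suc (2*N - j)) = real l - real j" using j by (auto simp: l_def of_nat_diff)
    hence "pi * real (Suc (2*N - j)) / real l = pi - pi * real j / real l"
      using l by (simp only:) (simp add: field_simps)
    hence "cos (pi * real (Suc (2*N - j)) / real l) = - cos (pi * real j / real l)" by simp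
    thus "g (Suc (2*N - j)) = g j" unfolding g_def by (simp only: power_mult power2_minus)
  qed auto
  finally have "(\<Sum>j<l. g j) = 1 + 2 * (\<Sum>k<N. g (Suc k))" by (simp add: g_def)
  with 1 show ?thesis by (simp add: g_def field_simps)
qed

text \<open>A Gaussian majorant for the cosine powers. The product \<open>cos u \<cdot> exp (u\<^sup>2/2)\<close> decreases because
  \<open>u cos u \<le> sin u\<close>, which in turn holds because \<open>sin u - u cos u\<close> has derivative \<open>u sin u\<close>.\<close>
lemma cos_le_exp_neg_half_square:
  fixes x :: real
  assumes "0 \<le> x" "x \<le> pi/2"
  shows "cos x \<le> exp (- x\<^sup>2/2)"
proof -
  have A: "y * cos y \<le> sin y" if "0 \<le> y" "y \<le> pi/2" for y :: real
  proof -
    have "sin 0 - 0 * cos 0 \<le> sin y - y * cos y"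
    proof (rule DERIV_nonneg_imp_nondecreasing[OF that(1)])
      fix u assume "0 \<le> u" "u \<le> y"
      hence "0 \<le> u * sin u" using that by (intro mult_nonneg_nonneg sin_ge_zero) auto
      moreover have "((\<lambda>u. sin u - u * cos u) has_real_derivative u * sin u) (at u)"
        by (auto intro!: derivative_eq_intros simp: algebra_simps)
      ultimately show "\<exists>d. ((\<lambda>u. sin u - u * cos u) has_real_derivative d) (at u) \<and> 0 \<le> d" by blast
    qed
    thus ?thesis by simp
  qed
  have "cos x * exp (x\<^sup>2/2) \<le> cos 0 * exp (0\<^sup>2/2)"
  proof (rule DERIV_nonpos_imp_nonincreasing[OF assms(1)])
    fix u assume u: "0 \<le> u" "u \<le> x"
    have "exp (u\<^sup>2/2) * (u * cos u - sin u) \<le> 0"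
      using A[of u] u assms by (intro mult_nonneg_nonpos) auto
    moreover have "((\<lambda>u. cos u * exp (u\<^sup>2/2)) has_real_derivative exp (u\<^sup>2/2) * (u * cos u - sin u)) (at u)"
      by (auto intro!: derivative_eq_intros simp: algebra_simps)
    ultimately show "\<exists>d. ((\<lambda>u. cos u * exp (u\<^sup>2/2)) has_real_derivative d) (at u) \<and> d \<le> 0" by blast
  qed
  thus ?thesis by (simp add: exp_minus field_simps)
qed

text \<open>The central binomial coefficients are up to sign and a power of four the coefficients of
  \<open>(1 + x)\<^sup>-\<^sup>1\<^sup>/\<^sup>2\<close>; their growth is governed by \<open>\<Gamma>(1/2) = \<surd>\<pi>\<close>.\<close>
lemma central_binomial_asymptotics:
  "(\<lambda>m. sqrt (real m) * real ((2*m) choose m) / 4 ^ m) \<longlonglongrightarrow> 1 / sqrt pi"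
proof -
  have half: "(-1/2 :: real) gchoose n = (-1) ^ n * real ((2*n) choose n) / 4 ^ n" for n
  proof (induction n)
    case (Suc n)
    have e1: "real (n+1) * ((-1/2 :: real) gchoose Suc n) = (-1/2 - real n) * ((-1/2) gchoose n)"
      using gbinomial_mult_1[of "-1/2::real" n] by (simp add: algebra_simps)
    have e2: "(n+1) * ((2 * Suc n) choose Suc n) = 2 * (2*n+1) * ((2*n) choose n)"
    proof -
      have "Suc n * ((2 * Suc n) choose Suc n) = (2*n+2) * ((2*n+1) choose n)"
        using Suc_times_binomial[of n "2*n+1"] by (simp del: binomial_Suc_Suc)
      moreover have "Suc n * (Suc (2*n) choose n) = Suc (2*n) * ((2*n) choose n)"
        using binomial_absorb_comp[of "Suc (2*n)" n] by (simp del: binomial_Suc_Suc)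
      ultimately have "Suc n * (Suc n * ((2 * Suc n) choose Suc n)) = Suc n * (2 * (2*n+1) * ((2*n) choose n))"
        by (simp add: algebra_simps)
      thus ?thesis by (simp only: mult_cancel1) simp
    qed
    have conv: "real (n+1) * real a = 2 * (2 * real n + 1) * real b" if "(n+1) * a = 2 * (2*n+1) * b" for a b
      using arg_cong[OF that, of real] by (simp add: algebra_simps)
    have lin: "x * g' = x * (- s * c' / (4 * p))"
      if "x * g' = (-1/2 - y) * (s * c / p)" "x * c' = 2 * (2 * y + 1) * c" "p > 0" for x g' y s c p c' :: real
    proof -
      have "x * (- s * c' / (4 * p)) = - (x * c') * s / (4 * p)" by simp
      also have "\<dots> = - (2 * (2 * y + 1) * c) * s / (4 * p)" by (simp only: that(2))
      also have "\<dots> = (-1/2 - y) * (s * c / p)" using that(3) by (simp add: field_simps)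
      finally show ?thesis using that(1) by simp
    qed
    have "real (n+1) * ((-1/2 :: real) gchoose Suc n) =
       real (n+1) * (- ((-1) ^ n) * real ((2*Suc n) choose Suc n) / (4 * 4 ^ n))"
      by (rule lin[OF e1[unfolded Suc] conv[OF e2]]) simp
    thus ?case by (simp only: mult_cancel_left) simp
  qed simp
  have "(\<lambda>n. ((-1/2 :: real) gchoose n) / ((-1)^n / exp ((-1/2+1) * of_real (ln (real n))))) \<longlonglongrightarrow> inverse (Gamma (- (-1/2)))"
    by (rule gbinomial_asymptotic)
  hence "(\<lambda>n. ((-1/2 :: real) gchoose n) / ((-1)^n / exp ((-1/2+1) * of_real (ln (real n))))) \<longlonglongrightarrow> 1 / sqrt pi"
    by (simp add: Gamma_one_half_real field_simps)
  moreover have "eventually (\<lambda>n. ((-1/2 :: real) gchoose n) / ((-1)^n / exp ((-1/2+1) * of_real (ln (real n)))) =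
     sqrt (real n) * real ((2*n) choose n) / 4 ^ n) sequentially"
    using eventually_gt_at_top[of 0]
  proof eventually_elim
    case (elim n)
    have "exp ((-1/2+1) * of_real (ln (real n))) = sqrt (real n)"
      using elim by (simp add: powr_half_sqrt[symmetric] powr_def)
    thus ?case unfolding half by (cases "even n") auto
  qed
  ultimately show ?thesis by (rule Lim_transform_eventually)
qed

lemma binomial_over_central:
  assumes "r \<le> m"
  shows "real ((2*m) choose (m + r)) = real ((2*m) choose m) * (\<Prod>i<r. (real m - real i) / (real m + real i + 1))"
  using assms
proof (induction r)
  case (Suc r)
  have absorb: "Suc (m+r) * ((2*m) choose Suc (m+r)) = (2*m - (m+r)) * ((2*m) choose (m+r))"
    by (simp only: binomial_absorb_comp binomial_absorption)
  have "real (Suc (m+r)) * real ((2*m) choose Suc (m+r)) = (real m - real r) * real ((2*m) choose (m+r))"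
  proof -
    have "real (Suc k) * real a = (real m - real r) * real b" if "Suc k * a = (2*m - (m + r)) * b" for k a b
      using arg_cong[OF that, of real] Suc.prems by (simp add: of_nat_diff algebra_simps)
    from this[OF absorb] show ?thesis .
  qed
  hence "real ((2*m) choose (m + Suc r)) = real ((2*m) choose (m+r)) * ((real m - real r) / (real m + real r + 1))"
    by (simp add: field_simps)
  also have "real ((2*m) choose (m+r)) = real ((2*m) choose m) * (\<Prod>i<r. (real m - real i) / (real m + real i + 1))"
    using Suc by simp
  finally show ?case by (simp only: prod.lessThan_Suc mult.assoc)
qed simp

text \<open>The odd numbers below \<open>2r\<close> sum to \<open>r\<^sup>2\<close>.\<close>
lemma prod_exp_odd: "(\<Prod>i<r. exp (- (2 * real i + 1) / x)) = exp (- (real r)\<^sup>2 / x)"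
proof (induction r)
  case (Suc r)
  have "- (real r)\<^sup>2 / x + - (2 * real r + 1) / x = - (real (Suc r))\<^sup>2 / x"
    unfolding add_divide_distrib[symmetric] by (simp add: power2_eq_square algebra_simps)
  thus ?case by (simp only: prod.lessThan_Suc Suc.IH mult_exp_exp)
qed simp

text \<open>Each factor of the ratio is \<open>1 - (2i + 1)/(m + i + 1)\<close>; bound it by an exponential. Together with the
  lower bound below this is a local limit theorem for the binomial distribution.\<close>
lemma binomial_over_central_le:
  assumes "r \<le> m" "0 < m"
  shows "real ((2*m) choose (m + r)) / real ((2*m) choose m) \<le> exp (- (real r)\<^sup>2 / (real m + real r))"
proof -
  have "real ((2*m) choose (m + r)) / real ((2*m) choose m) = (\<Prod>i<r. (real m - real i) / (real m + real i + 1))"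
    unfolding binomial_over_central[OF assms(1)] by simp
  also have "\<dots> \<le> (\<Prod>i<r. exp (- (2 * real i + 1) / (real m + real r)))"
  proof (rule prod_mono, safe)
    fix i assume i: "i < r"
    show "0 \<le> (real m - real i) / (real m + real i + 1)" using i assms by simp
    have "(real m - real i) / (real m + real i + 1) = 1 + - ((2 * real i + 1) / (real m + real i + 1))"
      by (simp add: field_simps)
    also have "\<dots> \<le> 1 + - ((2 * real i + 1) / (real m + real r))"
      using i assms by (auto intro!: divide_left_mono)
    also have "\<dots> \<le> exp (- ((2 * real i + 1) / (real m + real r)))" by (rule exp_ge_add_one_self)
    finally show "(real m - real i) / (real m + real i + 1) \<le> exp (- (2 * real i + 1) / (real m + real r))" by (simp only: minus_divide_left)
  qed
  also have "\<dots> = exp (- (real r)\<^sup>2 / (real m + real r))"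
    by (simp only: prod_exp_odd)
  finally show ?thesis .
qed

text \<open>The same estimate for the reciprocal factors \<open>1 + (2i + 1)/(m - i)\<close>.\<close>
lemma binomial_over_central_ge:
  assumes "r < m"
  shows "exp (- (real r)\<^sup>2 / (real m - real r)) \<le> real ((2*m) choose (m + r)) / real ((2*m) choose m)"
proof -
  have "exp (- (real r)\<^sup>2 / (real m - real r)) = (\<Prod>i<r. exp (- (2 * real i + 1) / (real m - real r)))"
    by (simp only: prod_exp_odd)
  also have "\<dots> \<le> (\<Prod>i<r. (real m - real i) / (real m + real i + 1))"
  proof (rule prod_mono, safe)
    fix i assume i: "i < r"
    have "(real m + real i + 1) / (real m - real i) = 1 + (2 * real i + 1) / (real m - real i)"
      using i assms by (simp add: field_simps)
    moreover have "(2 * real i + 1) / (real m - real i) \<le> (2 * real i + 1) / (real m - real r)"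
      using i assms by (intro divide_left_mono mult_pos_pos) simp_all
    moreover have "1 + (2 * real i + 1) / (real m - real r) \<le> exp ((2 * real i + 1) / (real m - real r))"
      by (rule exp_ge_add_one_self)
    ultimately have le: "(real m + real i + 1) / (real m - real i) \<le> exp ((2 * real i + 1) / (real m - real r))"
      by linarith
    have "0 < (real m + real i + 1) / (real m - real i)"
      using i assms by (intro divide_pos_pos) simp_all
    from le_imp_inverse_le[OF le this]
    show "exp (- (2 * real i + 1) / (real m - real r)) \<le> (real m - real i) / (real m + real i + 1)"
      by (simp only: exp_minus[symmetric] minus_divide_left inverse_divide)
  qed simp
  also have "\<dots> = real ((2*m) choose (m + r)) / real ((2*m) choose m)"
    using assms by (subst binomial_over_central) auto
  finally show ?thesis .
qed

section \<open>Theta inversion on the imaginary axis\<close>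

text \<open>The full Gaussian sum over \<open>\<int>\<close> is \<open>1 + 2 gauss_tail s\<close>.\<close>
definition gauss_tail :: "real \<Rightarrow> real" where
  "gauss_tail s = (suminf (\<lambda>k. exp (- (pi * s * (real (Suc k))\<^sup>2))))"

text \<open>Termwise \<open>cos (\<pi> j / l)\<^sup>2\<^sup>m\<close> tends to \<open>exp (- \<pi> s j\<^sup>2)\<close> when \<open>m \<sim> s l\<^sup>2 / \<pi>\<close>; the Gaussian majorant of the
  cosine justifies the exchange of limit and sum.\<close>
lemma cosine_sums_limit:
  fixes m :: "nat \<Rightarrow> nat" and s :: real
  assumes s: "s > 0" and m: "(\<lambda>N. real (m N) / (2 * real N + 1)\<^sup>2) \<longlonglongrightarrow> s / pi"
  shows "(\<lambda>N. \<Sum>k<N. cos (pi * real (Suc k) / real (2*N+1)) ^ (2 * m N)) \<longlonglongrightarrow> gauss_tail s"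
proof -
  define a where "a k N = (if k < N then cos (pi * real (Suc k) / (2 * real N + 1)) ^ (2 * m N) else 0)" for k N
  have "(\<lambda>N. suminf (\<lambda>k. a k N)) \<longlonglongrightarrow> gauss_tail s"
    unfolding gauss_tail_def
  proof (rule conjunct2[OF conjunct2[OF tannerys_theorem]])
    fix k
    let ?j = "real (Suc k)"
    have "(\<lambda>N. 2 * (2*real N+1)^2 * ln (cos (pi * ?j / (2*real N+1)))) \<longlonglongrightarrow> - (pi * ?j * (pi * ?j))"
      by real_asymp
    from tendsto_exp[OF tendsto_mult[OF m this]]
    have "(\<lambda>N. exp (real (m N) / (2 * real N + 1)\<^sup>2 * (2 * (2*real N+1)^2 * ln (cos (pi * ?j / (2*real N+1))))))
         \<longlonglongrightarrow> exp (- (pi * s * ?j\<^sup>2))"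
      by (simp add: power2_eq_square mult_ac)
    moreover have "eventually (\<lambda>N. exp (real (m N) / (2 * real N + 1)\<^sup>2 * (2 * (2*real N+1)^2 * ln (cos (pi * ?j / (2*real N+1)))))
       = a k N) sequentially"
      using eventually_gt_at_top[of k]
    proof eventually_elim
      case (elim N)
      have "pi * ?j / (2*real N+1) < pi / 2"
      proof -
        have "?j * 2 < 2 * real N + 1" using elim by simp
        thus ?thesis by (simp add: divide_simps)
      qed
      hence c: "cos (pi * ?j / (2*real N+1)) > 0" by (intro cos_gt_zero_pi) (auto intro: less_le_trans[of _ 0])
      have "real (m N) / (2 * real N + 1)\<^sup>2 * (2 * (2*real N+1)^2 * ln (cos (pi * ?j / (2*real N+1))))
          = real (2 * m N) * ln (cos (pi * ?j / (2*real N+1)))"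
        by (simp add: divide_simps)
      also have "exp \<dots> = cos (pi * ?j / (2*real N+1)) ^ (2 * m N)"
        using c by (simp only: exp_of_nat_mult exp_ln)
      finally show ?case using elim by (simp add: a_def)
    qed
    ultimately show "a k \<longlonglongrightarrow> exp (- (pi * s * ?j\<^sup>2))" by (rule Lim_transform_eventually)
  next
    have "eventually (\<lambda>N. real (m N) / (2 * real N + 1)\<^sup>2 > s / (2 * pi)) sequentially"
      using s by (intro order_tendstoD(1)[OF m]) (simp add: field_simps)
    hence "eventually (\<lambda>N. \<forall>k. norm (a k N) \<le> exp (- (s * pi / 2)) ^ Suc k) sequentially"
    proof eventually_elim
      case (elim N)
      show ?case
      proof
        fix k
        let ?x = "pi * real (Suc k) / (2 * real N + 1)"
        show "norm (a k N) \<le> exp (- (s * pi / 2)) ^ Suc k"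
        proof (cases "k < N")
          case True
          have "real (Suc k) * 2 \<le> 2 * real N + 1" using True by simp
          hence x: "0 \<le> ?x" "?x \<le> pi / 2" by (simp_all add: divide_simps)
          have c: "cos ?x \<ge> 0" using x(2) by (intro cos_ge_zero order_trans[OF _ x(1)]) auto
          have "norm (a k N) = cos ?x ^ (2 * m N)" using True c by (simp add: a_def)
          also have "\<dots> \<le> exp (- ?x\<^sup>2 / 2) ^ (2 * m N)"
            using c by (intro power_mono cos_le_exp_neg_half_square x)
          also have "\<dots> = exp (real (2 * m N) * (- ?x\<^sup>2 / 2))" by (simp only: exp_of_nat_mult)
          also have "real (2 * m N) * (- ?x\<^sup>2 / 2) = - (real (m N) / (2 * real N + 1)\<^sup>2 * (pi * real (Suc k))\<^sup>2)"
            by (simp add: power_divide)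
          also have "\<dots> \<le> - (s / (2 * pi) * (pi\<^sup>2 * real (Suc k)))"
          proof -
            have "real (Suc k) \<le> (real (Suc k))\<^sup>2" by (simp add: power2_eq_square)
            hence "pi\<^sup>2 * real (Suc k) \<le> (pi * real (Suc k))\<^sup>2"
              unfolding power_mult_distrib by (intro mult_left_mono) auto
            thus ?thesis using elim s by (intro le_imp_neg_le mult_mono) auto
          qed
          also have "\<dots> = real (Suc k) * (- (s * pi / 2))" by (simp add: power2_eq_square)
          finally show ?thesis by (simp only: exp_of_nat_mult exp_le_cancel_iff)
        qed (simp add: a_def)
      qed
    qed
    thus "\<forall>\<^sub>F (k, N) in sequentially \<times>\<^sub>F sequentially. norm (a k N) \<le> exp (- (s * pi / 2)) ^ Suc k"
      unfolding eventually_prod_filter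
      by (intro exI[of _ "\<lambda>_. True"] exI[of _ "\<lambda>N. \<forall>k. norm (a k N) \<le> exp (- (s * pi / 2)) ^ Suc k"]) auto
    show "summable (\<lambda>k. exp (- (s * pi / 2)) ^ Suc k)"
      using s by (subst summable_Suc_iff) (auto intro!: summable_geometric)
  qed simp
  moreover have "(suminf (\<lambda>k. a k N)) = (\<Sum>k<N. cos (pi * real (Suc k) / real (2*N+1)) ^ (2 * m N))" for N
    by (subst suminf_finite[of "{..<N}"]) (auto simp: a_def add.commute)
  ultimately show ?thesis by simp
qed

text \<open>The two-sided local limit estimate gives the limit of each term, since \<open>r = j l\<close> satisfies
  \<open>r\<^sup>2 / m \<rightarrow> \<pi> j\<^sup>2 / s\<close> and \<open>r / m \<rightarrow> 0\<close>. The upper estimate with \<open>m + r \<le> 2m\<close> gives the summable majorant;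
  there the exact inequality \<open>m \<le> s l\<^sup>2 / \<pi>\<close> is convenient.\<close>
lemma binomial_sums_limit:
  fixes m :: "nat \<Rightarrow> nat" and s :: real
  assumes s: "s > 0" and m: "(\<lambda>N. real (m N) / (2 * real N + 1)\<^sup>2) \<longlonglongrightarrow> s / pi"
    and le: "\<And>N. real (m N) \<le> s / pi * (2 * real N + 1)\<^sup>2"
  shows "(\<lambda>N. (\<Sum>k<m N. real ((2 * m N) choose (m N + Suc k * (2*N+1)))) / real ((2 * m N) choose m N)) \<longlonglongrightarrow> gauss_tail (1/s)"
proof -
  define b where "b k N = real ((2 * m N) choose (m N + Suc k * (2*N+1))) / real ((2 * m N) choose m N)" for k N
  have "(\<lambda>N. suminf (\<lambda>k. b k N)) \<longlonglongrightarrow> gauss_tail (1/s)"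
    unfolding gauss_tail_def
  proof (rule conjunct2[OF conjunct2[OF tannerys_theorem]])
    fix k
    let ?j = "real (Suc k)"
    let ?M = "\<lambda>N. real (m N) / (2 * real N + 1)\<^sup>2"
    have j: "(\<lambda>N. ?j / (2 * real N + 1)) \<longlonglongrightarrow> 0" by real_asymp
    have ne: "s / pi \<noteq> 0" using s by simp
    have L: "(\<lambda>N. exp (- (?j\<^sup>2 / (?M N - ?j / (2 * real N + 1))))) \<longlonglongrightarrow> exp (- (?j\<^sup>2 / (s / pi - 0)))"
      using ne by (intro tendsto_exp tendsto_minus tendsto_divide tendsto_diff tendsto_const m j) auto
    have U: "(\<lambda>N. exp (- (?j\<^sup>2 / (?M N + ?j / (2 * real N + 1))))) \<longlonglongrightarrow> exp (- (?j\<^sup>2 / (s / pi + 0)))"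
      using ne by (intro tendsto_exp tendsto_minus tendsto_divide tendsto_add tendsto_const m j) auto
    have "(\<lambda>N. ?M N - ?j / (2 * real N + 1)) \<longlonglongrightarrow> s / pi - 0" by (intro tendsto_diff m j)
    hence "eventually (\<lambda>N. ?M N - ?j / (2 * real N + 1) > 0) sequentially"
      by (rule order_tendstoD) (use s in simp)
    hence ev: "eventually (\<lambda>N. exp (- (?j\<^sup>2 / (?M N - ?j / (2 * real N + 1)))) \<le> b k N \<and>
        b k N \<le> exp (- (?j\<^sup>2 / (?M N + ?j / (2 * real N + 1))))) sequentially"
    proof eventually_elim
      case (elim N)
      define l where "l = 2 * real N + 1"
      have l: "l > 0" by (simp add: l_def)
      have r: "real (Suc k * (2*N+1)) = ?j * l" by (simp add: l_def algebra_simps)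
      define M where "M = ?M N"
      have mM: "real (m N) = M * l\<^sup>2" using l unfolding l_def M_def by simp
      have lt: "?j * l < real (m N)"
      proof -
        have "0 < l\<^sup>2 * (M - ?j / l)" using elim l unfolding l_def M_def by (intro mult_pos_pos) auto
        also have "\<dots> = real (m N) - ?j * l" using l unfolding mM by (simp add: field_simps power2_eq_square)
        finally show ?thesis by simp
      qed
      hence lt': "Suc k * (2*N+1) < m N" unfolding r[symmetric] of_nat_less_iff .
      have e1: "- (real (Suc k * (2*N+1)))\<^sup>2 / (real (m N) - real (Suc k * (2*N+1))) = - (?j\<^sup>2 / (M - ?j / (2 * real N + 1)))"
      proof -
        have "real (m N) - real (Suc k * (2*N+1)) = l\<^sup>2 * (M - ?j / l)"
          using l unfolding r mM by (simp add: field_simps power2_eq_square)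
        thus ?thesis using l unfolding r by (simp add: power_mult_distrib flip: l_def)
      qed
      have e2: "- (real (Suc k * (2*N+1)))\<^sup>2 / (real (m N) + real (Suc k * (2*N+1))) = - (?j\<^sup>2 / (M + ?j / (2 * real N + 1)))"
      proof -
        have "real (m N) + real (Suc k * (2*N+1)) = l\<^sup>2 * (M + ?j / l)"
          using l unfolding r mM by (simp add: field_simps power2_eq_square)
        thus ?thesis using l unfolding r by (simp add: power_mult_distrib flip: l_def)
      qed
      show ?case
        using binomial_over_central_ge[OF lt'] binomial_over_central_le[OF less_imp_le[OF lt']] lt'
        unfolding e1 e2 b_def M_def by simp
    qed
    have "b k \<longlonglongrightarrow> exp (- (?j\<^sup>2 / (s / pi)))"
    proof (rule tendsto_sandwich)
      show "\<forall>\<^sub>F N in sequentially. exp (- (?j\<^sup>2 / (?M N - ?j / (2 * real N + 1)))) \<le> b k N"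
        using ev by eventually_elim blast
      show "\<forall>\<^sub>F N in sequentially. b k N \<le> exp (- (?j\<^sup>2 / (?M N + ?j / (2 * real N + 1))))"
        using ev by eventually_elim blast
    qed (use L U in \<open>simp_all only: diff_zero add_0_right\<close>)
    thus "b k \<longlonglongrightarrow> exp (- (pi * (1/s) * ?j\<^sup>2))" by (simp add: field_simps)
  next
    have "norm (b k N) \<le> exp (- (pi / (2 * s))) ^ Suc k" for k N
    proof (cases "Suc k * (2*N+1) \<le> m N")
      case True
      let ?r = "Suc k * (2*N+1)"
      have m0: "m N > 0" using True by (cases "m N") auto
      have rr: "real ?r = real (Suc k) * (2 * real N + 1)" by (simp add: algebra_simps)
      have "norm (b k N) = b k N" by (simp add: b_def)
      also have "\<dots> \<le> exp (- (real ?r)\<^sup>2 / (real (m N) + real ?r))"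
        unfolding b_def by (rule binomial_over_central_le[OF True m0])
      also have "\<dots> \<le> exp (real (Suc k) * - (pi / (2 * s)))"
      proof -
        have "real (Suc k) * (pi / (2 * s)) * (real (m N) + real ?r) \<le> real (Suc k) * (pi / (2 * s)) * (2 * real (m N))"
        proof (intro mult_left_mono)
          have "real ?r \<le> real (m N)" using True unfolding of_nat_le_iff .
          thus "real (m N) + real ?r \<le> 2 * real (m N)" by linarith
        qed (use s in auto)
        also have "\<dots> \<le> real (Suc k) * (pi / (2 * s)) * (2 * (s / pi * (2 * real N + 1)\<^sup>2))"
          using le[of N] s by (intro mult_left_mono) auto
        also have "\<dots> = real (Suc k) * (2 * real N + 1)\<^sup>2" using s by simp
        also have "\<dots> \<le> (real (Suc k))\<^sup>2 * (2 * real N + 1)\<^sup>2"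
          by (intro mult_right_mono) (auto simp: power2_eq_square)
        also have "\<dots> = (real ?r)\<^sup>2" unfolding rr by (simp add: power_mult_distrib)
        finally have "real (Suc k) * (pi / (2 * s)) \<le> (real ?r)\<^sup>2 / (real (m N) + real ?r)"
          using m0 by (subst pos_le_divide_eq) (simp_all only: add_pos_nonneg of_nat_0_less_iff of_nat_0_le_iff)
        thus ?thesis by (simp only: exp_le_cancel_iff minus_divide_left[symmetric] mult_minus_right neg_le_iff_le)
      qed
      finally show ?thesis by (simp only: exp_of_nat_mult)
    next
      case False
      hence "b k N = 0" by (simp add: b_def binomial_eq_0)
      thus ?thesis by simp
    qed
    thus "\<forall>\<^sub>F (k, N) in sequentially \<times>\<^sub>F sequentially. norm (b k N) \<le> exp (- (pi / (2 * s))) ^ Suc k"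
      by (intro always_eventually) auto
    show "summable (\<lambda>k. exp (- (pi / (2 * s))) ^ Suc k)"
      using s by (subst summable_Suc_iff) (auto intro!: summable_geometric)
  qed simp
  moreover have "(suminf (\<lambda>k. b k N)) = (\<Sum>k<m N. real ((2 * m N) choose (m N + Suc k * (2*N+1)))) / real ((2 * m N) choose m N)" for N
  proof -
    have "(suminf (\<lambda>k. b k N)) = (\<Sum>k<m N. b k N)"
    proof (rule suminf_finite)
      fix k assume "k \<notin> {..<m N}"
      hence "m N < Suc k * (2*N+1)" by (auto simp: not_less intro: less_le_trans[of _ "Suc k"])
      thus "b k N = 0" by (simp add: b_def binomial_eq_0)
    qed simp
    thus ?thesis by (simp add: b_def sum_divide_distrib)
  qed
  ultimately show ?thesis by simp
qed

text \<open>Take \<open>l = 2N + 1\<close> and \<open>m = \<lfloor>s l\<^sup>2 / \<pi>\<rfloor>\<close> in the finite identity and let \<open>N\<close> grow. The prefactor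
  \<open>l 4\<^sup>-\<^sup>m (2m choose m)\<close> tends to \<open>1 / \<surd>s\<close>.\<close>
theorem gauss_sum_inversion:
  fixes s :: real
  assumes s: "s > 0"
  shows "sqrt s * (1 + 2 * gauss_tail s) = 1 + 2 * gauss_tail (1/s)"
proof -
  define m where "m N = nat \<lfloor>s / pi * (2 * real N + 1)\<^sup>2\<rfloor>" for N
  have m_le: "real (m N) \<le> s / pi * (2 * real N + 1)\<^sup>2" for N
    using s by (simp add: m_def)
  have m_ge: "s / pi * (2 * real N + 1)\<^sup>2 - 1 \<le> real (m N)" for N
    unfolding m_def by linarith
  have m: "(\<lambda>N. real (m N) / (2 * real N + 1)\<^sup>2) \<longlonglongrightarrow> s / pi"
  proof (rule tendsto_sandwich)
    show "(\<lambda>N. s / pi - 1 / (2 * real N + 1)\<^sup>2) \<longlonglongrightarrow> s / pi" by real_asymp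
    show "(\<lambda>N. s / pi) \<longlonglongrightarrow> s / pi" by simp
    show "\<forall>\<^sub>F N in sequentially. s / pi - 1 / (2 * real N + 1)\<^sup>2 \<le> real (m N) / (2 * real N + 1)\<^sup>2"
    proof (intro always_eventually allI)
      fix N
      have "s / pi - 1 / (2 * real N + 1)\<^sup>2 = (s / pi * (2 * real N + 1)\<^sup>2 - 1) / (2 * real N + 1)\<^sup>2"
        by (simp add: diff_divide_distrib)
      also have "\<dots> \<le> real (m N) / (2 * real N + 1)\<^sup>2" by (intro divide_right_mono m_ge) auto
      finally show "s / pi - 1 / (2 * real N + 1)\<^sup>2 \<le> real (m N) / (2 * real N + 1)\<^sup>2" .
    qed
    show "\<forall>\<^sub>F N in sequentially. real (m N) / (2 * real N + 1)\<^sup>2 \<le> s / pi"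
      using m_le by (intro always_eventually allI) (simp add: pos_divide_le_eq)
  qed
  have m_top: "filterlim m at_top sequentially"
    unfolding m_def using s by real_asymp
  define c where "c N = (2 * real N + 1) / 4 ^ m N * real ((2 * m N) choose m N)" for N
  have "(\<lambda>N. sqrt (real (m N)) * real ((2 * m N) choose m N) / 4 ^ m N) \<longlonglongrightarrow> 1 / sqrt pi"
    using filterlim_compose[OF central_binomial_asymptotics m_top] .
  moreover have "(\<lambda>N. sqrt (real (m N) / (2 * real N + 1)\<^sup>2)) \<longlonglongrightarrow> sqrt (s / pi)"
    by (intro tendsto_real_sqrt m)
  ultimately have "(\<lambda>N. sqrt (real (m N)) * real ((2 * m N) choose m N) / 4 ^ m N / sqrt (real (m N) / (2 * real N + 1)\<^sup>2))
       \<longlonglongrightarrow> 1 / sqrt pi / sqrt (s / pi)"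
    by (rule tendsto_divide) (use s in simp)
  moreover have "eventually (\<lambda>N. sqrt (real (m N)) * real ((2 * m N) choose m N) / 4 ^ m N / sqrt (real (m N) / (2 * real N + 1)\<^sup>2) = c N) sequentially"
    using eventually_compose_filterlim[OF eventually_gt_at_top[of 0] m_top]
    by eventually_elim (simp add: c_def real_sqrt_divide divide_simps)
  ultimately have c: "c \<longlonglongrightarrow> 1 / sqrt pi / sqrt (s / pi)" by (rule Lim_transform_eventually)
  hence c: "c \<longlonglongrightarrow> 1 / sqrt s" using s by (simp add: real_sqrt_divide)
  have "(\<lambda>N. 1 + 2 * (\<Sum>k<N. cos (pi * real (Suc k) / real (2*N+1)) ^ (2 * m N))) \<longlonglongrightarrow> 1 + 2 * gauss_tail s"
    by (intro tendsto_intros cosine_sums_limit s m)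
  moreover have "1 + 2 * (\<Sum>k<N. cos (pi * real (Suc k) / real (2*N+1)) ^ (2 * m N)) =
     c N * (1 + 2 * ((\<Sum>k<m N. real ((2 * m N) choose (m N + Suc k * (2*N+1)))) / real ((2 * m N) choose m N)))" for N
  proof -
    have "real ((2 * m N) choose m N) > 0" by simp
    thus ?thesis unfolding finite_theta_identity c_def
      by (simp only: distrib_left) (simp add: field_simps)
  qed
  ultimately have "(\<lambda>N. c N * (1 + 2 * ((\<Sum>k<m N. real ((2 * m N) choose (m N + Suc k * (2*N+1)))) / real ((2 * m N) choose m N))))
     \<longlonglongrightarrow> 1 + 2 * gauss_tail s" by simp
  moreover have "(\<lambda>N. c N * (1 + 2 * ((\<Sum>k<m N. real ((2 * m N) choose (m N + Suc k * (2*N+1)))) / real ((2 * m N) choose m N))))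
     \<longlonglongrightarrow> 1 / sqrt s * (1 + 2 * gauss_tail (1/s))"
    by (intro tendsto_intros c binomial_sums_limit s m m_le)
  ultimately have "1 + 2 * gauss_tail s = 1 / sqrt s * (1 + 2 * gauss_tail (1/s))"
    by (rule LIMSEQ_unique)
  thus ?thesis using s by simp
qed

section \<open>Power series with integer coefficients\<close>

text \<open>From here on \<open>abs_summable_on\<close> refers to limits along finite subsets rather than to integrals over the counting measure.\<close>
no_notation Infinite_Set_Sum.abs_summable_on (infix \<open>abs'_summable'_on\<close> 50)

text \<open>The series is required to converge on the whole unit disc, so that \<open>f\<close> is determined there by its
  coefficients and conversely.\<close>
definition int_series :: "(complex \<Rightarrow> complex) \<Rightarrow> bool" where
  "int_series f \<longleftrightarrow> (\<exists>a :: nat \<Rightarrow> int. \<forall>w. norm w < 1 \<longrightarrow> (\<lambda>n. of_int (a n) * w ^ n) sums f w)"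

lemma int_seriesI:
  fixes a :: "nat \<Rightarrow> int"
  assumes "\<And>w. norm w < 1 \<Longrightarrow> (\<lambda>n. of_int (a n) * w ^ n) sums f w"
  shows "int_series f"
  unfolding int_series_def using assms by (intro exI[of _ a]) simp

lemma int_seriesE:
  assumes "int_series f"
  obtains a :: "nat \<Rightarrow> int" where "\<And>w. norm w < 1 \<Longrightarrow> (\<lambda>n. of_int (a n) * w ^ n) sums f w"
proof -
  from assms obtain a :: "nat \<Rightarrow> int" where "\<forall>w. norm w < 1 \<longrightarrow> (\<lambda>n. of_int (a n) * w ^ n) sums f w"
    unfolding int_series_def ..
  thus thesis by (intro that[of a]) simp
qed

lemma int_series_imp_holomorphic: "int_series f \<Longrightarrow> f holomorphic_on ball 0 1"
  unfolding int_series_def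
proof (elim exE)
  fix a :: "nat \<Rightarrow> int"
  assume a: "\<forall>w. norm w < 1 \<longrightarrow> (\<lambda>n. of_int (a n) * w ^ n) sums f w"
  show "f holomorphic_on ball 0 1"
    by (rule power_series_holomorphic[where a = "\<lambda>n. of_int (a n)"]) (use a in simp)
qed

lemma int_series_const: "int_series (\<lambda>_. of_int c)"
proof -
  have "(\<lambda>n. of_int (if n = 0 then c else 0) * w ^ n) sums (of_int c :: complex)" for w
    using sums_finite[of "{0}" "\<lambda>n. of_int (if n = 0 then c else 0) * w ^ n"] by simp
  thus ?thesis unfolding int_series_def by (intro exI[of _ "\<lambda>n. if n = 0 then c else 0"]) simp
qed

lemma int_series_id: "int_series (\<lambda>w. w)"
proof -
  have "(\<lambda>n. of_int (if n = 1 then 1 else 0) * w ^ n) sums w" for w :: complex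
    using sums_finite[of "{1}" "\<lambda>n. of_int (if n = 1 then 1 else 0) * w ^ n"] by simp
  thus ?thesis unfolding int_series_def by (intro exI[of _ "\<lambda>n. if n = 1 then 1 else 0"]) simp
qed

lemma int_series_add:
  assumes "int_series f" "int_series g"
  shows "int_series (\<lambda>w. f w + g w)"
proof -
  obtain a b :: "nat \<Rightarrow> int"
    where ab: "\<And>w. norm w < 1 \<Longrightarrow> (\<lambda>n. of_int (a n) * w ^ n) sums f w"
      "\<And>w. norm w < 1 \<Longrightarrow> (\<lambda>n. of_int (b n) * w ^ n) sums g w"
    using int_seriesE[OF assms(1)] int_seriesE[OF assms(2)] by metis
  have "(\<lambda>n. of_int (a n + b n) * w ^ n) sums (f w + g w)" if "norm w < 1" for w
    using sums_add[OF ab[OF that]] by (simp add: distrib_right)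
  thus ?thesis by (rule int_seriesI)
qed

lemma int_series_uminus_arg: "int_series f \<Longrightarrow> int_series (\<lambda>w. f (- w))"
proof (elim int_seriesE)
  fix a :: "nat \<Rightarrow> int"
  assume a: "\<And>w. norm w < 1 \<Longrightarrow> (\<lambda>n. of_int (a n) * w ^ n) sums f w"
  have "(\<lambda>n. of_int (a n * (-1) ^ n) * w ^ n) sums f (- w)" if "norm w < 1" for w
  proof -
    have "of_int (a n) * (- w) ^ n = of_int (a n * (-1) ^ n) * w ^ n" for n
      by (subst power_minus) simp
    thus ?thesis using a[of "- w"] that by (simp only: norm_minus_cancel)
  qed
  thus "int_series (\<lambda>w. f (- w))" by (rule int_seriesI)
qed

lemma int_series_mult:
  assumes "int_series f" "int_series g"
  shows "int_series (\<lambda>w. f w * g w)"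
proof -
  obtain a b :: "nat \<Rightarrow> int"
    where a: "\<And>w. norm w < 1 \<Longrightarrow> (\<lambda>n. of_int (a n) * w ^ n) sums f w"
      and b: "\<And>w. norm w < 1 \<Longrightarrow> (\<lambda>n. of_int (b n) * w ^ n) sums g w"
    using int_seriesE[OF assms(1)] int_seriesE[OF assms(2)] by metis
  have "(\<lambda>n. of_int (sum (\<lambda>i. a i * b (n - i)) {..n}) * w ^ n) sums (f w * g w)" if w: "norm w < 1" for w
  proof -
    \<comment> \<open>An intermediate radius gives absolute convergence at \<open>w\<close>.\<close>
    define r where "r = (1 + norm w) / 2"
    have r: "norm w < norm (complex_of_real r)" "norm (complex_of_real r) < 1" using w
      unfolding norm_of_real by (auto simp: r_def)
    have A: "summable (\<lambda>n. norm (of_int (a n) * w ^ n))"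
      by (rule powser_insidea[OF sums_summable[OF a[OF r(2)]] r(1)])
    have B: "summable (\<lambda>n. norm (of_int (b n) * w ^ n))"
      by (rule powser_insidea[OF sums_summable[OF b[OF r(2)]] r(1)])
    have "(\<lambda>n. \<Sum>i\<le>n. (of_int (a i) * w ^ i) * (of_int (b (n - i)) * w ^ (n - i))) sums
       ((suminf (\<lambda>n. of_int (a n) * w ^ n)) * (suminf (\<lambda>n. of_int (b n) * w ^ n)))"
      by (rule Cauchy_product_sums[OF A B])
    moreover have "(sum (\<lambda>i. (of_int (a i) * w ^ i) * (of_int (b (n - i)) * w ^ (n - i))) {..n}) =
        of_int (sum (\<lambda>i. a i * b (n - i)) {..n}) * w ^ n" for n
      unfolding of_int_sum sum_distrib_right
      by (intro sum.cong refl) (simp add: power_add[symmetric] mult_ac flip: power_add)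
    moreover have "suminf (\<lambda>n. of_int (a n) * w ^ n) = f w" "suminf (\<lambda>n. of_int (b n) * w ^ n) = g w"
      using a[OF w] b[OF w] by (simp_all add: sums_iff)
    ultimately show ?thesis by (simp only:)
  qed
  thus ?thesis by (rule int_seriesI)
qed

lemma int_series_power: "int_series f \<Longrightarrow> int_series (\<lambda>w. f w ^ n)"
proof (induction n)
  case 0
  show ?case using int_series_const[of 1] by simp
qed (auto intro: int_series_mult)

lemma int_series_sparse:
  assumes "strict_mono (e :: nat \<Rightarrow> nat)"
  shows "int_series (\<lambda>w. suminf (\<lambda>n. w ^ e n))"
    and "norm (w :: complex) < 1 \<Longrightarrow> summable (\<lambda>n. norm (w ^ e n))"
proof -
  have ge: "n \<le> e n" for n using strict_mono_imp_increasing[OF assms] by simp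
  show sm: "summable (\<lambda>n. norm (w ^ e n))" if "norm w < 1" for w :: complex
  proof (rule summable_comparison_test)
    show "\<exists>N. \<forall>n\<ge>N. norm (norm (w ^ e n)) \<le> norm w ^ n"
      using that ge by (intro exI[of _ 0] allI impI) (simp add: norm_power power_decreasing)
  qed (use that in \<open>simp add: summable_geometric\<close>)
  have "(\<lambda>n. of_int (if n \<in> range e then 1 else 0) * w ^ n) sums suminf (\<lambda>n. w ^ e n)" if "norm w < 1" for w :: complex
  proof (rule iffD1[OF sums_mono_reindex[OF assms]])
    show "(\<lambda>n. of_int (if e n \<in> range e then 1 else 0) * w ^ e n) sums suminf (\<lambda>n. w ^ e n)"
      using summable_sums[OF summable_norm_cancel[OF sm[OF that]]] by simp
  qed simp
  thus "int_series (\<lambda>w. suminf (\<lambda>n. w ^ e n))" by (rule int_seriesI)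
qed

section \<open>Theta constants as series in the nome\<close>

text \<open>With the nome \<open>w\<close> this is \<open>\<theta>\<^sub>0\<^sub>0\<close>; its value at \<open>- w\<close> is \<open>\<theta>\<^sub>0\<^sub>1\<close>. Working with functions of the nome turns
  \<open>\<tau> \<mapsto> \<tau> + 1\<close> into \<open>w \<mapsto> - w\<close> and \<open>\<tau> \<mapsto> 2\<tau>\<close> into \<open>w \<mapsto> w\<^sup>2\<close>.\<close>
definition theta3 :: "complex \<Rightarrow> complex" where
  "theta3 w = (\<Sum>\<^sub>\<infinity>n\<in>(UNIV :: int set). w ^ nat (n\<^sup>2))"

text \<open>This is \<open>\<theta>\<^sub>1\<^sub>0\<close> without its factor \<open>w\<^sup>1\<^sup>/\<^sup>4\<close>, which is not a function of the nome.\<close>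
definition theta2 :: "complex \<Rightarrow> complex" where
  "theta2 w = (\<Sum>\<^sub>\<infinity>n\<in>(UNIV :: int set). w ^ nat (n\<^sup>2 + n))"

text \<open>Sums over \<open>\<int>\<close> are split at zero by \<open>n \<mapsto> -1 - n\<close>. This reflection leaves \<open>n\<^sup>2 + n\<close> invariant.\<close>
lemma has_sum_int_split:
  fixes f :: "int \<Rightarrow> complex"
  assumes "summable (\<lambda>n. norm (f (int n)))" "summable (\<lambda>n. norm (f (-1 - int n)))"
  shows "f abs_summable_on UNIV" "(f has_sum ((suminf (\<lambda>n. f (int n))) + (suminf (\<lambda>n. f (-1 - int n))))) UNIV"
proof -
  have U: "UNIV = range int \<union> range (\<lambda>n. -1 - int n)"
  proof safe
    fix x :: int assume "x \<notin> range (\<lambda>n. -1 - int n)"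
    hence "x \<noteq> -1 - int (nat (-1 - x))" by blast
    thus "x \<in> range int" by (cases "x \<ge> 0") (auto intro: image_eqI[of _ _ "nat x"])
  qed auto
  have D: "range int \<inter> range (\<lambda>n. -1 - int n) = {}" by auto
  have i: "inj int" "inj (\<lambda>n. -1 - int n)" by (auto simp: inj_def)
  have "(f has_sum (suminf (\<lambda>n. f (int n)))) (range int)"
    using norm_summable_imp_has_sum[OF assms(1) summable_sums[OF summable_norm_cancel[OF assms(1)]]]
    by (subst has_sum_reindex[OF i(1)]) (simp add: o_def)
  moreover have "(f has_sum (suminf (\<lambda>n. f (-1 - int n)))) (range (\<lambda>n. -1 - int n))"
    using norm_summable_imp_has_sum[OF assms(2) summable_sums[OF summable_norm_cancel[OF assms(2)]]]
    by (subst has_sum_reindex[OF i(2)]) (simp add: o_def)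
  ultimately show "(f has_sum ((suminf (\<lambda>n. f (int n))) + (suminf (\<lambda>n. f (-1 - int n))))) UNIV"
    unfolding U by (intro has_sum_Un_disjoint D)
  thus "f abs_summable_on UNIV"
    using summable_on_iff_abs_summable_on_complex has_sum_imp_summable by blast
qed

lemma strict_mono_squares:
  "strict_mono (\<lambda>n::nat. n\<^sup>2)" "strict_mono (\<lambda>n::nat. (Suc n)\<^sup>2)" "strict_mono (\<lambda>n::nat. n\<^sup>2 + n)"
  by (auto simp: strict_mono_Suc_iff power2_eq_square)

lemma theta3_sums:
  assumes "norm w < 1"
  shows "(\<lambda>n::int. w ^ nat (n\<^sup>2)) abs_summable_on UNIV"
    and "theta3 w = 1 + 2 * (suminf (\<lambda>n. w ^ (Suc n)\<^sup>2))"
proof -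
  have e: "nat ((int n)\<^sup>2) = n\<^sup>2" "nat ((-1 - int n)\<^sup>2) = (Suc n)\<^sup>2" for n
  proof -
    show "nat ((int n)\<^sup>2) = n\<^sup>2" by (simp add: nat_power_eq)
    have "(-1 - int n)\<^sup>2 = int ((Suc n)\<^sup>2)" by (simp add: power2_eq_square algebra_simps)
    thus "nat ((-1 - int n)\<^sup>2) = (Suc n)\<^sup>2" by (simp only: nat_int)
  qed
  note s = has_sum_int_split[of "\<lambda>n. w ^ nat (n\<^sup>2)", unfolded e,
      OF int_series_sparse(2)[OF strict_mono_squares(1) assms] int_series_sparse(2)[OF strict_mono_squares(2) assms]]
  show "(\<lambda>n::int. w ^ nat (n\<^sup>2)) abs_summable_on UNIV" by (rule s(1))
  have "(suminf (\<lambda>n. w ^ n\<^sup>2)) = 1 + (suminf (\<lambda>n. w ^ (Suc n)\<^sup>2))"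
    using suminf_split_head[OF summable_norm_cancel[OF int_series_sparse(2)[OF strict_mono_squares(1) assms]]] by simp
  thus "theta3 w = 1 + 2 * (suminf (\<lambda>n. w ^ (Suc n)\<^sup>2))"
    unfolding theta3_def using infsumI[OF s(2)] by simp
qed

lemma theta2_sums:
  assumes "norm w < 1"
  shows "(\<lambda>n::int. w ^ nat (n\<^sup>2 + n)) abs_summable_on UNIV"
    and "theta2 w = 2 * (suminf (\<lambda>n. w ^ (n\<^sup>2 + n)))"
proof -
  have e: "nat ((int n)\<^sup>2 + int n) = n\<^sup>2 + n" "nat ((-1 - int n)\<^sup>2 + (-1 - int n)) = n\<^sup>2 + n" for n
  proof -
    have "(int n)\<^sup>2 + int n = int (n\<^sup>2 + n)" "(-1 - int n)\<^sup>2 + (-1 - int n) = int (n\<^sup>2 + n)"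
      by (simp_all add: power2_eq_square algebra_simps)
    thus "nat ((int n)\<^sup>2 + int n) = n\<^sup>2 + n" "nat ((-1 - int n)\<^sup>2 + (-1 - int n)) = n\<^sup>2 + n"
      by (simp_all only: nat_int)
  qed
  note s = has_sum_int_split[of "\<lambda>n. w ^ nat (n\<^sup>2 + n)", unfolded e,
      OF int_series_sparse(2)[OF strict_mono_squares(3) assms] int_series_sparse(2)[OF strict_mono_squares(3) assms]]
  show "(\<lambda>n::int. w ^ nat (n\<^sup>2 + n)) abs_summable_on UNIV" by (rule s(1))
  show "theta2 w = 2 * (suminf (\<lambda>n. w ^ (n\<^sup>2 + n)))"
    unfolding theta2_def using infsumI[OF s(2)] by simp
qed

lemma theta_has_sum:
  assumes "norm w < 1"
  shows "((\<lambda>n::int. w ^ nat (n\<^sup>2)) has_sum theta3 w) UNIV"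
    and "((\<lambda>n::int. w ^ nat (n\<^sup>2 + n)) has_sum theta2 w) UNIV"
  unfolding theta2_def theta3_def
  using theta2_sums(1)[OF assms] theta3_sums(1)[OF assms]
  by (simp_all add: abs_summable_summable)

lemma int_series_cong:
  assumes "int_series f" "\<And>w. norm w < 1 \<Longrightarrow> f w = g w"
  shows "int_series g"
  using assms(1) by (elim int_seriesE, intro int_seriesI) (simp flip: assms(2))

lemma int_series_theta3: "int_series theta3"
  by (rule int_series_cong[OF int_series_add[OF int_series_const[of 1]
        int_series_mult[OF int_series_const[of 2] int_series_sparse(1)[OF strict_mono_squares(2)]]]])
     (simp add: theta3_sums)

text \<open>The factor two is split off because \<open>\<Delta>\<close> carries a denominator \<open>16\<close>, which it cancels.\<close>
definition half_theta2 :: "complex \<Rightarrow> complex" where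
  "half_theta2 w = (suminf (\<lambda>n. w ^ (n\<^sup>2 + n)))"

lemma int_series_half_theta2: "int_series half_theta2"
  unfolding half_theta2_def by (rule int_series_sparse(1)[OF strict_mono_squares(3)])

lemma theta2_eq: "norm w < 1 \<Longrightarrow> theta2 w = 2 * half_theta2 w"
  by (simp add: theta2_sums half_theta2_def)

lemma int_series_theta2: "int_series theta2"
  by (rule int_series_cong[OF int_series_mult[OF int_series_const[of 2] int_series_half_theta2]])
     (simp add: theta2_eq)

lemma theta_at_0: "theta3 0 = 1" "half_theta2 0 = 1"
proof -
  have "(0::complex) ^ (Suc n)\<^sup>2 = 0" for n by (subst power_0_left) simp
  thus "theta3 0 = 1" by (simp only: theta3_sums(2) norm_zero zero_less_one suminf_zero) simp
  have "(suminf (\<lambda>n. (0::complex) ^ (n\<^sup>2 + n))) = (\<Sum>n\<in>{0}. 0 ^ (n\<^sup>2 + n))"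
    by (rule suminf_finite) (simp_all add: power_0_left)
  thus "half_theta2 0 = 1" by (simp add: half_theta2_def)
qed

lemma has_sum_product_complex:
  fixes f g :: "int \<Rightarrow> complex"
  assumes "f abs_summable_on UNIV" "g abs_summable_on UNIV" "(f has_sum F) UNIV" "(g has_sum G) UNIV"
  shows "((\<lambda>(m, n). f m * g n) has_sum F * G) UNIV"
proof -
  have "((\<lambda>(m, n). f m * g n) has_sum F * G) (UNIV \<times> UNIV)"
  proof (rule has_sum_SigmaI[where g = "\<lambda>m. f m * G"])
    fix m :: int
    show "((\<lambda>n. case (m, n) of (m, n) \<Rightarrow> f m * g n) has_sum f m * G) UNIV"
      using has_sum_cmult_right[OF assms(4)] by simp
  next
    show "((\<lambda>m. f m * G) has_sum F * G) UNIV" by (rule has_sum_cmult_left[OF assms(3)])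
  next
    have "(\<lambda>(m, n). f m * g n) abs_summable_on (UNIV \<times> UNIV)"
      unfolding Infinite_Sum.abs_summable_on_Sigma_iff
    proof (intro conjI ballI)
      fix m :: int
      show "(\<lambda>n. case (m, n) of (m, n) \<Rightarrow> f m * g n) abs_summable_on UNIV"
        using summable_on_cmult_right[OF assms(2), of "norm (f m)"] by (simp add: norm_mult)
    next
      have "infsum (\<lambda>n. norm (f m * g n)) UNIV = norm (f m) * infsum (\<lambda>n. norm (g n)) UNIV" for m
        unfolding norm_mult by (rule infsum_cmult_right')
      moreover have "infsum (\<lambda>n. norm (g n)) UNIV \<ge> 0" by (rule infsum_nonneg) simp
      ultimately have "norm (infsum (\<lambda>n. norm (f m * g n)) UNIV) = norm (f m) * infsum (\<lambda>n. norm (g n)) UNIV" for m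
        by simp
      thus "(\<lambda>m. infsum (\<lambda>n. norm (case (m, n) of (m, n) \<Rightarrow> f m * g n)) UNIV) abs_summable_on UNIV"
        using summable_on_cmult_left[OF assms(1)] by simp
    qed
    thus "(\<lambda>(m, n). f m * g n) summable_on (UNIV \<times> UNIV)" by (rule abs_summable_summable)
  qed
  thus ?thesis by simp
qed

section \<open>Doubling relations\<close>

lemma quad_nonneg: "n\<^sup>2 + n \<ge> (0::int)"
proof -
  have "n * (n + 1) \<ge> 0" unfolding zero_le_mult_iff by linarith
  thus ?thesis by (simp add: power2_eq_square algebra_simps)
qed

lemma power_nat_eqI:
  fixes w :: complex
  assumes "0 \<le> a" "0 \<le> b" "0 \<le> c" "0 \<le> d" "a + b = 2 * c + 2 * d + int e"
  shows "w ^ nat a * w ^ nat b = w ^ e * ((w\<^sup>2) ^ nat c * (w\<^sup>2) ^ nat d)"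
proof -
  have "nat a + nat b = e + (2 * nat c + 2 * nat d)" using assms by linarith
  thus ?thesis by (simp only: flip: power_add power_mult)
qed

text \<open>The pairs of equal parity form the image of the rotated lattice \<open>(a, b) \<mapsto> (a + b, a - b)\<close>.\<close>
lemma even_pair_reindex:
  fixes h g :: "int \<times> int \<Rightarrow> complex"
  assumes "\<And>a b. h (a + b, a - b) = g (a, b)"
  shows "(h has_sum S) {(m, n). even (m + n)} \<longleftrightarrow> (g has_sum S) UNIV"
proof -
  have inj: "inj (\<lambda>(a::int, b::int). (a + b, a - b))" by (auto simp: inj_def)
  have img: "{(m, n). even (m + n)} = range (\<lambda>(a::int, b::int). (a + b, a - b))"
  proof (intro equalityI subsetI)
    fix x :: "int \<times> int" assume "x \<in> {(m, n). even (m + n)}"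
    then obtain m n where x: "x = (m, n)" and p: "even (m + n)" by auto
    from p obtain k where k: "m + n = 2 * k" by (rule evenE)
    have "x = (\<lambda>(a, b). (a + b, a - b)) (k, m - k)" using k by (simp add: x)
    thus "x \<in> range (\<lambda>(a, b). (a + b, a - b))" by (rule range_eqI)
  qed auto
  show ?thesis unfolding img by (subst has_sum_reindex[OF inj]) (simp add: o_def case_prod_unfold assms)
qed

lemma odd_pair_reindex:
  fixes h g :: "int \<times> int \<Rightarrow> complex"
  assumes "\<And>a b. h (a + b + 1, a - b) = g (a, b)"
  shows "(h has_sum S) {(m, n). odd (m + n)} \<longleftrightarrow> (g has_sum S) UNIV"
proof -
  have inj: "inj (\<lambda>(a::int, b::int). (a + b + 1, a - b))" by (auto simp: inj_def)
  have img: "{(m, n). odd (m + n)} = range (\<lambda>(a::int, b::int). (a + b + 1, a - b))"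
  proof (intro equalityI subsetI)
    fix x :: "int \<times> int" assume "x \<in> {(m, n). odd (m + n)}"
    then obtain m n where x: "x = (m, n)" and p: "odd (m + n)" by auto
    from p obtain k where k: "m + n = 2 * k + 1" by (rule oddE)
    have "x = (\<lambda>(a, b). (a + b + 1, a - b)) (k, m - k - 1)" using k by (simp add: x)
    thus "x \<in> range (\<lambda>(a, b). (a + b + 1, a - b))" by (rule range_eqI)
  qed auto
  show ?thesis unfolding img by (subst has_sum_reindex[OF inj]) (simp add: o_def case_prod_unfold assms)
qed

lemma pair_sum_by_parity:
  fixes h :: "int \<times> int \<Rightarrow> complex"
  assumes "(h has_sum S) UNIV" "(h has_sum A) {(m, n). even (m + n)}" "(h has_sum B) {(m, n). odd (m + n)}"
  shows "S = A + B"
proof -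
  have "(h has_sum (A + B)) ({(m, n). even (m + n)} \<union> {(m, n). odd (m + n)})"
    by (rule has_sum_Un_disjoint[OF assms(2,3)]) auto
  moreover have "{(m, n). even (m + n)} \<union> {(m, n). odd (m + n)} = (UNIV :: (int \<times> int) set)" by auto
  ultimately show ?thesis using assms(1) has_sum_unique by metis
qed

lemma norm_power2_less_1: "norm w < 1 \<Longrightarrow> norm ((w::complex)\<^sup>2) < 1"
  by (simp add: norm_power power_less_one_iff)

text \<open>Split the double sum by the parity of \<open>m + n\<close> and use
  \<open>m\<^sup>2 + n\<^sup>2 = 2 a\<^sup>2 + 2 b\<^sup>2\<close> for \<open>m, n = a \<plusminus> b\<close>. Replacing \<open>w\<close> by \<open>- w\<close> only changes the sign of the odd
  part, since the rest depends on \<open>w\<^sup>2\<close>.\<close>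
lemma theta3_squared:
  assumes w: "norm w < 1"
  shows "theta3 w ^ 2 = theta3 (w\<^sup>2) ^ 2 + w * theta2 (w\<^sup>2) ^ 2"
  unfolding power2_eq_square[of "theta3 w"]
proof (rule pair_sum_by_parity)
  note w2 = norm_power2_less_1[OF w]
  let ?f = "\<lambda>n::int. w ^ nat (n\<^sup>2)"
  show "((\<lambda>(m, n). ?f m * ?f n) has_sum theta3 w * theta3 w) UNIV"
    by (intro has_sum_product_complex theta3_sums theta_has_sum w)
  have "((\<lambda>(a, b). (w\<^sup>2) ^ nat (a\<^sup>2) * (w\<^sup>2) ^ nat (b\<^sup>2)) has_sum theta3 (w\<^sup>2) * theta3 (w\<^sup>2)) (UNIV :: (int \<times> int) set)"
    by (intro has_sum_product_complex theta3_sums theta_has_sum w2)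
  hence "((\<lambda>(a, b). (w\<^sup>2) ^ nat (a\<^sup>2) * (w\<^sup>2) ^ nat (b\<^sup>2)) has_sum theta3 (w\<^sup>2) ^ 2) (UNIV :: (int \<times> int) set)"
    by (simp only: power2_eq_square[of "theta3 (w\<^sup>2)"])
  moreover have "?f (a + b) * ?f (a - b) = w ^ 0 * ((w\<^sup>2) ^ nat (a\<^sup>2) * (w\<^sup>2) ^ nat (b\<^sup>2))" for a b
    by (rule power_nat_eqI[OF zero_le_power2 zero_le_power2 zero_le_power2 zero_le_power2])
      (simp add: power2_eq_square algebra_simps)
  ultimately show "((\<lambda>(m, n). ?f m * ?f n) has_sum theta3 (w\<^sup>2) ^ 2) {(m, n). even (m + n)}"
    by (subst even_pair_reindex[where g = "\<lambda>(a, b). (w\<^sup>2) ^ nat (a\<^sup>2) * (w\<^sup>2) ^ nat (b\<^sup>2)"]) simp_all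
  have "((\<lambda>(a, b). (w\<^sup>2) ^ nat (a\<^sup>2 + a) * (w\<^sup>2) ^ nat (b\<^sup>2 + b)) has_sum theta2 (w\<^sup>2) * theta2 (w\<^sup>2)) (UNIV :: (int \<times> int) set)"
    by (intro has_sum_product_complex theta2_sums theta_has_sum w2)
  from has_sum_cmult_right[OF this, of w]
  have "((\<lambda>(a, b). w * ((w\<^sup>2) ^ nat (a\<^sup>2 + a) * (w\<^sup>2) ^ nat (b\<^sup>2 + b))) has_sum w * theta2 (w\<^sup>2) ^ 2) (UNIV :: (int \<times> int) set)"
    by (simp only: power2_eq_square[of "theta2 (w\<^sup>2)"] case_prod_unfold)
  moreover have "?f (a + b + 1) * ?f (a - b) = w ^ 1 * ((w\<^sup>2) ^ nat (a\<^sup>2 + a) * (w\<^sup>2) ^ nat (b\<^sup>2 + b))" for a b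
    by (rule power_nat_eqI[OF zero_le_power2 zero_le_power2 quad_nonneg quad_nonneg])
      (simp add: power2_eq_square algebra_simps)
  ultimately show "((\<lambda>(m, n). ?f m * ?f n) has_sum w * theta2 (w\<^sup>2) ^ 2) {(m, n). odd (m + n)}"
    by (subst odd_pair_reindex[where g = "\<lambda>(a, b). w * ((w\<^sup>2) ^ nat (a\<^sup>2 + a) * (w\<^sup>2) ^ nat (b\<^sup>2 + b))"]) simp_all
qed

text \<open>A second parametrisation of the pairs of opposite parity, adapted to the exponent \<open>n\<^sup>2 + n\<close>.\<close>
lemma odd_pair_reindex_reflected:
  fixes h g :: "int \<times> int \<Rightarrow> complex"
  assumes "\<And>a b. h (a + b, b - a - 1) = g (a, b)"
  shows "(h has_sum S) {(m, n). odd (m + n)} \<longleftrightarrow> (g has_sum S) UNIV"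
proof -
  have inj: "inj (\<lambda>(a::int, b::int). (a + b, b - a - 1))" by (auto simp: inj_def)
  have img: "{(m, n). odd (m + n)} = range (\<lambda>(a::int, b::int). (a + b, b - a - 1))"
  proof (intro equalityI subsetI)
    fix x :: "int \<times> int" assume "x \<in> {(m, n). odd (m + n)}"
    then obtain m n where x: "x = (m, n)" and p: "odd (m + n)" by auto
    from p obtain k where k: "m + n = 2 * k + 1" by (rule oddE)
    have "x = (\<lambda>(a, b). (a + b, b - a - 1)) (m - k - 1, k + 1)" using k by (simp add: x)
    thus "x \<in> range (\<lambda>(a, b). (a + b, b - a - 1))" by (rule range_eqI)
  qed auto
  show ?thesis unfolding img by (subst has_sum_reindex[OF inj]) (simp add: o_def case_prod_unfold assms)
qed

text \<open>The parity classes contribute equally.\<close>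
lemma theta2_squared:
  assumes w: "norm w < 1"
  shows "theta2 w ^ 2 = 2 * theta2 (w\<^sup>2) * theta3 (w\<^sup>2)"
proof -
  note w2 = norm_power2_less_1[OF w]
  let ?f = "\<lambda>n::int. w ^ nat (n\<^sup>2 + n)"
  let ?g = "\<lambda>(a::int, b::int). (w\<^sup>2) ^ nat (a\<^sup>2 + a) * (w\<^sup>2) ^ nat (b\<^sup>2)"
  have P: "((\<lambda>(m, n). ?f m * ?f n) has_sum theta2 w * theta2 w) UNIV"
    by (intro has_sum_product_complex theta2_sums theta_has_sum w)
  have R: "(?g has_sum theta2 (w\<^sup>2) * theta3 (w\<^sup>2)) UNIV"
    by (intro has_sum_product_complex theta2_sums theta3_sums theta_has_sum w2)
  have E: "?f (a + b) * ?f (a - b) = w ^ 0 * ((w\<^sup>2) ^ nat (a\<^sup>2 + a) * (w\<^sup>2) ^ nat (b\<^sup>2))" for a b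
    by (rule power_nat_eqI[OF quad_nonneg quad_nonneg quad_nonneg zero_le_power2])
      (simp add: power2_eq_square algebra_simps)
  have O: "?f (a + b) * ?f (b - a - 1) = w ^ 0 * ((w\<^sup>2) ^ nat (a\<^sup>2 + a) * (w\<^sup>2) ^ nat (b\<^sup>2))" for a b
    by (rule power_nat_eqI[OF quad_nonneg quad_nonneg quad_nonneg zero_le_power2])
      (simp add: power2_eq_square algebra_simps)
  have "theta2 w * theta2 w = theta2 (w\<^sup>2) * theta3 (w\<^sup>2) + theta2 (w\<^sup>2) * theta3 (w\<^sup>2)"
  proof (rule pair_sum_by_parity[OF P])
    show "((\<lambda>(m, n). ?f m * ?f n) has_sum theta2 (w\<^sup>2) * theta3 (w\<^sup>2)) {(m, n). even (m + n)}"
      by (subst even_pair_reindex[where g = ?g]) (simp_all only: prod.case E R power_0 mult_1)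
    show "((\<lambda>(m, n). ?f m * ?f n) has_sum theta2 (w\<^sup>2) * theta3 (w\<^sup>2)) {(m, n). odd (m + n)}"
      by (subst odd_pair_reindex_reflected[where g = ?g]) (simp_all only: prod.case O R power_0 mult_1)
  qed
  thus ?thesis by (simp add: power2_eq_square)
qed

text \<open>Separate the even and the odd squares.\<close>
lemma theta3_quarter:
  assumes w: "norm w < 1"
  shows "theta3 w = theta3 (w ^ 4) + w * theta2 (w ^ 4)"
proof -
  have w4: "norm (w ^ 4) < 1" using w by (simp add: norm_power power_less_one_iff)
  let ?f = "\<lambda>n::int. w ^ nat (n\<^sup>2)"
  have "(?f has_sum theta3 (w ^ 4)) {n. even n}"
  proof (subst has_sum_reindex_bij_witness[of _ "\<lambda>k. 2 * k" "\<lambda>n. n div 2" UNIV "\<lambda>k. (w ^ 4) ^ nat (k\<^sup>2)"])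
    fix n :: int assume "n \<in> {n. even n}"
    then obtain k where n: "n = 2 * k" by (auto elim: evenE)
    have "nat (n\<^sup>2) = 4 * nat (k\<^sup>2)" by (simp add: n power_mult_distrib nat_mult_distrib)
    thus "(w ^ 4) ^ nat ((n div 2)\<^sup>2) = ?f n" by (simp add: n power_mult)
  qed (use theta_has_sum(1)[OF w4] in auto)
  moreover have "(?f has_sum w * theta2 (w ^ 4)) {n. odd n}"
  proof (subst has_sum_reindex_bij_witness[of _ "\<lambda>k. 2 * k + 1" "\<lambda>n. n div 2" UNIV "\<lambda>k. w * (w ^ 4) ^ nat (k\<^sup>2 + k)"])
    fix n :: int assume "n \<in> {n. odd n}"
    then obtain k where n: "n = 2 * k + 1" by (auto elim: oddE)
    have "n\<^sup>2 = 4 * (k\<^sup>2 + k) + 1" by (simp add: n power2_eq_square algebra_simps)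
    hence "nat (n\<^sup>2) = Suc (4 * nat (k\<^sup>2 + k))"
      using quad_nonneg[of k] by (simp only: nat_add_distrib nat_mult_distrib) simp
    thus "w * (w ^ 4) ^ nat ((n div 2)\<^sup>2 + n div 2) = ?f n" by (simp add: n power_mult)
  qed (use has_sum_cmult_right[OF theta_has_sum(2)[OF w4]] in auto)
  ultimately have "(?f has_sum (theta3 (w ^ 4) + w * theta2 (w ^ 4))) ({n. even n} \<union> {n. odd n})"
    by (intro has_sum_Un_disjoint) auto
  moreover have "{n. even n} \<union> {n. odd n} = (UNIV :: int set)" by auto
  ultimately show ?thesis using theta_has_sum(1)[OF w] has_sum_unique by metis
qed

lemma theta2_uminus: "theta2 (- w) = theta2 w"
proof -
  have "(- w) ^ nat (n\<^sup>2 + n) = w ^ nat (n\<^sup>2 + n)" for n :: int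
  proof -
    have "even (nat (n\<^sup>2 + n))" by (simp add: even_nat_iff quad_nonneg)
    thus ?thesis by simp
  qed
  thus ?thesis by (simp add: theta2_def)
qed

lemma theta3_squared_uminus:
  assumes w: "norm w < 1"
  shows "theta3 (- w) ^ 2 = theta3 (w\<^sup>2) ^ 2 - w * theta2 (w\<^sup>2) ^ 2"
  using theta3_squared[of "- w"] w by simp

text \<open>Jacobi's identity \<open>\<theta>\<^sub>0\<^sub>0\<^sup>4 = \<theta>\<^sub>1\<^sub>0\<^sup>4 + \<theta>\<^sub>0\<^sub>1\<^sup>4\<close>. With \<open>A, B\<close> the two terms of the doubling relation it reads
  \<open>(A + B)\<^sup>2 - (A - B)\<^sup>2 = 4 A B\<close>.\<close>
lemma jacobi_identity:
  assumes w: "norm w < 1"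
  shows "theta3 w ^ 4 = w * theta2 w ^ 4 + theta3 (- w) ^ 4"
proof -
  have "theta3 w ^ 4 = (theta3 w ^ 2)\<^sup>2" "theta3 (- w) ^ 4 = (theta3 (- w) ^ 2)\<^sup>2" "theta2 w ^ 4 = (theta2 w ^ 2)\<^sup>2"
    by simp_all
  thus ?thesis unfolding theta3_squared[OF w] theta3_squared_uminus[OF w] theta2_squared[OF w]
    by (simp add: power2_eq_square algebra_simps)
qed

text \<open>The product \<open>(A + B) (A - B)\<close> of the doubling relations, simplified by Jacobi's identity at \<open>w\<^sup>2\<close>.\<close>
lemma theta3_product:
  assumes w: "norm w < 1"
  shows "theta3 w ^ 2 * theta3 (- w) ^ 2 = theta3 (- (w\<^sup>2)) ^ 4"
proof -
  have "theta3 w ^ 2 * theta3 (- w) ^ 2 = theta3 (w\<^sup>2) ^ 4 - w\<^sup>2 * theta2 (w\<^sup>2) ^ 4"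
    unfolding theta3_squared[OF w] theta3_squared_uminus[OF w]
    by (simp add: power2_eq_square power4_eq_xxxx algebra_simps)
  thus ?thesis using jacobi_identity[OF norm_power2_less_1[OF w]] by simp
qed

text \<open>A zero of \<open>f\<close> would propagate to a sequence of zeros that tends to the origin.\<close>
lemma nonzero_by_squaring:
  fixes f :: "complex \<Rightarrow> complex"
  assumes hol: "f holomorphic_on ball 0 1" and f0: "f 0 \<noteq> 0"
    and step: "\<And>w. norm w < 1 \<Longrightarrow> f w = 0 \<Longrightarrow> f (s * w\<^sup>2) = 0" and s: "norm s = 1" and w: "norm w < 1"
  shows "f w \<noteq> 0"
proof
  assume "f w = 0"
  define v where "v n = ((\<lambda>w. s * w\<^sup>2) ^^ n) w" for n
  have v: "norm (v n) \<le> norm w ^ Suc n \<and> f (v n) = 0" for n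
  proof (induction n)
    case 0
    show ?case using \<open>f w = 0\<close> by (simp add: v_def)
  next
    case (Suc n)
    have vS: "v (Suc n) = s * (v n)\<^sup>2" by (simp add: v_def)
    have 1: "norm w ^ Suc n \<le> norm w" using w by (simp add: power_le_one mult_left_le)
    hence lt: "norm (v n) < 1" using Suc w by linarith
    have "norm (v (Suc n)) = norm (v n) * norm (v n)" using s by (simp add: vS norm_mult power2_eq_square)
    also have "\<dots> \<le> norm w ^ Suc n * norm w" using Suc 1 by (intro mult_mono) auto
    finally show ?case using step[OF lt] Suc by (simp add: vS mult.commute)
  qed
  have "(\<lambda>n. norm w ^ Suc n) \<longlonglongrightarrow> 0" using w LIMSEQ_Suc[OF LIMSEQ_power_zero[of "norm w"]] by simp
  hence "v \<longlonglongrightarrow> 0" by (rule Lim_null_comparison[rotated]) (use v in auto)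
  moreover have "isCont f 0"
    using holomorphic_on_imp_continuous_on[OF hol] by (simp add: continuous_on_eq_continuous_at)
  ultimately have "(\<lambda>n. f (v n)) \<longlonglongrightarrow> f 0" by (rule isCont_tendsto_compose[rotated])
  hence "f 0 = 0" using v by (simp add: LIMSEQ_const_iff)
  with f0 show False by simp
qed

text \<open>By the product relation a zero at \<open>w\<close> forces one at \<open>- w\<^sup>2\<close>.\<close>
lemma theta3_nonzero:
  assumes "norm w < 1" shows "theta3 w \<noteq> 0"
proof (rule nonzero_by_squaring[where f = theta3 and w = w and s = "-1"])
  fix w assume "norm w < 1" "theta3 w = 0"
  thus "theta3 (- 1 * w\<^sup>2) = 0" using theta3_product[of w] by simp
qed (simp_all add: int_series_imp_holomorphic int_series_theta3 theta_at_0 assms)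

lemma half_theta2_nonzero:
  assumes "norm w < 1" shows "half_theta2 w \<noteq> 0"
proof (rule nonzero_by_squaring[where f = half_theta2 and w = w and s = 1])
  fix w assume w: "norm w < 1" "half_theta2 w = 0"
  hence "theta2 (w\<^sup>2) = 0"
    using theta2_squared[of w] theta2_eq[of w] theta3_nonzero[OF norm_power2_less_1] by simp
  thus "half_theta2 (1 * w\<^sup>2) = 0" using theta2_eq[OF norm_power2_less_1[OF w(1)]] by simp
qed (simp_all add: int_series_imp_holomorphic int_series_half_theta2 theta_at_0 assms)

section \<open>Inversion on the upper half plane\<close>

abbreviation nome :: "complex \<Rightarrow> complex" where "nome \<tau> \<equiv> exp (pi * \<i> * \<tau>)"

lemma norm_nome: "norm (nome \<tau>) = exp (- (pi * Im \<tau>))"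
  by simp

lemma norm_nome_less_1: "\<tau> \<in> upper_half_plane \<Longrightarrow> norm (nome \<tau>) < 1"
  by (simp add: upper_half_plane_def)

lemma nome_add_1: "nome (\<tau> + 1) = - nome \<tau>"
  by (simp add: distrib_left exp_add)

lemma nome_double: "nome (2 * \<tau>) = nome \<tau> ^ 2"
  by (simp add: exp_double[symmetric] mult_ac)

text \<open>The fourth powers \<open>x = \<theta>\<^sub>1\<^sub>0\<^sup>4\<close> and \<open>z = \<theta>\<^sub>0\<^sub>0\<^sup>4\<close> as functions of the nome; \<open>\<theta>\<^sub>0\<^sub>1\<^sup>4\<close> is \<open>theta_z (- w)\<close>.\<close>
definition theta_x :: "complex \<Rightarrow> complex" where "theta_x w = w * theta2 w ^ 4"
definition theta_z :: "complex \<Rightarrow> complex" where "theta_z w = theta3 w ^ 4"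

lemma theta_10_power4: "theta_10 \<tau> ^ 4 = theta_x (nome \<tau>)"
proof -
  have "exp (pi * \<i> * (of_int n + 1 / 2)\<^sup>2 * \<tau>) = exp (pi * \<i> * \<tau> / 4) * nome \<tau> ^ nat (n\<^sup>2 + n)" for n :: int
  proof -
    have "(of_int n + 1 / 2 :: complex)\<^sup>2 = 1 / 4 + of_nat (nat (n\<^sup>2 + n))"
      using quad_nonneg[of n] by (simp add: of_nat_nat power2_eq_square algebra_simps)
    hence "pi * \<i> * (of_int n + 1 / 2)\<^sup>2 * \<tau> = pi * \<i> * \<tau> / 4 + of_nat (nat (n\<^sup>2 + n)) * (pi * \<i> * \<tau>)"
      by (simp only:) (simp add: algebra_simps)
    thus ?thesis by (simp only: exp_add exp_of_nat_mult)
  qed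
  hence "theta_10 \<tau> = exp (pi * \<i> * \<tau> / 4) * theta2 (nome \<tau>)"
    unfolding theta_10_def theta2_def by (simp only: infsum_cmult_right')
  thus ?thesis by (simp add: power_mult_distrib exp_of_nat_mult[symmetric] theta_x_def)
qed

lemma theta_01_power4: "theta_01 \<tau> ^ 4 = theta_z (- nome \<tau>)"
proof -
  have "(-1) powi n * exp (pi * \<i> * (of_int n)\<^sup>2 * \<tau>) = (- nome \<tau>) ^ nat (n\<^sup>2)" for n :: int
  proof -
    have "(of_int n :: complex)\<^sup>2 = of_nat (nat (n\<^sup>2))" by simp
    hence "pi * \<i> * (of_int n)\<^sup>2 * \<tau> = of_nat (nat (n\<^sup>2)) * (pi * \<i> * \<tau>)"
      by (simp only:) (simp add: algebra_simps)
    hence "exp (pi * \<i> * (of_int n)\<^sup>2 * \<tau>) = nome \<tau> ^ nat (n\<^sup>2)"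
      by (simp only: exp_of_nat_mult)
    moreover have "(-1 :: complex) powi n = (-1) ^ nat (n\<^sup>2)"
    proof -
      have "even (nat (n\<^sup>2)) = even n" by (simp add: even_nat_iff)
      thus ?thesis by (cases "even n") auto
    qed
    ultimately show ?thesis by (simp only: power_minus[of "nome \<tau>"])
  qed
  hence "theta_01 \<tau> = theta3 (- nome \<tau>)"
    unfolding theta_01_def theta3_def by simp
  thus ?thesis by (simp add: theta_z_def)
qed

lemma theta_xz: "norm w < 1 \<Longrightarrow> theta_x w + theta_z (- w) = theta_z w"
  using jacobi_identity[of w] by (simp add: theta_x_def theta_z_def)

lemma theta_x_uminus: "theta_x (- w) = - theta_x w"
  by (simp add: theta_x_def theta2_uminus)

lemma theta_x_squared:
  assumes w: "norm w < 1"
  shows "theta_x w ^ 2 = 16 * theta_x (w\<^sup>2) * theta_z (w\<^sup>2)"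
proof -
  have "theta_x w ^ 2 = w\<^sup>2 * (theta2 w ^ 2) ^ 4"
    by (simp add: theta_x_def power_mult_distrib flip: power_mult)
  thus ?thesis unfolding theta2_squared[OF w] by (simp add: theta_x_def theta_z_def power_mult_distrib mult.assoc)
qed

lemma theta_z_product:
  assumes w: "norm w < 1"
  shows "theta_z w * theta_z (- w) = theta_z (- (w\<^sup>2)) ^ 2"
proof -
  have "theta_z w * theta_z (- w) = (theta3 w ^ 2 * theta3 (- w) ^ 2)\<^sup>2"
    by (simp add: theta_z_def power_mult_distrib flip: power_mult)
  thus ?thesis unfolding theta3_product[OF w] by (simp add: theta_z_def)
qed

lemma theta_x_holomorphic: "theta_x holomorphic_on ball 0 1"
  unfolding theta_x_def by (intro holomorphic_intros int_series_imp_holomorphic int_series_theta2)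

lemma theta_z_holomorphic: "theta_z holomorphic_on ball 0 1"
  unfolding theta_z_def by (intro holomorphic_intros int_series_imp_holomorphic int_series_theta3)

lemma theta3_gauss:
  assumes s: "s > 0"
  shows "theta3 (of_real (exp (- (pi * s)))) = of_real (1 + 2 * gauss_tail s)"
proof -
  define q where "q = exp (- (pi * s))"
  have q: "norm (complex_of_real q) < 1" "q ^ m = exp (- (pi * s * real m))" for m
    using s by (auto simp: q_def mult_ac simp flip: exp_of_nat_mult)
  have "suminf (\<lambda>n. complex_of_real q ^ (Suc n)\<^sup>2) = of_real (suminf (\<lambda>n. q ^ (Suc n)\<^sup>2))"
  proof -
    have "summable (\<lambda>n. norm (complex_of_real q ^ (Suc n)\<^sup>2))"
      by (rule int_series_sparse(2)[OF strict_mono_squares(2) q(1)])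
    hence "summable (\<lambda>n. q ^ (Suc n)\<^sup>2)" by (simp add: q_def norm_power)
    from suminf_of_real[OF this, where ?'a = complex] show ?thesis by simp
  qed
  also have "suminf (\<lambda>n. q ^ (Suc n)\<^sup>2) = gauss_tail s"
    unfolding gauss_tail_def q(2) by simp
  finally show ?thesis using theta3_sums(2)[OF q(1)] unfolding q_def by simp
qed

text \<open>Write \<open>r s\<close> for \<open>\<theta>\<^sub>0\<^sub>0\<close> at \<open>\<i> s\<close>. By the splitting into even and odd squares, \<open>\<theta>\<^sub>0\<^sub>1\<close> is
  \<open>2 r (4 s) - r s\<close> and \<open>\<theta>\<^sub>1\<^sub>0\<close> is \<open>r (s / 4) - r s\<close>. Hence the inversion of \<open>\<theta>\<^sub>0\<^sub>0\<close> alone determines how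
  \<open>\<theta>\<^sub>0\<^sub>1\<close> and \<open>\<theta>\<^sub>1\<^sub>0\<close> are exchanged.\<close>
lemma theta_x_inversion_imaginary:
  assumes s: "s > 0"
  shows "theta_z (- of_real (exp (- (pi * (1 / s))))) = of_real (s\<^sup>2) * theta_x (of_real (exp (- (pi * s))))"
proof -
  define r where "r s = 1 + 2 * gauss_tail s" for s
  have inv: "sqrt s * r s = r (1 / s)" if "s > 0" for s
    using gauss_sum_inversion[OF that] by (simp add: r_def)
  define e where "e s = complex_of_real (exp (- (pi * s)))" for s
  have ne: "norm (e s) < 1" if "s > 0" for s using that by (simp add: e_def)
  have e4: "e s ^ 4 = e (4 * s)" for s
    by (simp add: e_def mult_ac flip: exp_of_nat_mult of_real_power)
  have th: "theta3 (e s) = of_real (r s)" if "s > 0" for s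
    unfolding e_def r_def by (rule theta3_gauss[OF that])
  \<comment> \<open>Since \<open>e s\<close> is the fourth root of \<open>e (4 s)\<close>, this is \<open>\<theta>\<^sub>1\<^sub>0\<close> at \<open>4 \<i> s\<close>.\<close>
  have quarter: "e s * theta2 (e (4 * s)) = of_real (r s - r (4 * s))" if "s > 0" for s
    using theta3_quarter[OF ne[OF that]] that by (simp add: e4 th)
  have minus: "theta3 (- e s) = of_real (2 * r (4 * s) - r s)" if "s > 0" for s
    using theta3_quarter[of "- e s"] ne[OF that] that quarter[OF that] by (simp add: e4 th)
  have "theta_z (- e (1 / s)) = of_real ((2 * r (4 * (1 / s)) - r (1 / s)) ^ 4)"
    using s by (simp add: theta_z_def minus)
  also have "2 * r (4 * (1 / s)) - r (1 / s) = sqrt s * (r (s / 4) - r s)"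
    using inv[of s] inv[of "s / 4"] s by (simp add: real_sqrt_divide algebra_simps)
  also have "(sqrt s * (r (s / 4) - r s)) ^ 4 = s\<^sup>2 * (r (s / 4) - r s) ^ 4"
  proof -
    have "sqrt s ^ 4 = ((sqrt s)\<^sup>2)\<^sup>2" by (simp flip: power_mult)
    thus ?thesis using s by (simp add: power_mult_distrib)
  qed
  also have "complex_of_real (s\<^sup>2 * (r (s / 4) - r s) ^ 4) = of_real (s\<^sup>2) * (e (s / 4) * theta2 (e (4 * (s / 4)))) ^ 4"
    using s by (subst quarter) simp_all
  also have "(e (s / 4) * theta2 (e (4 * (s / 4)))) ^ 4 = theta_x (e s)"
    using e4[of "s / 4"] by (simp add: theta_x_def power_mult_distrib)
  finally show ?thesis by (simp add: e_def)
qed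

lemma upper_half_plane_inverse:
  assumes "\<tau> \<in> upper_half_plane"
  shows "- 1 / \<tau> \<in> upper_half_plane"
proof -
  have "Im (- 1 / \<tau>) = Im \<tau> / (cmod \<tau>)\<^sup>2"
    by (simp add: Im_divide cmod_power2)
  moreover have "cmod \<tau> > 0" using assms by (auto simp: upper_half_plane_def)
  ultimately show ?thesis using assms by (simp add: upper_half_plane_def)
qed

lemma nome_image: "nome ` upper_half_plane \<subseteq> ball 0 1"
  using norm_nome_less_1 by auto

lemma compose_nome_holomorphic:
  assumes "f holomorphic_on ball 0 1"
  shows "(\<lambda>\<tau>. f (nome \<tau>)) holomorphic_on upper_half_plane"
  by (rule holomorphic_on_compose_gen[OF _ assms nome_image, unfolded o_def]) (intro holomorphic_intros)

lemma open_upper_half_plane: "open upper_half_plane"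
  unfolding upper_half_plane_def by (rule open_halfspace_Im_gt)

lemma connected_upper_half_plane: "connected upper_half_plane"
  unfolding upper_half_plane_def by (intro convex_connected convex_halfspace_Im_gt)

text \<open>Both sides are holomorphic and agree on the imaginary axis. For fourth powers the automorphy factor
  is a polynomial, so no branch of the square root has to be chosen.\<close>
lemma theta_z_uminus_inversion:
  assumes "\<tau> \<in> upper_half_plane"
  shows "theta_z (- nome (- 1 / \<tau>)) = - \<tau>\<^sup>2 * theta_x (nome \<tau>)"
proof -
  define F where "F \<tau> = theta_z (- nome (- 1 / \<tau>)) + \<tau>\<^sup>2 * theta_x (nome \<tau>)" for \<tau>
  have "(\<lambda>w. theta_z (- w)) holomorphic_on ball 0 1"
    by (rule holomorphic_on_compose_gen[OF _ theta_z_holomorphic, unfolded o_def]) (auto intro!: holomorphic_intros)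
  from compose_nome_holomorphic[OF this]
  have 1: "(\<lambda>\<tau>. theta_z (- nome \<tau>)) holomorphic_on upper_half_plane" .
  have 2: "(\<lambda>\<tau>. - 1 / \<tau>) holomorphic_on upper_half_plane"
    by (intro holomorphic_intros) (auto simp: upper_half_plane_def)
  have "(\<lambda>\<tau>. theta_z (- nome (- 1 / \<tau>))) holomorphic_on upper_half_plane"
    using holomorphic_on_compose_gen[OF 2 1] upper_half_plane_inverse by (auto simp: o_def)
  hence hol: "F holomorphic_on upper_half_plane"
    unfolding F_def by (intro holomorphic_intros compose_nome_holomorphic theta_x_holomorphic)
  have "F \<tau> = 0"
  proof (rule analytic_continuation[OF hol open_upper_half_plane connected_upper_half_plane])
    show "(\<lambda>s. \<i> * complex_of_real s) ` {0<..} \<subseteq> upper_half_plane"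
      by (auto simp: upper_half_plane_def)
    show "\<i> \<in> upper_half_plane" by (simp add: upper_half_plane_def)
    show "\<i> islimpt (\<lambda>s. \<i> * complex_of_real s) ` {0<..}"
      unfolding islimpt_sequential
    proof (intro exI[of _ "\<lambda>n. \<i> * complex_of_real (1 + inverse (real (Suc n)))"] conjI allI)
      fix n
      have "1 + inverse (real (Suc n)) \<noteq> 1" by simp
      hence "\<i> * complex_of_real (1 + inverse (real (Suc n))) \<noteq> \<i>"
        by (metis mult_cancel_left2 complex_i_not_zero of_real_eq_1_iff)
      moreover have "1 + inverse (real (Suc n)) \<in> {0<..}" by (simp add: add_pos_pos)
      ultimately show "\<i> * complex_of_real (1 + inverse (real (Suc n))) \<in> (\<lambda>s. \<i> * complex_of_real s) ` {0<..} - {\<i>}"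
        by blast
    next
      have "(\<lambda>n. \<i> * complex_of_real (1 + inverse (real (Suc n)))) \<longlonglongrightarrow> \<i> * complex_of_real (1 + 0)"
        by (intro tendsto_intros LIMSEQ_inverse_real_of_nat)
      thus "(\<lambda>n. \<i> * complex_of_real (1 + inverse (real (Suc n)))) \<longlonglongrightarrow> \<i>" by simp
    qed
    fix z assume "z \<in> (\<lambda>s. \<i> * complex_of_real s) ` {0<..}"
    then obtain s where s: "s > 0" and z: "z = \<i> * complex_of_real s" by auto
    have "nome z = of_real (exp (- (pi * s)))" unfolding z
      by (simp add: exp_of_real[symmetric] mult_ac)
    moreover have "nome (- 1 / z) = of_real (exp (- (pi * (1 / s))))"
    proof -
      have "complex_of_real pi * \<i> * (- 1 / z) = complex_of_real (- (pi * (1 / s)))"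
        using s unfolding z by (simp add: field_simps)
      thus ?thesis by (simp only: exp_of_real)
    qed
    ultimately show "F z = 0"
      using theta_x_inversion_imaginary[OF s] unfolding F_def z by (simp add: power_mult_distrib)
  qed (rule assms)
  thus ?thesis by (simp add: F_def eq_neg_iff_add_eq_0)
qed

lemma theta_x_inversion:
  assumes "\<tau> \<in> upper_half_plane"
  shows "theta_x (nome (- 1 / \<tau>)) = - \<tau>\<^sup>2 * theta_z (- nome \<tau>)"
proof -
  have "\<tau> \<noteq> 0" using assms by (auto simp: upper_half_plane_def)
  thus ?thesis using theta_z_uminus_inversion[OF upper_half_plane_inverse[OF assms]]
    by (simp add: field_simps)
qed

lemma theta_z_inversion:
  assumes "\<tau> \<in> upper_half_plane"
  shows "theta_z (nome (- 1 / \<tau>)) = - \<tau>\<^sup>2 * theta_z (nome \<tau>)"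
proof -
  have "theta_z (nome (- 1 / \<tau>)) = theta_x (nome (- 1 / \<tau>)) + theta_z (- nome (- 1 / \<tau>))"
    by (rule theta_xz[symmetric, OF norm_nome_less_1[OF upper_half_plane_inverse[OF assms]]])
  also have "\<dots> = - \<tau>\<^sup>2 * (theta_x (nome \<tau>) + theta_z (- nome \<tau>))"
    unfolding theta_x_inversion[OF assms] theta_z_uminus_inversion[OF assms] by (simp only: distrib_left add.commute)
  finally show ?thesis unfolding theta_xz[OF norm_nome_less_1[OF assms]] .
qed

section \<open>The expansions and the rotation law of \<open>\<alpha>\<close> and \<open>\<Delta>\<close>\<close>

text \<open>In terms of \<open>x, y, z\<close> with \<open>z = x + y\<close> the form \<open>\<alpha>\<close> is \<open>z\<^sup>2 + 4 x y\<close>. The summands are exchanged by the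
  rotation \<open>rot\<close> below.\<close>
definition alpha_series :: "complex \<Rightarrow> complex" where
  "alpha_series w = theta_z w ^ 2 + 4 * theta_x w * theta_z (- w)"

text \<open>The quotient of \<open>\<Delta> = x y z\<^sup>2 / 16\<close> by the nome.\<close>
definition delta_unit :: "complex \<Rightarrow> complex" where
  "delta_unit w = half_theta2 w ^ 4 * theta_z (- w) * theta_z w ^ 2"

lemma theta_x_half: "norm w < 1 \<Longrightarrow> theta_x w = 16 * w * half_theta2 w ^ 4"
  by (simp add: theta_x_def theta2_eq power_mult_distrib)

lemma alpha_eq:
  assumes "\<tau> \<in> upper_half_plane"
  shows "alpha \<tau> = alpha_series (nome \<tau>)"
  unfolding alpha_def delta'_def epsilon'_def theta_10_power4 theta_01_power4 alpha_series_def
    theta_xz[OF norm_nome_less_1[OF assms], symmetric]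
  by (simp add: power2_eq_square field_simps)

lemma Delta_eq_xz:
  assumes "\<tau> \<in> upper_half_plane"
  shows "Delta_G \<tau> = theta_x (nome \<tau>) * theta_z (- nome \<tau>) * theta_z (nome \<tau>) ^ 2 / 16"
  unfolding Delta_G_def delta'_def epsilon'_def theta_10_power4 theta_01_power4
    theta_xz[OF norm_nome_less_1[OF assms], symmetric]
  by (simp add: power2_eq_square field_simps)

lemma Delta_eq:
  assumes "\<tau> \<in> upper_half_plane"
  shows "Delta_G \<tau> = nome \<tau> * delta_unit (nome \<tau>)"
  unfolding Delta_eq_xz[OF assms] theta_x_half[OF norm_nome_less_1[OF assms]] delta_unit_def
  by simp

lemma int_series_theta_x: "int_series theta_x"
  unfolding theta_x_def by (intro int_series_mult int_series_power int_series_theta2 int_series_id)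

lemma int_series_theta_z: "int_series theta_z"
  unfolding theta_z_def by (intro int_series_power int_series_theta3)

lemma int_series_alpha: "int_series alpha_series"
proof -
  have "int_series (\<lambda>w. 4 * theta_x w * theta_z (- w))"
    using int_series_mult[OF int_series_mult[OF int_series_const[of 4] int_series_theta_x]
        int_series_uminus_arg[OF int_series_theta_z]] by simp
  thus ?thesis
    unfolding alpha_series_def by (rule int_series_add[OF int_series_power[OF int_series_theta_z]])
qed

lemma int_series_delta_unit: "int_series delta_unit"
  unfolding delta_unit_def
  by (intro int_series_mult int_series_power int_series_uminus_arg int_series_half_theta2 int_series_theta_z)

lemma delta_unit_nonzero: "norm w < 1 \<Longrightarrow> delta_unit w \<noteq> 0"
  by (simp add: delta_unit_def theta_z_def theta3_nonzero half_theta2_nonzero)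

lemma series_at_0: "alpha_series 0 = 1" "delta_unit 0 = 1"
  by (simp_all add: alpha_series_def delta_unit_def theta_z_def theta_x_def theta_at_0)

text \<open>The rotation of order four about \<open>\<i>\<close>. It belongs to \<open>G\<close> but not to the theta group, whose two cusps
  it exchanges.\<close>
definition rot :: "complex \<Rightarrow> complex" where "rot \<tau> = (\<tau> - 1) / (\<tau> + 1)"

text \<open>The rotation is \<open>\<tau> \<mapsto> 1 - 1/w\<close> with \<open>w = (\<tau> + 1)/2\<close>, so the laws for translation and inversion apply. They
  produce theta values at \<open>w\<close>, which the doubling relations bring back to \<open>2 w = \<tau> + 1\<close>.\<close>
lemma rot_theta:
  assumes \<tau>: "\<tau> \<in> upper_half_plane"
  shows "theta_z (nome (rot \<tau>)) ^ 2 = - ((\<tau> + 1) ^ 4) * (theta_x (nome \<tau>) * theta_z (- nome \<tau>))"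
    and "theta_x (nome (rot \<tau>)) * theta_z (- nome (rot \<tau>)) = - (((\<tau> + 1) / 2) ^ 4) * theta_z (nome \<tau>) ^ 2"
proof -
  define w where "w = (\<tau> + 1) / 2"
  have w: "w \<in> upper_half_plane" using \<tau> by (simp add: w_def upper_half_plane_def)
  have nw: "norm (nome w) < 1" by (rule norm_nome_less_1[OF w])
  have "\<tau> + 1 \<noteq> 0" using \<tau> by (auto simp: upper_half_plane_def complex_eq_iff)
  hence rot: "rot \<tau> = - 1 / w + 1" by (simp add: rot_def w_def field_simps)
  have sq: "nome w ^ 2 = - nome \<tau>"
  proof -
    have "2 * w = \<tau> + 1" by (simp add: w_def)
    thus ?thesis unfolding nome_double[symmetric] by (simp only: nome_add_1)
  qed
  have "theta_z (nome (rot \<tau>)) = theta_z (- nome (- 1 / w))" unfolding rot nome_add_1 ..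
  also have "\<dots> = - w\<^sup>2 * theta_x (nome w)" by (rule theta_z_uminus_inversion[OF w])
  finally have "theta_z (nome (rot \<tau>)) ^ 2 = w ^ 4 * theta_x (nome w) ^ 2"
    by (simp add: power_mult_distrib flip: power_mult)
  also have "\<dots> = - (16 * w ^ 4) * (theta_x (nome \<tau>) * theta_z (- nome \<tau>))"
    unfolding theta_x_squared[OF nw] sq theta_x_uminus by simp
  also have "16 * w ^ 4 = (\<tau> + 1) ^ 4" by (simp add: w_def power_divide)
  finally show "theta_z (nome (rot \<tau>)) ^ 2 = - ((\<tau> + 1) ^ 4) * (theta_x (nome \<tau>) * theta_z (- nome \<tau>))" .
  have "theta_x (nome (rot \<tau>)) * theta_z (- nome (rot \<tau>)) = - (theta_x (nome (- 1 / w)) * theta_z (nome (- 1 / w)))"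
    unfolding rot nome_add_1 theta_x_uminus by simp
  also have "\<dots> = - (w ^ 4) * (theta_z (nome w) * theta_z (- nome w))"
    unfolding theta_x_inversion[OF w] theta_z_inversion[OF w] by (simp add: power2_eq_square power4_eq_xxxx)
  also have "\<dots> = - (w ^ 4) * theta_z (nome \<tau>) ^ 2"
    unfolding theta_z_product[OF nw] sq by simp
  finally show "theta_x (nome (rot \<tau>)) * theta_z (- nome (rot \<tau>)) = - (((\<tau> + 1) / 2) ^ 4) * theta_z (nome \<tau>) ^ 2"
    unfolding w_def .
qed

lemma rot_in_upper_half_plane:
  assumes "\<tau> \<in> upper_half_plane"
  shows "rot \<tau> \<in> upper_half_plane" "Im (rot \<tau>) = 2 * Im \<tau> / (norm (\<tau> + 1))\<^sup>2"
proof -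
  have n: "norm (\<tau> + 1) > 0" using assms by (auto simp: upper_half_plane_def complex_eq_iff)
  show "Im (rot \<tau>) = 2 * Im \<tau> / (norm (\<tau> + 1))\<^sup>2"
    by (simp add: rot_def Im_divide cmod_power2 algebra_simps)
  thus "rot \<tau> \<in> upper_half_plane" using assms n by (simp add: upper_half_plane_def)
qed

text \<open>The automorphy factor of the rotation as an element of \<open>G\<close> is \<open>(1 + \<i>)/2 \<cdot> (\<tau> + 1)\<close>. Its fourth power has
  a minus sign, which matches the sign in the exchange law for theta values.\<close>
lemma rot_factor: "((1 + \<i>) / 2 * z) ^ 4 = - (z ^ 4) / 4"
proof -
  have "((1 + \<i>) / 2)\<^sup>2 = \<i> / 2" by (simp add: power2_eq_square field_simps)
  hence "(((1 + \<i>) / 2)\<^sup>2)\<^sup>2 = - (1 / 4)" by (simp add: power2_eq_square)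
  hence "((1 + \<i>) / 2) ^ 4 = - (1 / 4)" by (simp flip: power_mult)
  thus ?thesis by (simp only: power_mult_distrib) simp
qed

lemma alpha_rot:
  assumes "\<tau> \<in> upper_half_plane"
  shows "alpha (rot \<tau>) = ((1 + \<i>) / 2 * (\<tau> + 1)) ^ 4 * alpha \<tau>"
proof -
  have u: "((\<tau> + 1) / 2) ^ 4 = (\<tau> + 1) ^ 4 / 16" by (simp add: power_divide)
  show ?thesis
    unfolding alpha_eq[OF assms] alpha_eq[OF rot_in_upper_half_plane(1)[OF assms]] alpha_series_def mult.assoc[of 4]
      rot_theta[OF assms] rot_factor u
    by (simp add: algebra_simps)
qed

lemma Delta_rot:
  assumes "\<tau> \<in> upper_half_plane"
  shows "Delta_G (rot \<tau>) = ((1 + \<i>) / 2 * (\<tau> + 1)) ^ 8 * Delta_G \<tau>"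
proof -
  have u: "((\<tau> + 1) / 2) ^ 4 = (\<tau> + 1) ^ 4 / 16" by (simp add: power_divide)
  have eight: "z ^ 8 = z ^ 4 * z ^ 4" for z :: complex by (simp flip: power_add)
  show ?thesis
    unfolding Delta_eq_xz[OF assms] Delta_eq_xz[OF rot_in_upper_half_plane(1)[OF assms]]
      rot_theta[OF assms] eight rot_factor u
    by (simp add: algebra_simps)
qed

section \<open>Generators of the group\<close>

definition mat2 :: "complex \<Rightarrow> complex \<Rightarrow> complex \<Rightarrow> complex \<Rightarrow> complex^2^2" where
  "mat2 a b c d = vector [vector [a, b], vector [c, d]]"

lemma mat2_nth [simp]:
  "mat2 a b c d $ 1 $ 1 = a" "mat2 a b c d $ 1 $ 2 = b"
  "mat2 a b c d $ 2 $ 1 = c" "mat2 a b c d $ 2 $ 2 = d"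
  by (simp_all add: mat2_def vector_2)

lemma mat2_eqI:
  fixes A B :: "complex^2^2"
  assumes "A $ 1 $ 1 = B $ 1 $ 1" "A $ 1 $ 2 = B $ 1 $ 2" "A $ 2 $ 1 = B $ 2 $ 1" "A $ 2 $ 2 = B $ 2 $ 2"
  shows "A = B"
  using assms by (simp add: vec_eq_iff forall_2)

lemma mat2_cases: obtains a b c d where "g = mat2 a b c d"
  by (rule that[of "g$1$1" "g$1$2" "g$2$1" "g$2$2"]) (rule mat2_eqI; simp)

lemma matmul2:
  fixes A B :: "complex^2^2"
  shows "(A ** B) $ i $ j = A $ i $ 1 * B $ 1 $ j + A $ i $ 2 * B $ 2 $ j"
  by (simp add: matrix_matrix_mult_def sum_2)

lemma mat2_mult: "mat2 a b c d ** mat2 a' b' c' d' = mat2 (a * a' + b * c') (a * b' + b * d') (c * a' + d * c') (c * b' + d * d')"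
  by (rule mat2_eqI) (simp_all add: matmul2)

lemma mat2_one: "mat 1 = mat2 1 0 0 1"
  by (rule mat2_eqI) (simp_all add: mat_def)

definition g0_inv :: "complex^2^2" where
  "g0_inv = mat2 (1 / sqrt 2) (- \<i> / sqrt 2) (- \<i> / sqrt 2) (1 / sqrt 2)"

lemma g0_mat2: "g0 = mat2 (1 / sqrt 2) (\<i> / sqrt 2) (\<i> / sqrt 2) (1 / sqrt 2)"
  by (rule mat2_eqI) (simp_all add: g0_def vector_2)

lemma sqrt2_squared: "complex_of_real (sqrt 2) * complex_of_real (sqrt 2) = 2"
  by (simp flip: of_real_mult)

lemma g0_g0_inv: "g0 ** g0_inv = mat 1" "g0_inv ** g0 = mat 1"
  unfolding g0_mat2 g0_inv_def mat2_mult mat2_one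
  by (rule mat2_eqI; simp add: sqrt2_squared)+

lemma matrix_inv_g0: "matrix_inv g0 = g0_inv"
proof -
  have inv: "g0 ** matrix_inv g0 = mat 1 \<and> matrix_inv g0 ** g0 = mat 1"
    unfolding matrix_inv_def by (rule someI[of _ g0_inv]) (simp add: g0_g0_inv)
  hence "matrix_inv g0 = matrix_inv g0 ** g0 ** g0_inv"
    unfolding matrix_mul_assoc[symmetric] by (simp add: g0_g0_inv)
  thus ?thesis using inv by simp
qed

definition cayley :: "complex^2^2 \<Rightarrow> complex^2^2" where
  "cayley m = g0 ** m ** matrix_inv g0"

lemma cayley_mult: "cayley m ** cayley n = cayley (m ** n)"
proof -
  have "cayley m ** cayley n = g0 ** m ** (g0_inv ** g0) ** n ** g0_inv"
    by (simp only: cayley_def matrix_inv_g0 matrix_mul_assoc)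
  thus ?thesis by (simp add: g0_g0_inv cayley_def matrix_inv_g0 matrix_mul_assoc)
qed

text \<open>For a matrix over \<open>\<int>[\<i>]\<close> with rows \<open>(a, b)\<close> and \<open>(cnj b, cnj a)\<close> the halves cancel, and the entries are
  rational integers.\<close>
lemma cayley_mat2: "cayley (mat2 a b c d) = mat2 ((a + d + \<i> * (c - b)) / 2) ((b + c + \<i> * (d - a)) / 2)
     ((b + c + \<i> * (a - d)) / 2) ((a + d - \<i> * (c - b)) / 2)"
proof -
  define t where "t = 1 / complex_of_real (sqrt 2)"
  have t: "t * t = 1 / 2" by (simp add: t_def sqrt2_squared)
  have tt: "t * (t * x) = x / 2" for x using t by (simp add: mult.assoc[symmetric])
  have g: "g0 = mat2 t (\<i> * t) (\<i> * t) t" "g0_inv = mat2 t (- (\<i> * t)) (- (\<i> * t)) t"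
    by (simp_all add: g0_mat2 g0_inv_def t_def)
  show ?thesis
    unfolding cayley_def matrix_inv_g0 unfolding g mat2_mult
    by (rule mat2_eqI) (simp_all add: algebra_simps t tt add_divide_distrib diff_divide_distrib)
qed

definition T_mat :: "int \<Rightarrow> complex^2^2" where "T_mat n = mat2 1 (2 * of_int n) 0 1"
definition R_mat :: "complex^2^2" where "R_mat = mat2 ((1 + \<i>) / 2) (- (1 + \<i>) / 2) ((1 + \<i>) / 2) ((1 + \<i>) / 2)"
definition I_mat :: "complex^2^2" where "I_mat = mat2 \<i> 0 0 \<i>"

text \<open>The inverse of \<open>R_mat\<close> is omitted since \<open>R_mat\<close> has finite order.\<close>
inductive_set gens :: "(complex^2^2) set" where
  gens_one: "mat 1 \<in> gens"
| gens_mult: "t \<in> {T_mat 1, T_mat (-1), R_mat, I_mat} \<Longrightarrow> g \<in> gens \<Longrightarrow> t ** g \<in> gens"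

lemma gens_prod: "g \<in> gens \<Longrightarrow> h \<in> gens \<Longrightarrow> g ** h \<in> gens"
proof (induction g rule: gens.induct)
  case (gens_mult t g)
  have "t ** (g ** h) \<in> gens" by (rule gens.gens_mult[OF gens_mult(1) gens_mult(3)[OF gens_mult(4)]])
  thus ?case by (simp only: matrix_mul_assoc)
qed simp

lemma gens_basic: "t \<in> {T_mat 1, T_mat (-1), R_mat, I_mat} \<Longrightarrow> t \<in> gens"
  using gens_mult[OF _ gens_one] by simp

lemma T_mat_mult: "T_mat m ** T_mat n = T_mat (m + n)"
  by (simp add: T_mat_def mat2_mult algebra_simps)

lemma T_mat_gens: "T_mat n \<in> gens"
proof (induction n rule: int_induct[where k = 0])
  case base
  have "T_mat 0 = mat 1" by (simp add: T_mat_def mat2_one)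
  thus ?case using gens_one by simp
next
  case (step1 n)
  have "T_mat 1 ** T_mat n \<in> gens" by (rule gens_mult[OF _ step1(2)]) simp
  thus ?case by (simp only: T_mat_mult add.commute)
next
  case (step2 n)
  have "T_mat (-1) ** T_mat n \<in> gens" by (rule gens_mult[OF _ step2(2)]) simp
  moreover have "- 1 + n = n - 1" by simp
  ultimately show ?case by (simp only: T_mat_mult)
qed

text \<open>The square of the rotation is the inversion, up to a scalar.\<close>
lemma S_mat_gens: "mat2 0 1 (-1) 0 \<in> gens"
proof -
  have "I_mat ** (R_mat ** R_mat) = mat2 0 1 (-1) 0"
    unfolding I_mat_def R_mat_def mat2_mult by (rule mat2_eqI) (simp_all add: field_simps)
  moreover have "I_mat ** (R_mat ** R_mat) \<in> gens"
    by (intro gens_prod gens_basic) simp_all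
  ultimately show ?thesis by simp
qed

text \<open>Division with remainder modulo \<open>2 C\<close>, with the remainder of least absolute value. Parity excludes
  the remainder \<open>\<plusminus> C\<close>, hence the inequality is strict.\<close>
lemma reduce_mod_double:
  fixes A C :: int
  assumes "C \<noteq> 0" "odd (A + C)"
  obtains n where "\<bar>A + 2 * n * C\<bar> < \<bar>C\<bar>"
proof -
  define r where "r = A mod (2 * \<bar>C\<bar>)"
  define k where "k = A div (2 * \<bar>C\<bar>)"
  have A: "A = 2 * \<bar>C\<bar> * k + r" by (simp add: r_def k_def)
  have r: "0 \<le> r" "r < 2 * \<bar>C\<bar>" using assms(1) by (simp_all add: r_def)
  have C: "\<bar>C\<bar> = sgn C * C" by (simp add: abs_sgn mult.commute)
  have "odd (r + C)" using assms(2) unfolding A by simp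
  hence ne: "r \<noteq> \<bar>C\<bar>" by (cases "C \<ge> 0") auto
  show ?thesis
  proof (cases "r < \<bar>C\<bar>")
    case True
    have "A + 2 * (- (sgn C * k)) * C = A - 2 * (sgn C * C) * k" by (simp add: algebra_simps)
    also have "\<dots> = r" unfolding C[symmetric] using A by simp
    finally show ?thesis using True r by (intro that[of "- (sgn C * k)"]) simp
  next
    case False
    have "A + 2 * (- (sgn C * (k + 1))) * C = A - 2 * (sgn C * C) * k - 2 * (sgn C * C)" by (simp add: algebra_simps)
    also have "\<dots> = r - 2 * \<bar>C\<bar>" unfolding C[symmetric] using A by simp
    finally show ?thesis using False r ne by (intro that[of "- (sgn C * (k + 1))"]) simp
  qed
qed

text \<open>Euclid's algorithm in the first column. Only even translations are available, but the entries of the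
  first column have opposite parity, so each step still decreases the lower entry.\<close>
lemma theta_group_gens:
  fixes A B C D :: int
  assumes "A * D - B * C = 1" "even (A - D)" "even (B - C)"
  shows "mat2 (of_int A) (of_int B) (of_int C) (of_int D) \<in> gens"
  using assms
proof (induction "nat \<bar>C\<bar>" arbitrary: A B C D rule: less_induct)
  case less
  show ?case
  proof (cases "C = 0")
    case True
    hence AD: "A * D = 1" using less.prems by simp
    obtain n where B: "B = 2 * n" using less.prems(3) True by (auto elim: evenE)
    from AD consider "A = 1" "D = 1" | "A = -1" "D = -1"
      using zmult_eq_1_iff[of A D] by auto
    thus ?thesis
    proof cases
      case 1
      thus ?thesis using T_mat_gens[of n] by (simp add: T_mat_def True B)
    next
      case 2
      have "I_mat ** (I_mat ** T_mat (- n)) \<in> gens"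
        by (intro gens_prod T_mat_gens gens_basic) simp_all
      thus ?thesis by (simp add: T_mat_def I_mat_def mat2_mult True B 2)
    qed
  next
    case False
    have "odd (A + C)"
    proof
      assume "even (A + C)"
      hence "even (A * D - B * C)" using less.prems(2,3) by (cases "even A"; auto)
      thus False using less.prems(1) by simp
    qed
    with False obtain n where n: "\<bar>A + 2 * n * C\<bar> < \<bar>C\<bar>" by (rule reduce_mod_double)
    define A' where "A' = A + 2 * n * C"
    define B' where "B' = B + 2 * n * D"
    have IH: "mat2 (of_int (- C)) (of_int (- D)) (of_int A') (of_int B') \<in> gens"
    proof (rule less.hyps)
      show "nat \<bar>A'\<bar> < nat \<bar>C\<bar>" using n by (simp add: A'_def)
      show "- C * B' - - D * A' = 1" using less.prems(1) by (simp add: A'_def B'_def algebra_simps)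
      show "even (- C - B')" "even (- D - A')" using less.prems(2,3) by (simp_all add: A'_def B'_def)
    qed
    \<comment> \<open>Undo the translation and the inversion that led to the smaller matrix.\<close>
    have "T_mat (- n) ** (mat2 0 1 (-1) 0 ** mat2 (of_int (- C)) (of_int (- D)) (of_int A') (of_int B')) \<in> gens"
      by (intro gens_prod T_mat_gens S_mat_gens IH)
    moreover have "T_mat (- n) ** (mat2 0 1 (-1) 0 ** mat2 (of_int (- C)) (of_int (- D)) (of_int A') (of_int B'))
       = mat2 (of_int A) (of_int B) (of_int C) (of_int D)"
      by (simp add: T_mat_def mat2_mult A'_def B'_def)
    ultimately show ?thesis by simp
  qed
qed

lemma cayley_diag_gens: "cayley (mat2 1 0 0 (\<i> ^ j)) \<in> gens"
proof (induction j)
  case 0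
  have "cayley (mat2 1 0 0 1) = mat 1" by (simp add: cayley_mat2 mat2_one)
  thus ?case using gens_one by simp
next
  case (Suc j)
  have "R_mat = cayley (mat2 1 0 0 \<i>)" unfolding R_mat_def cayley_mat2
    by (rule mat2_eqI) (simp_all add: complex_eq_iff)
  moreover have "cayley (mat2 1 0 0 (\<i> ^ Suc j)) = cayley (mat2 1 0 0 \<i>) ** cayley (mat2 1 0 0 (\<i> ^ j))"
    by (simp add: cayley_mult mat2_mult)
  ultimately have "cayley (mat2 1 0 0 (\<i> ^ Suc j)) = R_mat ** cayley (mat2 1 0 0 (\<i> ^ j))"
    by (simp only:)
  thus ?case using gens_mult[OF _ Suc, of R_mat] by simp
qed

text \<open>The units of \<open>\<int>[\<i>]\<close> are the powers of \<open>\<i>\<close>.\<close>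
lemma gaussian_unit:
  assumes "u \<in> gaussian_integers" "cnj u * u = 1"
  obtains j where "u = \<i> ^ j"
proof -
  obtain x y :: int where u: "Re u = of_int x" "Im u = of_int y"
    using assms(1) by (auto simp: gaussian_integers_def elim!: Ints_cases)
  have "Re (cnj u * u) = of_int (x * x + y * y)" by (simp add: u)
  hence n: "x * x + y * y = 1" unfolding assms(2) by (metis of_int_eq_1_iff one_complex.sel(1))
  have "x * x \<le> 1" "y * y \<le> 1" using n zero_le_square[of x] zero_le_square[of y] by linarith+
  hence "\<bar>x\<bar> \<le> 1" "\<bar>y\<bar> \<le> 1" by (simp_all add: abs_square_le_1 power2_eq_square[symmetric])
  hence "x \<in> {-1, 0, 1}" "y \<in> {-1, 0, 1}" by auto
  with n have "(x, y) \<in> {(1, 0), (0, 1), (-1, 0), (0, -1)}" by auto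
  hence "u \<in> {1, \<i>, -1, - \<i>}" using u by (auto simp: complex_eq_iff)
  moreover have "1 = \<i> ^ 0" "\<i> = \<i> ^ 1" "-1 = \<i> ^ 2" "- \<i> = \<i> ^ 3" by (simp_all add: power3_eq_cube)
  ultimately show ?thesis using that by (metis empty_iff insert_iff)
qed

lemma gaussian_integers_closed:
  assumes "x \<in> gaussian_integers" "y \<in> gaussian_integers"
  shows "x * y \<in> gaussian_integers" "x - y \<in> gaussian_integers"
  using assms by (auto simp: gaussian_integers_def)

lemma mem_U11_iff:
  "mat2 a b c d \<in> U11_gauss \<longleftrightarrow> {a, b, c, d} \<subseteq> gaussian_integers \<and>
     cnj a * a - cnj c * c = 1 \<and> cnj a * b - cnj c * d = 0 \<and> cnj b * a - cnj d * c = 0 \<and> cnj b * b - cnj d * d = -1"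
proof -
  have H: "herm_H = mat2 1 0 0 (-1)" by (rule mat2_eqI) (simp_all add: herm_H_def vector_2)
  have ct: "conj_transpose (mat2 a b c d) = mat2 (cnj a) (cnj c) (cnj b) (cnj d)"
    by (rule mat2_eqI) (simp_all add: conj_transpose_def)
  have eq: "mat2 p q r s = mat2 p' q' r' s' \<longleftrightarrow> p = p' \<and> q = q' \<and> r = r' \<and> s = s'" for p q r s p' q' r' s'
    by (metis mat2_nth)
  show ?thesis unfolding U11_gauss_def H
    by (simp add: ct mat2_mult eq forall_2 algebra_simps)
qed

text \<open>Let \<open>u\<close> be the determinant of a unitary matrix \<open>m\<close>. The unitarity relations give \<open>d = u cnj a\<close> and
  \<open>b = u cnj c\<close>, so \<open>m\<close> is \<open>diag (1, u)\<close> times a matrix of determinant one. The Cayley transform of the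
  first factor is a power of the rotation, that of the second lies in the theta group.\<close>
lemma group_G_subset_gens: "group_G \<subseteq> gens"
proof
  fix g assume "g \<in> group_G"
  then obtain m where m: "m \<in> U11_gauss" and g: "g = cayley m"
    by (auto simp: group_G_def cayley_def)
  obtain a b c d where mm: "m = mat2 a b c d" by (rule mat2_cases)
  from m have gi: "a \<in> gaussian_integers" "b \<in> gaussian_integers" "c \<in> gaussian_integers" "d \<in> gaussian_integers"
    and e: "cnj a * a - cnj c * c = 1" "cnj a * b = cnj c * d" "cnj b * b - cnj d * d = -1"
    by (auto simp: mm mem_U11_iff)
  define u where "u = a * d - b * c"
  have "u * cnj a = (cnj a * a) * d - (cnj a * b) * c" by (simp add: u_def algebra_simps)
  also have "\<dots> = (cnj a * a - cnj c * c) * d" unfolding e(2) by (simp add: algebra_simps)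
  finally have d: "d = u * cnj a" unfolding e(1) by simp
  have "u * cnj c = a * (cnj c * d) - b * (cnj c * c)" by (simp add: u_def algebra_simps)
  also have "\<dots> = (cnj a * a - cnj c * c) * b" unfolding e(2)[symmetric] by (simp add: algebra_simps)
  finally have b: "b = u * cnj c" unfolding e(1) by simp
  have "cnj u * u * (cnj a * a - cnj c * c) = 1" using e(3) unfolding b d by (simp add: algebra_simps)
  hence uu: "cnj u * u = 1" unfolding e(1) by simp
  have "u \<in> gaussian_integers" unfolding u_def using gi by (intro gaussian_integers_closed)
  then obtain j where j: "u = \<i> ^ j" using uu by (rule gaussian_unit)
  have c: "c = u * cnj b" unfolding b using uu by (simp add: mult.commute mult.left_commute)
  have "m = mat2 1 0 0 u ** mat2 a b (cnj b) (cnj a)"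
    unfolding mm mat2_mult using c d by simp
  hence g': "g = cayley (mat2 1 0 0 (\<i> ^ j)) ** cayley (mat2 a b (cnj b) (cnj a))"
    unfolding g cayley_mult j by simp
  obtain x y where a: "Re a = of_int x" "Im a = of_int y"
    using gi(1) by (auto simp: gaussian_integers_def elim!: Ints_cases)
  obtain z w where b': "Re b = of_int z" "Im b = of_int w"
    using gi(2) by (auto simp: gaussian_integers_def elim!: Ints_cases)
  have "cnj b * b = cnj c * c" unfolding b using uu by (simp add: mult.commute mult.left_commute)
  hence "cnj a * a - cnj b * b = 1" using e(1) by simp
  hence "Re (cnj a * a - cnj b * b) = 1" by simp
  hence "of_int (x * x + y * y - (z * z + w * w)) = (1 :: real)" by (simp add: a b')
  hence det: "x * x + y * y - (z * z + w * w) = 1" by (simp only: of_int_eq_1_iff)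
  have "cayley (mat2 a b (cnj b) (cnj a)) = mat2 (of_int (x + w)) (of_int (z + y)) (of_int (z - y)) (of_int (x - w))"
    unfolding cayley_mat2 by (rule mat2_eqI) (simp_all add: complex_eq_iff a b')
  moreover have "mat2 (of_int (x + w)) (of_int (z + y)) (of_int (z - y)) (of_int (x - w)) \<in> gens"
    using det by (intro theta_group_gens) (simp_all add: algebra_simps)
  ultimately show "g \<in> gens" unfolding g' by (intro gens_prod cayley_diag_gens) simp
qed

lemma R_I_in_group_G: "R_mat \<in> group_G" "I_mat \<in> group_G"
proof -
  have cay: "cayley m \<in> group_G" if "m \<in> U11_gauss" for m
    unfolding group_G_def cayley_def using that by blast
  have R: "R_mat = cayley (mat2 1 0 0 \<i>)"
    unfolding R_mat_def cayley_mat2 by (rule mat2_eqI) (simp_all add: complex_eq_iff)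
  show "R_mat \<in> group_G"
    unfolding R by (rule cay) (simp add: mem_U11_iff gaussian_integers_def)
  have I: "I_mat = cayley (mat2 \<i> 0 0 \<i>)"
    unfolding I_mat_def cayley_mat2 by (rule mat2_eqI) simp_all
  show "I_mat \<in> group_G"
    unfolding I by (rule cay) (simp add: mem_U11_iff gaussian_integers_def)
qed

lemma automorphy_mult:
  assumes "automorphy_factor h \<tau> \<noteq> 0"
  shows "automorphy_factor (g ** h) \<tau> = automorphy_factor g (frac_linear h \<tau>) * automorphy_factor h \<tau>"
    and "frac_linear (g ** h) \<tau> = frac_linear g (frac_linear h \<tau>)"
proof -
  define N where "N = h $ 1 $ 1 * \<tau> + h $ 1 $ 2"
  define D where "D = automorphy_factor h \<tau>"
  have D: "D \<noteq> 0" and Dd: "D = h $ 2 $ 1 * \<tau> + h $ 2 $ 2" using assms by (simp_all add: D_def automorphy_factor_def)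
  have fr: "frac_linear h \<tau> = N / D" by (simp add: frac_linear_def N_def D_def automorphy_factor_def)
  have row: "(g ** h) $ i $ 1 * \<tau> + (g ** h) $ i $ 2 = (g $ i $ 1 * (N / D) + g $ i $ 2) * D" for i
  proof -
    have "(g ** h) $ i $ 1 * \<tau> + (g ** h) $ i $ 2 = g $ i $ 1 * N + g $ i $ 2 * D"
      unfolding N_def Dd matmul2 by (simp add: algebra_simps)
    thus ?thesis using D by (simp add: distrib_right)
  qed
  show "automorphy_factor (g ** h) \<tau> = automorphy_factor g (frac_linear h \<tau>) * automorphy_factor h \<tau>"
    unfolding fr D_def[symmetric] unfolding automorphy_factor_def row ..
  show "frac_linear (g ** h) \<tau> = frac_linear g (frac_linear h \<tau>)"
    unfolding fr unfolding frac_linear_def row using D by simp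
qed

lemma generator_action:
  "automorphy_factor (T_mat n) \<tau> = 1" "frac_linear (T_mat n) \<tau> = \<tau> + 2 * of_int n"
  "automorphy_factor I_mat \<tau> = \<i>" "frac_linear I_mat \<tau> = \<tau>"
  "automorphy_factor R_mat \<tau> = (1 + \<i>) / 2 * (\<tau> + 1)" "frac_linear R_mat \<tau> = rot \<tau>"
proof -
  show R: "automorphy_factor R_mat \<tau> = (1 + \<i>) / 2 * (\<tau> + 1)"
    by (simp only: automorphy_factor_def R_mat_def mat2_nth distrib_left mult_1_right)
  have "1 + \<i> \<noteq> 0" by (simp add: complex_eq_iff)
  moreover have "frac_linear R_mat \<tau> = ((1 + \<i>) / 2 * (\<tau> - 1)) / ((1 + \<i>) / 2 * (\<tau> + 1))"
  proof -
    have "(1 + \<i>) / 2 * \<tau> + - (1 + \<i>) / 2 = (1 + \<i>) / 2 * (\<tau> - 1)"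
      by (simp only: diff_conv_add_uminus distrib_left mult_minus_right mult_1_right minus_divide_left)
    thus ?thesis unfolding R[symmetric] frac_linear_def automorphy_factor_def
      by (simp only: R_mat_def mat2_nth)
  qed
  ultimately show "frac_linear R_mat \<tau> = rot \<tau>" by (simp add: rot_def)
qed (simp_all add: automorphy_factor_def frac_linear_def T_mat_def I_mat_def)

lemma generator_regular:
  assumes "t \<in> {T_mat 1, T_mat (-1), R_mat, I_mat}" "\<tau> \<in> upper_half_plane"
  shows "automorphy_factor t \<tau> \<noteq> 0" "frac_linear t \<tau> \<in> upper_half_plane"
proof -
  have "1 + \<i> \<noteq> 0" "\<tau> + 1 \<noteq> 0" using assms(2) by (auto simp: complex_eq_iff upper_half_plane_def)
  thus "automorphy_factor t \<tau> \<noteq> 0" using assms(1) by (auto simp: generator_action)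
  show "frac_linear t \<tau> \<in> upper_half_plane"
    using assms rot_in_upper_half_plane(1)[OF assms(2)] by (auto simp: generator_action upper_half_plane_def)
qed

lemma gens_regular:
  assumes "g \<in> gens" "\<tau> \<in> upper_half_plane"
  shows "automorphy_factor g \<tau> \<noteq> 0" "frac_linear g \<tau> \<in> upper_half_plane"
proof -
  have "automorphy_factor g \<tau> \<noteq> 0 \<and> frac_linear g \<tau> \<in> upper_half_plane"
    using assms(1)
  proof induction
    case gens_one
    show ?case using assms(2) by (simp add: automorphy_factor_def frac_linear_def mat2_one)
  next
    case (gens_mult t g)
    thus ?case using generator_regular[of t "frac_linear g \<tau>"] automorphy_mult[of g \<tau> t] by simp
  qed
  thus "automorphy_factor g \<tau> \<noteq> 0" "frac_linear g \<tau> \<in> upper_half_plane" by auto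
qed

text \<open>The transformation law is a cocycle condition, so it suffices to know it for the generators; the
  scalar \<open>\<i>\<close> only imposes a condition on the weight.\<close>
lemma transformation_from_generators:
  fixes k :: int
  assumes T: "\<And>\<tau>. \<tau> \<in> upper_half_plane \<Longrightarrow> f (\<tau> + 2) = f \<tau>"
    and R: "\<And>\<tau>. \<tau> \<in> upper_half_plane \<Longrightarrow> f (rot \<tau>) = ((1 + \<i>) / 2 * (\<tau> + 1)) powi k * f \<tau>"
    and I: "\<i> powi k = 1"
    and g: "g \<in> group_G" and \<tau>: "\<tau> \<in> upper_half_plane"
  shows "f (frac_linear g \<tau>) = automorphy_factor g \<tau> powi k * f \<tau>"
proof -
  have basic: "f (frac_linear t \<tau>) = automorphy_factor t \<tau> powi k * f \<tau>"
    if "t \<in> {T_mat 1, T_mat (-1), R_mat, I_mat}" "\<tau> \<in> upper_half_plane" for t \<tau>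
  proof -
    have "f (\<tau> - 2) = f \<tau>"
      using T[of "\<tau> - 2"] that(2) by (simp add: upper_half_plane_def)
    thus ?thesis using that T[OF that(2)] R[OF that(2)] I by (auto simp: generator_action)
  qed
  have "g \<in> gens" using g group_G_subset_gens by blast
  thus ?thesis
  proof induction
    case gens_one
    show ?case by (simp add: automorphy_factor_def frac_linear_def mat2_one)
  next
    case (gens_mult t g)
    show ?case
      unfolding automorphy_mult[OF gens_regular(1)[OF gens_mult(2) \<tau>]]
        basic[OF gens_mult(1) gens_regular(2)[OF gens_mult(2) \<tau>]] gens_mult(3) power_int_mult_distrib
      by simp
  qed
qed

section \<open>Automorphic forms as functions of the nome\<close>

lemma nome_add_2: "nome (\<tau> + 2) = nome \<tau>"
proof -
  have "\<tau> + 2 = \<tau> + 1 + 1" by simp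
  thus ?thesis by (simp only: nome_add_1 minus_minus)
qed

lemma nome_surj:
  assumes "w \<noteq> 0" "norm w < 1"
  obtains \<tau> where "\<tau> \<in> upper_half_plane" "nome \<tau> = w"
proof -
  define \<tau> where "\<tau> = Ln w / (pi * \<i>)"
  have e: "complex_of_real pi * \<i> * \<tau> = Ln w" by (simp add: \<tau>_def)
  have "nome \<tau> = w" unfolding e using assms(1) by (rule exp_Ln)
  moreover have "Im \<tau> > 0"
  proof (rule ccontr)
    assume "\<not> Im \<tau> > 0"
    hence "norm (nome \<tau>) \<ge> 1" unfolding norm_nome by (simp add: mult_nonneg_nonpos)
    thus False using \<open>nome \<tau> = w\<close> assms(2) by simp
  qed
  ultimately show thesis using that by (simp add: upper_half_plane_def)
qed

text \<open>The exponential maps the half plane onto the punctured disc, so convergence of the expansion at every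
  \<open>\<tau>\<close> is convergence on the unit disc. Holomorphy at the cusp becomes holomorphy at the origin.\<close>
lemma has_q_expansion_holomorphic:
  assumes "has_q_expansion f a"
  obtains \<phi> where "\<phi> holomorphic_on ball 0 1" "\<And>\<tau>. \<tau> \<in> upper_half_plane \<Longrightarrow> f \<tau> = \<phi> (nome \<tau>)"
    "\<And>w. norm w < 1 \<Longrightarrow> (\<lambda>n. a n * w ^ n) sums \<phi> w"
proof -
  define \<phi> where "\<phi> w = suminf (\<lambda>n. a n * w ^ n)" for w
  have s: "(\<lambda>n. a n * w ^ n) sums \<phi> w" if w: "norm w < 1" for w
  proof (cases "w = 0")
    case True
    have "summable (\<lambda>n. a n * 0 ^ n)" by (rule summable_finite[of "{0}"]) auto
    thus ?thesis unfolding \<phi>_def True by (rule summable_sums)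
  next
    case False
    then obtain \<tau> where "\<tau> \<in> upper_half_plane" "nome \<tau> = w" using w by (rule nome_surj)
    hence "(\<lambda>n. a n * w ^ n) sums f \<tau>" using assms unfolding has_q_expansion_def by blast
    thus ?thesis unfolding \<phi>_def by (rule summable_sums[OF sums_summable])
  qed
  have "\<phi> holomorphic_on ball 0 1"
    by (rule power_series_holomorphic[where a = a]) (use s in simp)
  moreover have "f \<tau> = \<phi> (nome \<tau>)" if "\<tau> \<in> upper_half_plane" for \<tau>
  proof -
    have "(\<lambda>n. a n * nome \<tau> ^ n) sums f \<tau>" using assms that unfolding has_q_expansion_def by blast
    thus ?thesis using s[OF norm_nome_less_1[OF that]] by (rule sums_unique2)
  qed
  ultimately show thesis using s that by blast
qed

lemma holomorphic_has_q_expansion: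
  assumes "\<phi> holomorphic_on ball 0 1" "\<And>\<tau>. \<tau> \<in> upper_half_plane \<Longrightarrow> f \<tau> = \<phi> (nome \<tau>)"
  shows "has_q_expansion f (\<lambda>n. (deriv ^^ n) \<phi> 0 / fact n)"
  unfolding has_q_expansion_def
proof
  fix \<tau> assume t: "\<tau> \<in> upper_half_plane"
  have "nome \<tau> \<in> ball 0 1" using norm_nome_less_1[OF t] by simp
  from holomorphic_power_series[OF assms(1) this]
  show "(\<lambda>n. (deriv ^^ n) \<phi> 0 / fact n * nome \<tau> ^ n) sums f \<tau>"
    by (simp add: assms(2)[OF t])
qed

lemma integral_expansion_iff:
  "integral_expansion f \<longleftrightarrow> (\<exists>\<phi>. int_series \<phi> \<and> (\<forall>\<tau>\<in>upper_half_plane. f \<tau> = \<phi> (nome \<tau>)))"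
proof
  assume "integral_expansion f"
  then obtain a :: "nat \<Rightarrow> int" where "has_q_expansion f (\<lambda>n. of_int (a n))"
    unfolding integral_expansion_def by (elim exE)
  then obtain \<phi> where "\<phi> holomorphic_on ball 0 1"
    and \<phi>: "\<And>\<tau>. \<tau> \<in> upper_half_plane \<Longrightarrow> f \<tau> = \<phi> (nome \<tau>)"
    "\<And>w. norm w < 1 \<Longrightarrow> (\<lambda>n. of_int (a n) * w ^ n) sums \<phi> w"
    by (rule has_q_expansion_holomorphic) (rule that)
  have "int_series \<phi>" by (rule int_seriesI[OF \<phi>(2)])
  thus "\<exists>\<phi>. int_series \<phi> \<and> (\<forall>\<tau>\<in>upper_half_plane. f \<tau> = \<phi> (nome \<tau>))" using \<phi>(1) by (intro exI[of _ \<phi>]) simp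
next
  assume "\<exists>\<phi>. int_series \<phi> \<and> (\<forall>\<tau>\<in>upper_half_plane. f \<tau> = \<phi> (nome \<tau>))"
  then obtain \<phi> where i: "int_series \<phi>" and f: "\<forall>\<tau>\<in>upper_half_plane. f \<tau> = \<phi> (nome \<tau>)" by (elim exE conjE)
  from i obtain a :: "nat \<Rightarrow> int" where a: "\<And>w. norm w < 1 \<Longrightarrow> (\<lambda>n. of_int (a n) * w ^ n) sums \<phi> w"
    by (rule int_seriesE) (rule that)
  have "has_q_expansion f (\<lambda>n. of_int (a n))"
    unfolding has_q_expansion_def using a[OF norm_nome_less_1] f by simp
  thus "integral_expansion f" unfolding integral_expansion_def by (rule exI[of _ a])
qed

lemma automorphic_formsI:
  assumes "\<phi> holomorphic_on ball 0 1" "\<And>\<tau>. \<tau> \<in> upper_half_plane \<Longrightarrow> f \<tau> = \<phi> (nome \<tau>)"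
    and "\<And>g \<tau>. g \<in> group_G \<Longrightarrow> \<tau> \<in> upper_half_plane \<Longrightarrow> f (frac_linear g \<tau>) = automorphy_factor g \<tau> powi k * f \<tau>"
    and "\<And>\<tau>. \<tau> \<notin> upper_half_plane \<Longrightarrow> f \<tau> = 0"
  shows "f \<in> automorphic_forms k"
proof -
  have "f holomorphic_on upper_half_plane"
    by (rule holomorphic_transform[OF compose_nome_holomorphic[OF assms(1)]]) (simp add: assms(2))
  thus ?thesis unfolding automorphic_forms_def
    using holomorphic_has_q_expansion[OF assms(1,2)] assms(3,4) by blast
qed

lemma automorphic_formsE:
  assumes "f \<in> automorphic_forms k"
  obtains \<phi> where "\<phi> holomorphic_on ball 0 1" "\<And>\<tau>. \<tau> \<in> upper_half_plane \<Longrightarrow> f \<tau> = \<phi> (nome \<tau>)"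
proof -
  from assms obtain a where "has_q_expansion f a" unfolding automorphic_forms_def by blast
  thus thesis using that by (elim has_q_expansion_holomorphic) blast
qed

lemma automorphic_forms_law:
  "f \<in> automorphic_forms k \<Longrightarrow> g \<in> group_G \<Longrightarrow> \<tau> \<in> upper_half_plane \<Longrightarrow>
     f (frac_linear g \<tau>) = automorphy_factor g \<tau> powi k * f \<tau>"
  by (simp add: automorphic_forms_def)

lemma automorphic_forms_off: "f \<in> automorphic_forms k \<Longrightarrow> \<tau> \<notin> upper_half_plane \<Longrightarrow> f \<tau> = 0"
  by (simp add: automorphic_forms_def)

lemma group_G_regular:
  assumes "g \<in> group_G" "\<tau> \<in> upper_half_plane"
  shows "automorphy_factor g \<tau> \<noteq> 0" "frac_linear g \<tau> \<in> upper_half_plane"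
  using assms gens_regular group_G_subset_gens by blast+

lemma automorphic_forms_mult:
  assumes f: "f \<in> automorphic_forms k" and g: "g \<in> automorphic_forms l"
  shows "f * g \<in> automorphic_forms (k + l)"
proof -
  obtain \<phi> where \<phi>: "\<phi> holomorphic_on ball 0 1" "\<And>\<tau>. \<tau> \<in> upper_half_plane \<Longrightarrow> f \<tau> = \<phi> (nome \<tau>)"
    by (rule automorphic_formsE[OF f], rule that)
  obtain \<psi> where \<psi>: "\<psi> holomorphic_on ball 0 1" "\<And>\<tau>. \<tau> \<in> upper_half_plane \<Longrightarrow> g \<tau> = \<psi> (nome \<tau>)"
    by (rule automorphic_formsE[OF g], rule that)
  show ?thesis
  proof (rule automorphic_formsI)
    show "(\<lambda>w. \<phi> w * \<psi> w) holomorphic_on ball 0 1" by (intro holomorphic_intros \<phi> \<psi>)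
    show "(f * g) (frac_linear \<gamma> \<tau>) = automorphy_factor \<gamma> \<tau> powi (k + l) * (f * g) \<tau>"
      if "\<gamma> \<in> group_G" "\<tau> \<in> upper_half_plane" for \<gamma> \<tau>
      using automorphic_forms_law[OF f that] automorphic_forms_law[OF g that] group_G_regular[OF that]
      by (simp add: power_int_add)
  qed (simp_all add: \<phi> \<psi> automorphic_forms_off[OF f])
qed

lemma automorphic_forms_add:
  assumes f: "f \<in> automorphic_forms k" and g: "g \<in> automorphic_forms k"
  shows "f + g \<in> automorphic_forms k"
proof -
  obtain \<phi> where \<phi>: "\<phi> holomorphic_on ball 0 1" "\<And>\<tau>. \<tau> \<in> upper_half_plane \<Longrightarrow> f \<tau> = \<phi> (nome \<tau>)"
    by (rule automorphic_formsE[OF f], rule that)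
  obtain \<psi> where \<psi>: "\<psi> holomorphic_on ball 0 1" "\<And>\<tau>. \<tau> \<in> upper_half_plane \<Longrightarrow> g \<tau> = \<psi> (nome \<tau>)"
    by (rule automorphic_formsE[OF g], rule that)
  show ?thesis
  proof (rule automorphic_formsI)
    show "(\<lambda>w. \<phi> w + \<psi> w) holomorphic_on ball 0 1" by (intro holomorphic_intros \<phi> \<psi>)
    show "(f + g) (frac_linear \<gamma> \<tau>) = automorphy_factor \<gamma> \<tau> powi k * (f + g) \<tau>"
      if "\<gamma> \<in> group_G" "\<tau> \<in> upper_half_plane" for \<gamma> \<tau>
      using automorphic_forms_law[OF f that] automorphic_forms_law[OF g that]
      by (simp add: distrib_left)
  qed (simp_all add: \<phi> \<psi> automorphic_forms_off[OF f] automorphic_forms_off[OF g])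
qed

lemma automorphic_forms_zero: "0 \<in> automorphic_forms k"
  by (rule automorphic_formsI[where \<phi> = "\<lambda>_. 0"]) (auto intro: holomorphic_intros)

lemma automorphic_forms_const: "on_uhp (\<lambda>_. c) \<in> automorphic_forms 0"
  by (rule automorphic_formsI[where \<phi> = "\<lambda>_. c"])
     (auto intro: holomorphic_intros simp: on_uhp_def group_G_regular)

lemma on_uhp_formI:
  assumes phi: "\<phi> holomorphic_on ball 0 1" "\<And>\<tau>. \<tau> \<in> upper_half_plane \<Longrightarrow> f \<tau> = \<phi> (nome \<tau>)"
    and R: "\<And>\<tau>. \<tau> \<in> upper_half_plane \<Longrightarrow> f (rot \<tau>) = ((1 + \<i>) / 2 * (\<tau> + 1)) powi k * f \<tau>"
    and I: "\<i> powi k = 1"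
  shows "on_uhp f \<in> automorphic_forms k"
proof (rule automorphic_formsI[OF phi(1)])
  have T: "f (\<tau> + 2) = f \<tau>" if "\<tau> \<in> upper_half_plane" for \<tau>
  proof -
    have "\<tau> + 2 \<in> upper_half_plane" using that by (simp add: upper_half_plane_def)
    thus ?thesis using that phi(2) by (simp only: nome_add_2)
  qed
  fix g \<tau> assume g: "g \<in> group_G" "\<tau> \<in> upper_half_plane"
  show "on_uhp f (frac_linear g \<tau>) = automorphy_factor g \<tau> powi k * on_uhp f \<tau>"
    using transformation_from_generators[OF T R I g] group_G_regular(2)[OF g] g(2) by (simp add: on_uhp_def)
qed (simp_all add: on_uhp_def phi)

lemma alpha_form: "on_uhp alpha \<in> automorphic_forms 4"
proof (rule on_uhp_formI)
  show "alpha_series holomorphic_on ball 0 1" by (rule int_series_imp_holomorphic[OF int_series_alpha])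
  show "alpha (rot \<tau>) = ((1 + \<i>) / 2 * (\<tau> + 1)) powi 4 * alpha \<tau>" if "\<tau> \<in> upper_half_plane" for \<tau>
    using alpha_rot[OF that] by simp
  show "\<i> powi 4 = 1" by simp
qed (rule alpha_eq)

lemma Delta_form: "on_uhp Delta_G \<in> automorphic_forms 8"
proof (rule on_uhp_formI)
  show "(\<lambda>w. w * delta_unit w) holomorphic_on ball 0 1"
    by (intro holomorphic_intros int_series_imp_holomorphic[OF int_series_delta_unit])
  show "Delta_G (rot \<tau>) = ((1 + \<i>) / 2 * (\<tau> + 1)) powi 8 * Delta_G \<tau>" if "\<tau> \<in> upper_half_plane" for \<tau>
    using Delta_rot[OF that] by simp
  have "\<i> ^ 8 = (\<i>\<^sup>2) ^ 4" by (simp only: power_mult[symmetric]) simp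
  thus "\<i> powi 8 = 1" by simp
qed (rule Delta_eq)

lemma Delta_nonzero: "\<tau> \<in> upper_half_plane \<Longrightarrow> Delta_G \<tau> \<noteq> 0"
  using delta_unit_nonzero[OF norm_nome_less_1] by (simp add: Delta_eq)

section \<open>Vanishing theorems\<close>

text \<open>The scalar matrix \<open>\<i>\<close> acts trivially, but its automorphy factor is \<open>\<i>\<close>.\<close>
lemma weight_multiple_of_4:
  assumes "f \<in> automorphic_forms k" "f \<noteq> 0"
  shows "4 dvd k"
proof -
  obtain \<tau> where "f \<tau> \<noteq> 0" using assms(2) by (auto simp: fun_eq_iff)
  moreover from this have "\<tau> \<in> upper_half_plane" using automorphic_forms_off[OF assms(1)] by blast
  ultimately have "\<i> powi k = 1"
    using automorphic_forms_law[OF assms(1) R_I_in_group_G(2), of \<tau>] by (simp add: generator_action)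
  moreover have "\<i> powi k = cis (pi / 2 * of_int k)"
    by (simp only: cis_pi_half[symmetric] cis_power_int mult.commute)
  ultimately have "Re (cis (pi / 2 * of_int k)) = 1" by simp
  hence "cos (pi / 2 * of_int k) = 1" by (simp only: cis.sel)
  then obtain n :: int where "pi / 2 * of_int k = of_int n * 2 * pi" by (auto simp: cos_one_2pi_int)
  hence "of_int k = (of_int (4 * n) :: real)" by (simp add: field_simps)
  hence "k = 4 * n" by (simp only: of_int_eq_iff)
  thus ?thesis by simp
qed

text \<open>The inverse rotation, which moves points near the cusp \<open>1\<close> upwards in the same way as \<open>rot\<close> does near \<open>-1\<close>.\<close>
lemma rot_cubed:
  assumes "\<tau> \<in> upper_half_plane"
  shows "rot (rot (rot \<tau>)) = (\<tau> + 1) / (1 - \<tau>)"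
proof -
  have ne: "\<tau> \<noteq> 0" "\<tau> + 1 \<noteq> 0" "1 - \<tau> \<noteq> 0" using assms by (auto simp: upper_half_plane_def complex_eq_iff)
  have "rot (rot \<tau>) = - 1 / \<tau>"
  proof -
    have e: "rot \<tau> - 1 = - 2 / (\<tau> + 1)" "rot \<tau> + 1 = 2 * \<tau> / (\<tau> + 1)"
      using ne by (simp_all add: rot_def field_simps)
    moreover have "(- 2 / c) / (2 * t / c) = - 1 / t" if "c \<noteq> 0" "t \<noteq> 0" for c t :: complex
      using that by (simp add: field_simps)
    ultimately show ?thesis unfolding rot_def[of "rot \<tau>"] using ne by (simp only: not_False_eq_True)
  qed
  moreover have "rot (- 1 / \<tau>) = (\<tau> + 1) / (1 - \<tau>)"
  proof -
    have e: "- 1 / \<tau> - 1 = - (\<tau> + 1) / \<tau>" "- 1 / \<tau> + 1 = - (1 - \<tau>) / \<tau>"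
      using ne by (simp_all add: field_simps)
    show ?thesis unfolding rot_def e using ne by (simp add: divide_simps) (simp add: algebra_simps)
  qed
  ultimately show ?thesis by simp
qed

text \<open>If the real part lies in \<open>[-1, 1]\<close>, one of the numbers \<open>|\<tau> \<plusminus> 1|\<^sup>2\<close> is at most \<open>1 + (Im \<tau>)\<^sup>2\<close>.
  The rotation or its inverse divides the imaginary part by half of it, hence by at most \<open>5/8\<close> as long as
  the imaginary part is below \<open>1/2\<close>.\<close>
lemma reduce_to_high_point:
  assumes rot: "\<And>\<tau>. \<tau> \<in> upper_half_plane \<Longrightarrow> f (rot \<tau>) = f \<tau>"
    and T: "\<And>\<tau>. \<tau> \<in> upper_half_plane \<Longrightarrow> f (\<tau> + 2) = f \<tau>"
    and \<tau>: "\<tau> \<in> upper_half_plane"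
  shows "\<exists>\<sigma>\<in>upper_half_plane. Im \<sigma> \<ge> 1/2 \<and> f \<sigma> = f \<tau>"
proof -
  have Tn: "f (\<sigma> + 2 * of_int n) = f \<sigma>" if "\<sigma> \<in> upper_half_plane" for \<sigma> n
  proof (induction n rule: int_induct[where k = 0])
    case (step1 i)
    have "f (\<sigma> + 2 * of_int i + 2) = f (\<sigma> + 2 * of_int i)" using that by (intro T) (simp add: upper_half_plane_def)
    moreover have "\<sigma> + 2 * of_int (i + 1) = \<sigma> + 2 * of_int i + 2" by simp
    ultimately show ?case using step1 by (simp only:)
  next
    case (step2 i)
    have "f (\<sigma> + 2 * of_int (i - 1) + 2) = f (\<sigma> + 2 * of_int (i - 1))" using that by (intro T) (simp add: upper_half_plane_def)
    moreover have "\<sigma> + 2 * of_int (i - 1) + 2 = \<sigma> + 2 * of_int i" by simp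
    ultimately show ?case using step2 by (simp only:)
  qed simp
  have up: "\<exists>\<rho>\<in>upper_half_plane. Im \<rho> \<ge> 8/5 * Im \<sigma> \<and> f \<rho> = f \<sigma>"
    if s: "\<sigma> \<in> upper_half_plane" and low: "Im \<sigma> < 1/2" for \<sigma>
  proof -
    \<comment> \<open>Translate the real part into \<open>(-1, 1]\<close>.\<close>
    define n where "n = \<lfloor>(1 - Re \<sigma>) / 2\<rfloor>"
    define z where "z = \<sigma> + 2 * of_int n"
    have z: "z \<in> upper_half_plane" "Im z = Im \<sigma>" "f z = f \<sigma>"
      using s Tn[OF s] by (simp_all add: z_def upper_half_plane_def)
    have fl: "of_int n \<le> (1 - Re \<sigma>) / 2" "(1 - Re \<sigma>) / 2 < of_int n + 1"
      unfolding n_def by linarith+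
    have Re_z: "Re z = Re \<sigma> + 2 * of_int n" by (simp add: z_def)
    have re: "-1 < Re z" "Re z \<le> 1" using fl unfolding Re_z by (simp_all add: field_simps)
    have pos: "Im z > 0" using z(1) by (simp add: upper_half_plane_def)
    have bound: "8/5 * Im z \<le> 2 * Im z / d" if "0 < d" "d \<le> 1 + (Im z)\<^sup>2" for d
    proof -
      have "(Im z)\<^sup>2 \<le> (1/2)\<^sup>2" using low z(2) pos by (intro power_mono) auto
      hence "d \<le> 5/4" using that by (simp add: power2_eq_square)
      hence "8/5 * Im z * d \<le> 8/5 * Im z * (5/4)" using pos by (intro mult_left_mono) auto
      thus ?thesis using that(1) by (simp add: pos_le_divide_eq)
    qed
    show ?thesis
    proof (cases "Re z \<le> 0")
      case True
      have "(norm (z + 1))\<^sup>2 = (Re z + 1)\<^sup>2 + (Im z)\<^sup>2" by (simp add: cmod_power2)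
      moreover have "(Re z + 1)\<^sup>2 \<le> 1" using re True by (intro power_le_one) auto
      moreover have "(norm (z + 1))\<^sup>2 > 0" using pos by (auto simp: complex_eq_iff)
      ultimately have "8/5 * Im z \<le> Im (rot z)"
        unfolding rot_in_upper_half_plane(2)[OF z(1)] by (intro bound) auto
      thus ?thesis using rot[OF z(1)] z rot_in_upper_half_plane(1)[OF z(1)] by (intro bexI[of _ "rot z"]) auto
    next
      case False
      define r where "r = rot (rot (rot z))"
      have r: "r = (z + 1) / (1 - z)" unfolding r_def by (rule rot_cubed[OF z(1)])
      have "Im r = 2 * Im z / (norm (1 - z))\<^sup>2"
        unfolding r by (simp add: Im_divide cmod_power2 algebra_simps)
      moreover have "(norm (1 - z))\<^sup>2 = (1 - Re z)\<^sup>2 + (Im z)\<^sup>2" by (simp add: cmod_power2)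
      moreover have "(1 - Re z)\<^sup>2 \<le> 1" using re False by (intro power_le_one) auto
      moreover have "(norm (1 - z))\<^sup>2 > 0" using pos by (auto simp: complex_eq_iff)
      ultimately have "8/5 * Im z \<le> Im r" using bound[of "(norm (1 - z))\<^sup>2"] by simp
      moreover have "r \<in> upper_half_plane" "f r = f z"
        unfolding r_def using z(1) rot rot_in_upper_half_plane(1) by simp_all
      ultimately show ?thesis using z by (intro bexI[of _ r]) auto
    qed
  qed
  \<comment> \<open>Iterating the step multiplies the height by \<open>8/5\<close> until it exceeds \<open>1/2\<close>.\<close>
  obtain N where N: "1/2 / Im \<tau> < (8/5) ^ N" using real_arch_pow[of "8/5" "1/2 / Im \<tau>"] by auto
  have "\<exists>\<sigma>\<in>upper_half_plane. (Im \<sigma> \<ge> 1/2 \<or> Im \<sigma> \<ge> (8/5) ^ n * Im \<tau>) \<and> f \<sigma> = f \<tau>" for n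
  proof (induction n)
    case 0
    show ?case using \<tau> by (intro bexI[of _ \<tau>]) auto
  next
    case (Suc n)
    then obtain \<sigma> where s: "\<sigma> \<in> upper_half_plane" "Im \<sigma> \<ge> 1/2 \<or> Im \<sigma> \<ge> (8/5) ^ n * Im \<tau>" "f \<sigma> = f \<tau>" by blast
    show ?case
    proof (cases "Im \<sigma> \<ge> 1/2")
      case True
      thus ?thesis using s by blast
    next
      case False
      then obtain \<rho> where "\<rho> \<in> upper_half_plane" "Im \<rho> \<ge> 8/5 * Im \<sigma>" "f \<rho> = f \<sigma>" using up[OF s(1)] by auto
      moreover have "8/5 * Im \<sigma> \<ge> 8/5 * ((8/5) ^ n * Im \<tau>)" using s(2) False by (intro mult_left_mono) auto
      moreover have "(8/5) ^ Suc n * Im \<tau> = 8/5 * ((8/5) ^ n * Im \<tau>)" by simp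
      ultimately have "Im \<rho> \<ge> (8/5) ^ Suc n * Im \<tau>" by linarith
      thus ?thesis using s(3) \<open>\<rho> \<in> upper_half_plane\<close> \<open>f \<rho> = f \<sigma>\<close> by (intro bexI[of _ \<rho>]) auto
    qed
  qed
  from this[of N] obtain \<sigma> where s: "\<sigma> \<in> upper_half_plane" "Im \<sigma> \<ge> 1/2 \<or> Im \<sigma> \<ge> (8/5) ^ N * Im \<tau>" "f \<sigma> = f \<tau>" by blast
  have "1/2 < (8/5) ^ N * Im \<tau>" using N \<tau> by (simp add: upper_half_plane_def pos_divide_less_eq)
  thus ?thesis using s by (intro bexI[of _ \<sigma>]) auto
qed

text \<open>Since each value is attained at height at least \<open>1/2\<close>, the function \<open>\<phi>\<close> on the unit disc attains
  the maximum of its modulus on a smaller closed disc, and is constant by the maximum principle.\<close>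
lemma weight_0_cusp_form_zero:
  assumes f: "f \<in> automorphic_forms 0" and phi: "\<phi> holomorphic_on ball 0 1"
    and f_phi: "\<And>\<tau>. \<tau> \<in> upper_half_plane \<Longrightarrow> f \<tau> = \<phi> (nome \<tau>)" and 0: "\<phi> 0 = 0"
  shows "f = 0"
proof -
  define r where "r = exp (- (pi / 2))"
  have r: "0 < r" "r < 1" by (simp_all add: r_def)
  have "continuous_on (cball 0 r) (\<lambda>w. norm (\<phi> w))"
    using r by (intro continuous_on_norm holomorphic_on_imp_continuous_on holomorphic_on_subset[OF phi]) auto
  then obtain \<xi> where xi: "\<xi> \<in> cball 0 r" "\<And>w. w \<in> cball 0 r \<Longrightarrow> norm (\<phi> w) \<le> norm (\<phi> \<xi>)"
    using continuous_attains_sup[of "cball 0 r" "\<lambda>w. norm (\<phi> w)"] r by auto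
  have max: "norm (\<phi> w) \<le> norm (\<phi> \<xi>)" if w: "w \<in> ball 0 1" for w
  proof (cases "w = 0")
    case True
    thus ?thesis using xi(2)[of w] r by simp
  next
    case False
    obtain \<tau> where t: "\<tau> \<in> upper_half_plane" "nome \<tau> = w" using nome_surj[OF False] w by auto
    have "f (rot \<sigma>) = f \<sigma>" if "\<sigma> \<in> upper_half_plane" for \<sigma>
      using automorphic_forms_law[OF f R_I_in_group_G(1) that] by (simp add: generator_action)
    moreover have "f (\<sigma> + 2) = f \<sigma>" if "\<sigma> \<in> upper_half_plane" for \<sigma>
    proof -
      have "\<sigma> + 2 \<in> upper_half_plane" using that by (simp add: upper_half_plane_def)
      thus ?thesis using that f_phi by (simp only: nome_add_2)
    qed
    ultimately obtain \<sigma> where s: "\<sigma> \<in> upper_half_plane" "Im \<sigma> \<ge> 1/2" "f \<sigma> = f \<tau>"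
      using reduce_to_high_point[of f \<tau>] t(1) by blast
    have "norm (nome \<sigma>) \<le> r" unfolding norm_nome r_def using s(2) by simp
    hence "norm (\<phi> (nome \<sigma>)) \<le> norm (\<phi> \<xi>)" by (intro xi(2)) simp
    thus ?thesis using s(3) f_phi[OF s(1)] f_phi[OF t(1)] t(2) by simp
  qed
  have "\<phi> constant_on ball 0 1"
  proof (rule maximum_modulus_principle[OF phi open_ball connected_ball open_ball subset_refl])
    show "\<xi> \<in> ball 0 1" using xi(1) r by simp
  qed (rule max)
  then obtain c where c: "\<And>w. w \<in> ball 0 1 \<Longrightarrow> \<phi> w = c" by (auto simp: constant_on_def)
  have "c = 0" using c[of 0] 0 by simp
  hence "\<phi> w = 0" if "norm w < 1" for w using c[of w] that by simp
  hence "f \<tau> = 0" for \<tau>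
    using f_phi norm_nome_less_1 automorphic_forms_off[OF f] by (cases "\<tau> \<in> upper_half_plane") auto
  thus ?thesis by (simp add: fun_eq_iff)
qed

lemma automorphic_forms_power:
  assumes "f \<in> automorphic_forms k"
  shows "on_uhp (\<lambda>\<tau>. f \<tau> ^ n) \<in> automorphic_forms (int n * k)"
proof (induction n)
  case 0
  show ?case using automorphic_forms_const[of 1] by simp
next
  case (Suc n)
  have "f * on_uhp (\<lambda>\<tau>. f \<tau> ^ n) = on_uhp (\<lambda>\<tau>. f \<tau> ^ Suc n)" by (auto simp: on_uhp_def fun_eq_iff)
  thus ?case using automorphic_forms_mult[OF assms Suc] by (simp add: algebra_simps)
qed

text \<open>The product \<open>f\<^sup>8 \<Delta>\<^sup>-\<^sup>k\<close> has weight zero and vanishes at the cusp, and \<open>\<Delta>\<close> has no zeros in the half plane.\<close>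
lemma negative_weight_zero:
  assumes f: "f \<in> automorphic_forms k" and k: "k < 0"
  shows "f = 0"
proof -
  define n where "n = nat (- k)"
  have n: "int n = - k" "n > 0" using k by (simp_all add: n_def)
  \<comment> \<open>The exponent eight balances the weight eight of \<open>\<Delta>\<close>, for every \<open>k\<close>.\<close>
  define F where "F = on_uhp (\<lambda>\<tau>. f \<tau> ^ 8) * on_uhp (\<lambda>\<tau>. on_uhp Delta_G \<tau> ^ n)"
  have "F \<in> automorphic_forms (int 8 * k + int n * 8)"
    unfolding F_def by (intro automorphic_forms_mult automorphic_forms_power f Delta_form)
  hence F: "F \<in> automorphic_forms 0" by (simp add: n)
  obtain \<phi> where \<phi>: "\<phi> holomorphic_on ball 0 1" "\<And>\<tau>. \<tau> \<in> upper_half_plane \<Longrightarrow> f \<tau> = \<phi> (nome \<tau>)"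
    by (rule automorphic_formsE[OF f], rule that)
  have "F = 0"
  proof (rule weight_0_cusp_form_zero[OF F])
    show "(\<lambda>w. \<phi> w ^ 8 * (w * delta_unit w) ^ n) holomorphic_on ball 0 1"
      by (intro holomorphic_intros \<phi> int_series_imp_holomorphic[OF int_series_delta_unit])
  qed (use n in \<open>simp_all add: F_def on_uhp_def \<phi> Delta_eq\<close>)
  have "f \<tau> = 0" for \<tau>
  proof (cases "\<tau> \<in> upper_half_plane")
    case True
    have "F \<tau> = 0" by (simp add: \<open>F = 0\<close>)
    thus ?thesis using True Delta_nonzero[OF True] by (simp add: F_def on_uhp_def)
  qed (rule automorphic_forms_off[OF f])
  thus ?thesis by (simp add: fun_eq_iff)
qed

section \<open>Division of integral series\<close>

lemma int_series_imp_fps: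
  assumes "int_series f"
  obtains F where "f has_fps_expansion F" "\<And>n. fps_nth F n \<in> \<int>"
proof -
  obtain a :: "nat \<Rightarrow> int" where a: "\<And>w. norm w < 1 \<Longrightarrow> (\<lambda>n. of_int (a n) * w ^ n) sums f w"
    by (rule int_seriesE[OF assms], rule that)
  have "f has_fps_expansion Abs_fps (\<lambda>n. of_int (a n))"
  proof (rule has_fps_expansionI)
    have "\<forall>\<^sub>F w in nhds 0. w \<in> ball (0::complex) 1"
      by (intro eventually_nhds_in_open) auto
    thus "\<forall>\<^sub>F w in nhds 0. (\<lambda>n. fps_nth (Abs_fps (\<lambda>n. of_int (a n))) n * w ^ n) sums f w"
      by eventually_elim (use a in simp)
  qed
  thus thesis by (rule that) simp
qed

lemma fps_int_imp_int_series:
  assumes "f holomorphic_on ball 0 1" "f has_fps_expansion F" "\<And>n. fps_nth F n \<in> \<int>"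
  shows "int_series f"
proof (rule int_seriesI)
  fix w :: complex assume w: "norm w < 1"
  have "f has_fps_expansion fps_expansion f 0"
    by (rule has_fps_expansion_fps_expansion[OF open_ball _ assms(1)]) simp
  hence "F = fps_expansion f 0" by (rule fps_expansion_unique_complex[OF assms(2)])
  hence c: "(deriv ^^ n) f 0 / fact n = of_int \<lfloor>Re (fps_nth F n)\<rfloor>" for n
    using assms(3)[of n] by (auto simp: fps_expansion_def elim!: Ints_cases)
  show "(\<lambda>n. of_int \<lfloor>Re (fps_nth F n)\<rfloor> * w ^ n) sums f w"
    using holomorphic_power_series[OF assms(1), of w] w by (simp add: c)
qed

text \<open>The coefficients of the quotient satisfy a recursion in which the only divisor is \<open>u 0 = 1\<close>.\<close>
lemma int_series_divide:
  assumes f: "int_series f" and u: "int_series u" and u0: "u 0 = 1"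
    and nz: "\<And>w. norm w < 1 \<Longrightarrow> u w \<noteq> 0"
  shows "int_series (\<lambda>w. f w / u w)"
proof -
  define g where "g w = f w / u w" for w
  have g: "g holomorphic_on ball 0 1"
    unfolding g_def using nz by (intro holomorphic_on_divide int_series_imp_holomorphic f u) auto
  obtain F where F: "f has_fps_expansion F" "\<And>n. fps_nth F n \<in> \<int>" by (rule int_series_imp_fps[OF f], rule that)
  obtain U where U: "u has_fps_expansion U" "\<And>n. fps_nth U n \<in> \<int>" by (rule int_series_imp_fps[OF u], rule that)
  define H where "H = fps_expansion g 0"
  have H: "g has_fps_expansion H" unfolding H_def
    by (rule has_fps_expansion_fps_expansion[OF open_ball _ g]) simp
  have prod: "(\<lambda>w. g w * u w) has_fps_expansion H * U" by (rule has_fps_expansion_mult[OF H U(1)])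
  have ev: "\<forall>\<^sub>F w in nhds 0. g w * u w = f w"
  proof -
    have "\<forall>\<^sub>F w in nhds 0. w \<in> ball (0::complex) 1"
      by (intro eventually_nhds_in_open) auto
    thus ?thesis by eventually_elim (use nz in \<open>simp add: g_def\<close>)
  qed
  have "f has_fps_expansion H * U" by (rule iffD1[OF has_fps_expansion_cong[OF ev refl] prod])
  hence FHU: "F = H * U" by (rule fps_expansion_unique_complex[OF F(1)])
  have U0: "fps_nth U 0 = 1" using has_fps_expansion_imp_0_eq_fps_nth_0[OF U(1)] u0 by simp
  have "fps_nth H n \<in> \<int>" for n
  proof (induction n rule: less_induct)
    case (less n)
    have "fps_nth F n = sum (\<lambda>i. fps_nth H i * fps_nth U (n - i)) {0..n}"
      unfolding FHU by (rule fps_mult_nth)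
    also have "{0..n} = insert n {0..<n}" by auto
    also have "sum (\<lambda>i. fps_nth H i * fps_nth U (n - i)) (insert n {0..<n}) =
       fps_nth H n + sum (\<lambda>i. fps_nth H i * fps_nth U (n - i)) {0..<n}"
      by (subst sum.insert) (simp_all add: U0)
    finally have "fps_nth H n = fps_nth F n - sum (\<lambda>i. fps_nth H i * fps_nth U (n - i)) {0..<n}" by simp
    also have "\<dots> \<in> \<int>" using less by (intro Ints_diff F(2) Ints_sum Ints_mult U(2)) auto
    finally show ?case .
  qed
  from fps_int_imp_int_series[OF g H this] show ?thesis unfolding g_def .
qed

lemma int_series_shift:
  assumes "int_series f" "f 0 = 0"
  obtains g where "int_series g" "\<And>w. norm w < 1 \<Longrightarrow> f w = w * g w"
proof -
  obtain a :: "nat \<Rightarrow> int" where a: "\<And>w. norm w < 1 \<Longrightarrow> (\<lambda>n. of_int (a n) * w ^ n) sums f w"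
    by (rule int_seriesE[OF assms(1)], rule that)
  have "(\<lambda>n. of_int (a n) * (0::complex) ^ n) sums of_int (a 0)"
    using sums_finite[of "{0}" "\<lambda>n. of_int (a n) * (0::complex) ^ n"] by simp
  hence a0: "a 0 = 0" using a[of 0] assms(2) by (metis norm_zero of_int_eq_0_iff sums_unique2 zero_less_one)
  define g where "g w = suminf (\<lambda>n. of_int (a (Suc n)) * w ^ n)" for w :: complex
  have s: "(\<lambda>n. of_int (a (Suc n)) * w ^ n) sums g w \<and> f w = w * g w" if w: "norm w < 1" for w
  proof (cases "w = 0")
    case True
    have "summable (\<lambda>n. of_int (a (Suc n)) * w ^ n)" unfolding True by (rule summable_finite[of "{0}"]) auto
    thus ?thesis using True assms(2) unfolding g_def by (simp add: summable_sums)
  next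
    case False
    have "(\<lambda>n. of_int (a (Suc n)) * w ^ Suc n) sums f w"
      using a[OF w] a0 sums_Suc_iff[of "\<lambda>n. of_int (a n) * w ^ n" "f w"] by simp
    from sums_mult[OF this, of "1 / w"]
    have "(\<lambda>n. of_int (a (Suc n)) * w ^ n) sums (f w / w)" using False by (simp add: mult_ac)
    thus ?thesis unfolding g_def using False by (simp add: sums_iff)
  qed
  have "int_series g" by (rule int_seriesI[where a = "\<lambda>n. a (Suc n)"]) (use s in blast)
  thus thesis by (rule that) (use s in blast)
qed

lemma int_series_at_0:
  assumes "int_series f"
  obtains c :: int where "f 0 = of_int c"
proof -
  obtain a :: "nat \<Rightarrow> int" where a: "\<And>w. norm w < 1 \<Longrightarrow> (\<lambda>n. of_int (a n) * w ^ n) sums f w"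
    by (rule int_seriesE[OF assms], rule that)
  have "(\<lambda>n. of_int (a n) * (0::complex) ^ n) sums of_int (a 0)"
    using sums_finite[of "{0}" "\<lambda>n. of_int (a n) * (0::complex) ^ n"] by simp
  hence "f 0 = of_int (a 0)" using a[of 0] by (metis norm_zero sums_unique2 zero_less_one)
  thus thesis by (rule that)
qed

section \<open>The graded ring\<close>

abbreviation alphaH :: "complex \<Rightarrow> complex" where "alphaH \<equiv> on_uhp alpha"
abbreviation DeltaH :: "complex \<Rightarrow> complex" where "DeltaH \<equiv> on_uhp Delta_G"

definition graded :: "(int \<Rightarrow>\<^sub>0 (complex \<Rightarrow> complex)) set" where
  "graded = carrier forms_ring_Z"

lemma mem_graded_iff:
  "F \<in> graded \<longleftrightarrow> (\<forall>k. Poly_Mapping.lookup F (2 * k) \<in> automorphic_forms k \<and> Poly_Mapping.lookup F (2 * k + 1) = 0)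
     \<and> (\<forall>d. integral_expansion (Poly_Mapping.lookup F d))"
  by (simp add: graded_def forms_ring_Z_def forms_ring_C_def)

lemma integral_expansion_add: "integral_expansion f \<Longrightarrow> integral_expansion g \<Longrightarrow> integral_expansion (f + g)"
  unfolding integral_expansion_iff
proof (elim exE conjE)
  fix \<phi> \<psi> assume "int_series \<phi>" "int_series \<psi>"
    "\<forall>\<tau>\<in>upper_half_plane. f \<tau> = \<phi> (nome \<tau>)" "\<forall>\<tau>\<in>upper_half_plane. g \<tau> = \<psi> (nome \<tau>)"
  thus "\<exists>\<phi>. int_series \<phi> \<and> (\<forall>\<tau>\<in>upper_half_plane. (f + g) \<tau> = \<phi> (nome \<tau>))"
    by (intro exI[of _ "\<lambda>w. \<phi> w + \<psi> w"]) (simp add: int_series_add)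
qed

lemma integral_expansion_mult: "integral_expansion f \<Longrightarrow> integral_expansion g \<Longrightarrow> integral_expansion (f * g)"
  unfolding integral_expansion_iff
proof (elim exE conjE)
  fix \<phi> \<psi> assume "int_series \<phi>" "int_series \<psi>"
    "\<forall>\<tau>\<in>upper_half_plane. f \<tau> = \<phi> (nome \<tau>)" "\<forall>\<tau>\<in>upper_half_plane. g \<tau> = \<psi> (nome \<tau>)"
  thus "\<exists>\<phi>. int_series \<phi> \<and> (\<forall>\<tau>\<in>upper_half_plane. (f * g) \<tau> = \<phi> (nome \<tau>))"
    by (intro exI[of _ "\<lambda>w. \<phi> w * \<psi> w"]) (simp add: int_series_mult)
qed

lemma integral_expansionI: "int_series \<phi> \<Longrightarrow> (\<And>\<tau>. \<tau> \<in> upper_half_plane \<Longrightarrow> f \<tau> = \<phi> (nome \<tau>)) \<Longrightarrow> integral_expansion f"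
  unfolding integral_expansion_iff by (rule exI[of _ \<phi>]) simp

lemma integral_expansion_basic:
  "integral_expansion 0" "integral_expansion (on_uhp (\<lambda>_. of_int c))" "integral_expansion alphaH" "integral_expansion DeltaH"
proof -
  show "integral_expansion 0"
    by (rule integral_expansionI[OF int_series_const[of 0]]) simp
  show "integral_expansion (on_uhp (\<lambda>_. of_int c))"
    by (rule integral_expansionI[OF int_series_const[of c]]) (simp add: on_uhp_def)
  show "integral_expansion alphaH"
    by (rule integral_expansionI[OF int_series_alpha]) (simp add: on_uhp_def alpha_eq)
  show "integral_expansion DeltaH"
    by (rule integral_expansionI[OF int_series_mult[OF int_series_id int_series_delta_unit]]) (simp add: on_uhp_def Delta_eq)
qed

lemma lookup_single_times:
  fixes x :: "'a :: semiring_0" and G :: "int \<Rightarrow>\<^sub>0 'a"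
  shows "Poly_Mapping.lookup (Poly_Mapping.single k x * G) d = x * Poly_Mapping.lookup G (d - k)"
proof -
  have "(Poly_Mapping.lookup G q when d = l + q) = (Poly_Mapping.lookup G q when q = d - l)" for l q :: int
    by (rule when_cong) auto
  hence "Poly_Mapping.lookup (Poly_Mapping.single k x * G) d =
      Sum_any (\<lambda>l. Poly_Mapping.lookup (Poly_Mapping.single k x) l * Poly_Mapping.lookup G (d - l))"
    by (simp add: lookup_mult)
  also have "\<dots> = Sum_any (\<lambda>l. (x * Poly_Mapping.lookup G (d - l)) when l = k)"
    by (rule Sum_any.cong) (simp add: lookup_single when_def)
  finally show ?thesis by simp
qed

lemma graded_add: "F \<in> graded \<Longrightarrow> G \<in> graded \<Longrightarrow> F + G \<in> graded"
  by (simp add: mem_graded_iff lookup_add automorphic_forms_add integral_expansion_add)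

lemma graded_zero: "0 \<in> graded"
  by (simp add: mem_graded_iff automorphic_forms_zero integral_expansion_basic)

lemma graded_single:
  assumes "f \<in> automorphic_forms k" "integral_expansion f"
  shows "Poly_Mapping.single (2 * k) f \<in> graded"
  unfolding mem_graded_iff
proof (intro conjI allI)
  fix j :: int
  have "2 * k \<noteq> 2 * j + 1" by presburger
  thus "Poly_Mapping.lookup (Poly_Mapping.single (2 * k) f) (2 * j + 1) = 0" by (simp add: lookup_single)
qed (use assms in \<open>auto simp: lookup_single when_def automorphic_forms_zero integral_expansion_basic\<close>)

text \<open>Closure under multiplication by homogeneous elements is all that the evaluation map requires, as it is built by Horner's scheme.\<close>
lemma graded_single_times:
  assumes f: "f \<in> automorphic_forms k" "integral_expansion f" and G: "G \<in> graded"
  shows "Poly_Mapping.single (2 * k) f * G \<in> graded"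
  unfolding mem_graded_iff lookup_single_times
proof (intro conjI allI)
  fix j :: int
  have e: "2 * j - 2 * k = 2 * (j - k)" "2 * j + 1 - 2 * k = 2 * (j - k) + 1" by simp_all
  have G': "Poly_Mapping.lookup G (2 * (j - k)) \<in> automorphic_forms (j - k)" "Poly_Mapping.lookup G (2 * (j - k) + 1) = 0"
    using G unfolding mem_graded_iff by blast+
  have "f * Poly_Mapping.lookup G (2 * (j - k)) \<in> automorphic_forms (k + (j - k))"
    by (rule automorphic_forms_mult[OF f(1) G'(1)])
  thus "f * Poly_Mapping.lookup G (2 * j - 2 * k) \<in> automorphic_forms j"
    unfolding e using add_diff_cancel_left'[of k "j - k"] by (simp only: add.commute[of k] diff_add_cancel)
  show "f * Poly_Mapping.lookup G (2 * j + 1 - 2 * k) = 0"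
    unfolding e G' by simp
next
  fix d show "integral_expansion (f * Poly_Mapping.lookup G (d - 2 * k))"
    using G f(2) by (intro integral_expansion_mult) (simp_all add: mem_graded_iff)
qed

text \<open>Evaluation of a polynomial along a ring homomorphism that need not preserve the unit.
  This generality matters here: the unit of the graded ring is the function one on the half plane, extended by zero,
  and is only an idempotent of the ambient type.\<close>
lemma poly_map_poly_hom:
  fixes \<phi> :: "'a :: comm_ring_1 \<Rightarrow> 'b :: comm_ring_1"
  assumes add: "\<And>x y. \<phi> (x + y) = \<phi> x + \<phi> y" and mult: "\<And>x y. \<phi> (x * y) = \<phi> x * \<phi> y"
  shows "poly (map_poly \<phi> (p + q)) b = poly (map_poly \<phi> p) b + poly (map_poly \<phi> q) b"
    and "poly (map_poly \<phi> (p * q)) b = poly (map_poly \<phi> p) b * poly (map_poly \<phi> q) b"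
    and "poly (map_poly \<phi> (pCons c p)) b = \<phi> c + b * poly (map_poly \<phi> p) b"
proof -
  have 0: "\<phi> 0 = 0" using add[of 0 0] by simp
  have A: "poly (map_poly \<phi> (p + q)) b = poly (map_poly \<phi> p) b + poly (map_poly \<phi> q) b" for p q
  proof -
    have "map_poly \<phi> (p + q) = map_poly \<phi> p + map_poly \<phi> q"
      by (rule poly_eqI) (simp add: coeff_map_poly 0 add)
    thus ?thesis by simp
  qed
  have C: "poly (map_poly \<phi> (pCons c p)) b = \<phi> c + b * poly (map_poly \<phi> p) b" for c p
    by (simp add: map_poly_pCons 0)
  have S: "poly (map_poly \<phi> (smult c p)) b = \<phi> c * poly (map_poly \<phi> p) b" for c p
  proof -
    have "map_poly \<phi> (smult c p) = smult (\<phi> c) (map_poly \<phi> p)"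
      by (rule poly_eqI) (simp add: coeff_map_poly 0 mult)
    thus ?thesis by simp
  qed
  show "poly (map_poly \<phi> (p * q)) b = poly (map_poly \<phi> p) b * poly (map_poly \<phi> q) b"
    by (induction p) (simp_all add: A C S 0 algebra_simps)
  show "poly (map_poly \<phi> (p + q)) b = poly (map_poly \<phi> p) b + poly (map_poly \<phi> q) b" by (rule A)
  show "poly (map_poly \<phi> (pCons c p)) b = \<phi> c + b * poly (map_poly \<phi> p) b" by (rule C)
qed

definition ev_const :: "int \<Rightarrow> (int \<Rightarrow>\<^sub>0 (complex \<Rightarrow> complex))" where
  "ev_const c = homog 0 (\<lambda>_. of_int c)"

definition ev_alpha :: "int poly \<Rightarrow> (int \<Rightarrow>\<^sub>0 (complex \<Rightarrow> complex))" where
  "ev_alpha q = poly (map_poly ev_const q) (homog 8 alpha)"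

text \<open>The evaluation \<open>X \<mapsto> \<alpha>\<close>, \<open>Y \<mapsto> \<Delta>\<close>, first in the inner and then in the outer variable.\<close>
definition ev :: "int poly poly \<Rightarrow> (int \<Rightarrow>\<^sub>0 (complex \<Rightarrow> complex))" where
  "ev p = poly (map_poly ev_alpha p) (homog 16 Delta_G)"

lemma ev_const_hom: "ev_const (x + y) = ev_const x + ev_const y" "ev_const (x * y) = ev_const x * ev_const y"
  by (auto simp: ev_const_def homog_def on_uhp_def fun_eq_iff mult_single single_add[symmetric] intro!: arg_cong[of _ _ "Poly_Mapping.single 0"])

lemma ev_const_0: "ev_const 0 = 0"
proof -
  have "on_uhp (\<lambda>_. of_int 0) = 0" by (auto simp: on_uhp_def fun_eq_iff)
  thus ?thesis by (simp add: ev_const_def homog_def)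
qed

lemmas ev_alpha_hom = poly_map_poly_hom[where \<phi> = ev_const and b = "homog 8 alpha", OF ev_const_hom, folded ev_alpha_def]
lemmas ev_hom = poly_map_poly_hom[where \<phi> = ev_alpha and b = "homog 16 Delta_G", OF ev_alpha_hom(1,2), folded ev_def]

lemma ev_alpha_0 [simp]: "ev_alpha 0 = 0" by (simp add: ev_alpha_def)
lemma ev_0 [simp]: "ev 0 = 0" by (simp add: ev_def)

lemma on_uhp_mult: "on_uhp f * on_uhp g = on_uhp (\<lambda>\<tau>. f \<tau> * g \<tau>)"
  by (auto simp: on_uhp_def fun_eq_iff)

lemma ev_alpha_in_graded: "ev_alpha q \<in> graded"
proof (induction q)
  case (pCons c q)
  have "ev_const c \<in> graded" "homog 8 alpha * ev_alpha q \<in> graded"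
    using graded_single[OF automorphic_forms_const integral_expansion_basic(2), of c]
      graded_single_times[OF alpha_form integral_expansion_basic(3) pCons(2)]
    by (simp_all add: ev_const_def homog_def)
  thus ?case unfolding ev_alpha_hom by (rule graded_add)
qed (simp add: graded_zero)

lemma ev_in_graded: "ev p \<in> graded"
proof (induction p)
  case (pCons q p)
  have "homog 16 Delta_G * ev p \<in> graded"
    using graded_single_times[OF Delta_form integral_expansion_basic(4) pCons(2)]
    by (simp add: homog_def)
  thus ?case unfolding ev_hom by (intro graded_add ev_alpha_in_graded)
qed (simp add: graded_zero)

lemma lookup_ev_alpha:
  "Poly_Mapping.lookup (ev_alpha q) (8 * int i) = on_uhp (\<lambda>\<tau>. of_int (coeff q i) * alpha \<tau> ^ i)"
proof -
  have neg: "Poly_Mapping.lookup (ev_alpha q) d = 0" if "d < 0" for q d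
    using that
  proof (induction q arbitrary: d)
    case (pCons c q)
    thus ?case by (simp add: ev_alpha_hom lookup_add ev_const_def homog_def lookup_single lookup_single_times)
  qed simp
  show "Poly_Mapping.lookup (ev_alpha q) (8 * int i) = on_uhp (\<lambda>\<tau>. of_int (coeff q i) * alpha \<tau> ^ i)"
  proof (induction q arbitrary: i)
    case 0
    show ?case by (simp add: on_uhp_def fun_eq_iff)
  next
    case (pCons c q)
    show ?case
    proof (cases i)
      case 0
      thus ?thesis
        using neg[of "-8" q] by (simp add: ev_alpha_hom lookup_add ev_const_def homog_def lookup_single_times)
    next
      case (Suc j)
      have "8 * int i - 8 = 8 * int j" by (simp add: Suc)
      moreover have "Poly_Mapping.lookup (ev_const c) (8 * int i) = 0"
        by (simp add: Suc ev_const_def homog_def lookup_single)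
      ultimately show ?thesis
        unfolding ev_alpha_hom lookup_add homog_def lookup_single_times
        using pCons(2)[of j] by (simp add: on_uhp_mult Suc mult_ac)
    qed
  qed
qed

lemma holomorphic_zero_punctured:
  assumes "\<phi> holomorphic_on ball 0 1" "\<And>w. w \<noteq> 0 \<Longrightarrow> norm w < 1 \<Longrightarrow> \<phi> w = 0"
  shows "\<phi> 0 = (0 :: complex)"
proof -
  have "isCont \<phi> 0"
    using holomorphic_on_imp_continuous_on[OF assms(1)] by (simp add: continuous_on_eq_continuous_at)
  hence "(\<phi> \<longlongrightarrow> \<phi> 0) (at 0)" by (simp add: isCont_def)
  moreover have "\<forall>\<^sub>F w in at 0. \<phi> w = 0"
    using assms(2) unfolding eventually_at by (intro exI[of _ 1]) (simp add: dist_norm)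
  hence "(\<phi> \<longlongrightarrow> 0) (at 0)" by (rule tendsto_eventually)
  ultimately show ?thesis by (rule tendsto_unique[rotated]) simp
qed

text \<open>At the cusp \<open>\<alpha>\<close> is one and \<open>\<Delta>\<close> is zero. So if a polynomial \<open>q + Y p\<close> evaluates to zero, looking at the
  cusp in each degree kills the coefficients of \<open>q\<close>, and then \<open>\<Delta>\<close> can be cancelled.\<close>
lemma ev_injective:
  assumes "ev p = 0"
  shows "p = 0"
  using assms
proof (induction p)
  case (pCons q p)
  let ?G = "ev p"
  have z: "ev_alpha q + homog 16 Delta_G * ?G = 0" using pCons.prems by (simp add: ev_hom)
  have lk: "Poly_Mapping.lookup (ev_alpha q) d + DeltaH * Poly_Mapping.lookup ?G (d - 16) = 0" for d
    using arg_cong[OF z, of "\<lambda>F. Poly_Mapping.lookup F d"] by (simp add: lookup_add homog_def lookup_single_times)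
  have "coeff q i = 0" for i
  proof -
    have e: "8 * int i - 16 = 2 * (4 * int i - 8)" by simp
    have "Poly_Mapping.lookup ?G (8 * int i - 16) \<in> automorphic_forms (4 * int i - 8)"
      using ev_in_graded[of p] unfolding mem_graded_iff e by blast
    then obtain \<psi> where \<psi>: "\<psi> holomorphic_on ball 0 1"
      "\<And>\<tau>. \<tau> \<in> upper_half_plane \<Longrightarrow> Poly_Mapping.lookup ?G (8 * int i - 16) \<tau> = \<psi> (nome \<tau>)"
      by (rule automorphic_formsE) (rule that)
    define \<Phi> where "\<Phi> w = of_int (coeff q i) * alpha_series w ^ i + w * delta_unit w * \<psi> w" for w
    have "\<Phi> 0 = 0"
    proof (rule holomorphic_zero_punctured)
      show "\<Phi> holomorphic_on ball 0 1" unfolding \<Phi>_def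
        by (intro holomorphic_intros \<psi> int_series_imp_holomorphic[OF int_series_alpha] int_series_imp_holomorphic[OF int_series_delta_unit])
      fix w :: complex assume "w \<noteq> 0" "norm w < 1"
      then obtain \<tau> where t: "\<tau> \<in> upper_half_plane" "nome \<tau> = w" by (rule nome_surj)
      have "(Poly_Mapping.lookup (ev_alpha q) (8 * int i) + DeltaH * Poly_Mapping.lookup ?G (8 * int i - 16)) \<tau> = 0"
        unfolding lk by simp
      thus "\<Phi> w = 0"
        unfolding \<Phi>_def t(2)[symmetric] using t(1) \<psi>(2)[OF t(1)]
        by (simp add: lookup_ev_alpha on_uhp_def alpha_eq Delta_eq)
    qed
    thus ?thesis by (simp add: \<Phi>_def series_at_0)
  qed
  hence q: "q = 0" by (simp add: poly_eq_iff)
  have "Poly_Mapping.lookup ?G d = 0" for d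
  proof
    fix \<tau>
    have "DeltaH * Poly_Mapping.lookup ?G d = 0" using lk[of "d + 16"] by (simp add: q)
    hence D: "DeltaH \<tau> * Poly_Mapping.lookup ?G d \<tau> = 0" by (simp add: fun_eq_iff)
    show "Poly_Mapping.lookup ?G d \<tau> = 0 \<tau>"
    proof (cases "\<tau> \<in> upper_half_plane")
      case True
      thus ?thesis using D Delta_nonzero[OF True] by (simp add: on_uhp_def)
    next
      case False
      show ?thesis
      proof (cases "even d")
        case True
        then obtain k where "d = 2 * k" by (rule evenE)
        hence "Poly_Mapping.lookup ?G d \<in> automorphic_forms k" using ev_in_graded[of p] by (simp add: mem_graded_iff)
        thus ?thesis using automorphic_forms_off[OF _ False] by simp
      next
        assume "odd d"
        then obtain k where "d = 2 * k + 1" by (rule oddE)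
        thus ?thesis using ev_in_graded[of p] by (simp add: mem_graded_iff)
      qed
    qed
  qed
  hence "?G = 0" by (intro poly_mapping_eqI) simp
  thus ?case using pCons.IH q by simp
qed simp

lemma ev_alpha_monom: "ev_alpha (monom c n) = Poly_Mapping.single (8 * int n) (on_uhp (\<lambda>\<tau>. of_int c * alpha \<tau> ^ n))"
proof (induction n)
  case 0
  have "ev_alpha (pCons c 0) = ev_const c" unfolding ev_alpha_hom by simp
  thus ?case by (simp add: ev_const_def homog_def monom_0)
next
  case (Suc n)
  have "on_uhp alpha * on_uhp (\<lambda>\<tau>. of_int c * alpha \<tau> ^ n) = on_uhp (\<lambda>\<tau>. of_int c * alpha \<tau> ^ Suc n)"
    by (simp add: on_uhp_mult mult_ac)
  thus ?case unfolding monom_Suc ev_alpha_hom Suc ev_const_0 by (simp add: homog_def mult_single)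
qed

text \<open>A form that vanishes at the cusp is divisible by \<open>\<Delta>\<close>, because \<open>\<Delta>\<close> has no other zero and a simple
  one there. Integrality survives because the unit part of \<open>\<Delta>\<close> has constant term one.\<close>
lemma divide_by_Delta:
  assumes f: "f \<in> automorphic_forms k" and phi: "int_series \<phi>" "\<And>\<tau>. \<tau> \<in> upper_half_plane \<Longrightarrow> f \<tau> = \<phi> (nome \<tau>)"
    and 0: "\<phi> 0 = 0"
  obtains g where "g \<in> automorphic_forms (k - 8)" "integral_expansion g" "f = DeltaH * g"
proof -
  obtain \<eta> where chi: "int_series \<eta>" "\<And>w. norm w < 1 \<Longrightarrow> \<phi> w = w * \<eta> w"
    by (rule int_series_shift[OF phi(1) 0], rule that)
  define \<psi> where "\<psi> w = \<eta> w / delta_unit w" for w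
  have psi: "int_series \<psi>" unfolding \<psi>_def
    by (rule int_series_divide[OF chi(1) int_series_delta_unit series_at_0(2) delta_unit_nonzero])
  define g where "g = on_uhp (\<lambda>\<tau>. f \<tau> / Delta_G \<tau>)"
  have g_psi: "g \<tau> = \<psi> (nome \<tau>)" if "\<tau> \<in> upper_half_plane" for \<tau>
    using that norm_nome_less_1[OF that]
    by (simp add: g_def on_uhp_def phi(2) chi(2) \<psi>_def Delta_eq)
  show thesis
  proof (rule that)
    show "g \<in> automorphic_forms (k - 8)"
    proof (rule automorphic_formsI[OF int_series_imp_holomorphic[OF psi] g_psi])
      fix \<gamma> \<tau> assume gt: "\<gamma> \<in> group_G" "\<tau> \<in> upper_half_plane"
      note reg = group_G_regular[OF gt]
      have "Delta_G (frac_linear \<gamma> \<tau>) = automorphy_factor \<gamma> \<tau> powi 8 * Delta_G \<tau>"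
        using automorphic_forms_law[OF Delta_form gt] gt(2) reg(2) by (simp add: on_uhp_def)
      thus "g (frac_linear \<gamma> \<tau>) = automorphy_factor \<gamma> \<tau> powi (k - 8) * g \<tau>"
        using automorphic_forms_law[OF f gt] gt(2) reg by (simp add: g_def on_uhp_def power_int_diff)
    qed (simp_all add: g_def on_uhp_def)
    show "integral_expansion g" by (rule integral_expansionI[OF psi g_psi])
    show "f = DeltaH * g"
      using Delta_nonzero automorphic_forms_off[OF f] by (auto simp: g_def on_uhp_def fun_eq_iff)
  qed
qed

text \<open>Subtract the multiple of \<open>\<alpha>\<^sup>m\<close> with the same value at the cusp and divide by \<open>\<Delta>\<close>; this lowers the
  weight by eight. Below weight eight the quotient has negative weight and vanishes.\<close>
lemma ev_surjective_homogeneous: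
  assumes "f \<in> automorphic_forms (4 * int m)" "integral_expansion f"
  shows "\<exists>p. ev p = Poly_Mapping.single (8 * int m) f"
  using assms
proof (induction m arbitrary: f rule: less_induct)
  case (less m)
  obtain \<phi> where phi: "int_series \<phi>" "\<And>\<tau>. \<tau> \<in> upper_half_plane \<Longrightarrow> f \<tau> = \<phi> (nome \<tau>)"
    using less.prems(2) unfolding integral_expansion_iff by blast
  obtain c where c: "\<phi> 0 = of_int c" by (rule int_series_at_0[OF phi(1)])
  define M where "M = on_uhp (\<lambda>\<tau>. of_int c * alpha \<tau> ^ m)"
  \<comment> \<open>The correction is added with coefficient \<open>- c\<close>, to stay within sums of forms.\<close>
  define M' where "M' = on_uhp (\<lambda>\<tau>. of_int (- c) * alpha \<tau> ^ m)"
  define f1 where "f1 = f + M'"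
  have f: "f = M + f1" by (simp add: f1_def M_def M'_def on_uhp_def fun_eq_iff)
  have "on_uhp (\<lambda>\<tau>. alphaH \<tau> ^ m) \<in> automorphic_forms (int m * 4)" by (rule automorphic_forms_power[OF alpha_form])
  from automorphic_forms_mult[OF automorphic_forms_const[of "of_int (- c)"] this]
  have "M' \<in> automorphic_forms (4 * int m)" unfolding on_uhp_mult
    by (simp add: M'_def mult.commute on_uhp_def cong: if_cong)
  hence f1: "f1 \<in> automorphic_forms (4 * int m)" unfolding f1_def by (rule automorphic_forms_add[OF less.prems(1)])
  obtain g where g: "g \<in> automorphic_forms (4 * int m - 8)" "integral_expansion g" "f1 = DeltaH * g"
  proof (rule divide_by_Delta[OF f1])
    show "int_series (\<lambda>w. \<phi> w + of_int (- c) * alpha_series w ^ m)"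
      by (rule int_series_add[OF phi(1) int_series_mult[OF int_series_const int_series_power[OF int_series_alpha]]])
    show "f1 \<tau> = \<phi> (nome \<tau>) + of_int (- c) * alpha_series (nome \<tau>) ^ m" if "\<tau> \<in> upper_half_plane" for \<tau>
      using that by (simp add: f1_def M'_def on_uhp_def phi(2) alpha_eq)
    show "\<phi> 0 + of_int (- c) * alpha_series 0 ^ m = 0" by (simp add: c series_at_0)
  qed (rule that)
  have evM: "ev [:monom c m:] = Poly_Mapping.single (8 * int m) M"
    unfolding ev_hom ev_alpha_monom M_def by simp
  have a0: "ev_alpha 0 = 0" by simp
  show ?case
  proof (cases "m < 2")
    case True
    hence "g = 0" by (intro negative_weight_zero[OF g(1)]) simp
    hence "f = M" using f g(3) by simp
    thus ?thesis using evM by blast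
  next
    case False
    have "4 * int m - 8 = 4 * int (m - 2)" using False by simp
    hence "\<exists>p. ev p = Poly_Mapping.single (8 * int (m - 2)) g"
      using False g(1,2) by (intro less.IH) simp_all
    then obtain p where p: "ev p = Poly_Mapping.single (8 * int (m - 2)) g" by blast
    have "16 + 8 * int (m - 2) = 8 * int m" using False by simp
    hence "ev (pCons 0 p) = Poly_Mapping.single (8 * int m) f1"
      unfolding ev_hom(3) p a0 homog_def mult_single g(3) by simp
    hence "ev ([:monom c m:] + pCons 0 p) = Poly_Mapping.single (8 * int m) f"
      unfolding ev_hom(1) evM f by (simp only: single_add)
    thus ?thesis by blast
  qed
qed

lemma ev_surjective:
  assumes F: "F \<in> graded"
  shows "\<exists>p. ev p = F"
proof -
  have single: "\<exists>p. ev p = Poly_Mapping.single d (Poly_Mapping.lookup F d)" for d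
  proof (cases "Poly_Mapping.lookup F d = 0")
    case True
    thus ?thesis by (intro exI[of _ 0]) simp
  next
    case nz: False
    have "even d"
    proof (rule ccontr)
      assume "odd d"
      then obtain k where "d = 2 * k + 1" by (rule oddE)
      thus False using F nz by (simp add: mem_graded_iff)
    qed
    then obtain k where d: "d = 2 * k" by (rule evenE)
    have f: "Poly_Mapping.lookup F d \<in> automorphic_forms k" "integral_expansion (Poly_Mapping.lookup F d)"
      using F by (simp_all add: d mem_graded_iff)
    have "4 dvd k" using weight_multiple_of_4[OF f(1) nz] .
    moreover have "k \<ge> 0" using negative_weight_zero[OF f(1)] nz by (meson not_le)
    ultimately obtain m where "k = 4 * int m" by (metis dvd_def nonneg_int_cases zero_le_mult_iff zero_less_numeral not_numeral_le_zero)
    thus ?thesis using ev_surjective_homogeneous[of "Poly_Mapping.lookup F d" m] f by (simp add: d)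
  qed
  obtain P where P: "\<And>d. ev (P d) = Poly_Mapping.single d (Poly_Mapping.lookup F d)"
    using choice[of "\<lambda>d p. ev p = Poly_Mapping.single d (Poly_Mapping.lookup F d)"] single by blast
  have ev_sum: "ev (sum P A) = sum (\<lambda>d. ev (P d)) A" if "finite A" for A
    using that by (induction A rule: finite_induct) (simp_all add: ev_hom)
  have "ev (sum P (Poly_Mapping.keys F)) = F"
  proof (rule poly_mapping_eqI)
    fix k
    have "Poly_Mapping.lookup (ev (sum P (Poly_Mapping.keys F))) k =
        sum (\<lambda>d. Poly_Mapping.lookup (Poly_Mapping.single d (Poly_Mapping.lookup F d)) k) (Poly_Mapping.keys F)"
      by (simp only: ev_sum[OF finite_keys] lookup_sum P)
    also have "\<dots> = sum (\<lambda>d. if d = k then Poly_Mapping.lookup F k else 0) (Poly_Mapping.keys F)"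
      by (intro sum.cong refl) (simp add: lookup_single when_def)
    also have "\<dots> = Poly_Mapping.lookup F k"
      by (simp add: sum.delta in_keys_iff)
    finally show "Poly_Mapping.lookup (ev (sum P (Poly_Mapping.keys F))) k = Poly_Mapping.lookup F k" .
  qed
  thus ?thesis by blast
qed

lemma Delta_normalized: "normalized_cusp_form 8 (on_uhp Delta_G)"
proof -
  obtain u :: "nat \<Rightarrow> int" where u: "\<And>w. norm w < 1 \<Longrightarrow> (\<lambda>n. of_int (u n) * w ^ n) sums delta_unit w"
    by (rule int_seriesE[OF int_series_delta_unit], rule that)
  have "(\<lambda>n. of_int (u n) * (0::complex) ^ n) sums of_int (u 0)"
    using sums_finite[of "{0}" "\<lambda>n. of_int (u n) * (0::complex) ^ n"] by simp
  hence "of_int (u 0) = delta_unit 0" using u[of 0] by (metis norm_zero sums_unique2 zero_less_one)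
  hence u0: "u 0 = 1" by (simp add: series_at_0)
  define a :: "nat \<Rightarrow> complex" where "a n = (case n of 0 \<Rightarrow> 0 | Suc n \<Rightarrow> of_int (u n))" for n
  have "has_q_expansion (on_uhp Delta_G) a"
    unfolding has_q_expansion_def
  proof
    fix \<tau> assume t: "\<tau> \<in> upper_half_plane"
    from sums_mult[OF u[OF norm_nome_less_1[OF t]], of "nome \<tau>"]
    have "(\<lambda>n. a (Suc n) * nome \<tau> ^ Suc n) sums on_uhp Delta_G \<tau>"
      using t by (simp add: a_def on_uhp_def Delta_eq mult_ac)
    thus "(\<lambda>n. a n * nome \<tau> ^ n) sums on_uhp Delta_G \<tau>"
      by (rule sums_Suc_imp[rotated]) (simp add: a_def)
  qed
  moreover have "a 0 = 0" "a 1 = 1" by (simp_all add: a_def u0)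
  ultimately show ?thesis unfolding normalized_cusp_form_def using Delta_form by blast
qed

theorem proposition4:
  shows "(\<exists>h \<in> ring_iso ZXY forms_ring_Z. h var_X = homog 8 alpha \<and> h var_Y = homog 16 Delta_G) \<and>
         normalized_cusp_form 8 (on_uhp Delta_G)"
proof (intro conjI bexI)
  have a1: "ev_alpha 1 = ev_const 1" unfolding one_pCons ev_alpha_hom by simp
  have unit: "homog d f * ev_const 1 = homog d f" for d f
    by (simp add: ev_const_def homog_def mult_single on_uhp_mult)
  have aX: "ev_alpha [:0, 1:] = homog 8 alpha"
    unfolding ev_alpha_hom ev_const_0 using unit by simp
  show "ev var_X = homog 8 alpha" unfolding var_X_def ev_hom aX by simp
  have "ev [:0, 1:] = ev_alpha 0 + homog 16 Delta_G * (ev_alpha 1 + homog 16 Delta_G * ev 0)" unfolding ev_hom ..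
  thus "ev var_Y = homog 16 Delta_G" unfolding var_Y_def a1 by (simp add: unit)
  show "ev \<in> ring_iso ZXY forms_ring_Z"
  proof (rule ring_iso_memI)
    show "ev x \<in> carrier forms_ring_Z" for x using ev_in_graded by (simp add: graded_def)
    show "ev (x \<otimes>\<^bsub>ZXY\<^esub> y) = ev x \<otimes>\<^bsub>forms_ring_Z\<^esub> ev y" for x y
      by (simp add: ZXY_def cring_class_ops_def forms_ring_Z_def forms_ring_C_def ev_hom(2))
    show "ev (x \<oplus>\<^bsub>ZXY\<^esub> y) = ev x \<oplus>\<^bsub>forms_ring_Z\<^esub> ev y" for x y
      by (simp add: ZXY_def cring_class_ops_def forms_ring_Z_def forms_ring_C_def ev_hom(1))
    have "ev 1 = ev_const 1" unfolding one_pCons[where 'a = "int poly"] ev_hom a1 by simp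
    thus "ev \<one>\<^bsub>ZXY\<^esub> = \<one>\<^bsub>forms_ring_Z\<^esub>"
      by (simp add: ZXY_def cring_class_ops_def forms_ring_Z_def forms_ring_C_def ev_const_def)
    have "inj ev"
    proof (rule injI)
      fix p q assume "ev p = ev q"
      hence "ev (p - q) = 0" using ev_hom(1)[of "p - q" q] by simp
      thus "p = q" using ev_injective by fastforce
    qed
    moreover have "range ev = graded" using ev_in_graded ev_surjective by blast
    ultimately show "bij_betw ev (carrier ZXY) (carrier forms_ring_Z)"
      by (simp add: bij_betw_def graded_def ZXY_def cring_class_ops_def)
  qed
qed (rule Delta_normalized)

end
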